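(* A multicategory $\mathcal M$ is exponentiable in $\mathbf{Mlt}$ if and only if it is promonoidal. In particular, every representable multicategory and every sequential multicategory is exponentiable, while for every non-empty category $\mathcal C$ the unary multicategory $\mathcal C^-$ is not exponentiable.
   Context: A (plain) multicategory $\mathcal M$ has objects, sets $\mathcal M(A_1,\dots,A_n;A)$ of $n$-ary arrows ($n\ge 0$), identities, and associative unital composition $f(f_1,\dots,f_n)$. $\mathbf{Mlt}$ is the category of (small) multicategories and functors; it has finite products, computed in the obvious way ($(\mathcal M\times\mathcal N)((A_1,B_1),\dots,(A_n,B_n);(A,B))=\mathcal M(A_1,\dots,A_n;A)\times\mathcal N(B_1,\dots,B_n;B)$). $\mathcal M$ is exponentiable if $\mathcal M\times -:\mathbf{Mlt}\to\mathbf{Mlt}$ has a right adjoint. $\mathcal M_-$ denotes the category of objects and unary arrows of $\mathcal M$. $\mathcal M$ is promonoidal if arrows decompose essentially uniquely, i.e. for all double sequences of objects $A_{i1},\dots,A_{im_i}$ ($1\le i\le n$, $n\ge 0$, $m_i\ge 0$) and every object $B$, composition induces a bijection $$\int^{A_1,\dots,A_n\in\mathcal M_-}\mathcal M(A_1,\dots,A_n;B)\times\prod_{i=1}^n\mathcal M(A_{i1},\dots,A_{im_i};A_i)\ \longrightarrow\ \mathcal M(A_{11},\dots,A_{nm_n};B).$$ An arrow $u:A_1,\dots,A_n\to A$ is preuniversal if composition with $u$ gives a bijection $\mathcal M(A;B)\to\mathcal M(A_1,\dots,A_n;B)$ for every $B$; $\mathcal M$ is representable if every finite sequence of objects is the domain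 of a preuniversal arrow and preuniversal arrows are closed under composition. For a category $\mathcal C$, $\mathcal C^-$ is the multicategory with the same objects, $\mathcal C^-(X;Y)=\mathcal C(X;Y)$, and no $n$-ary arrows for $n\ne1$. $\mathcal C_\blacktriangleright$ is the multicategory with the same objects, $\mathcal C_\blacktriangleright(X_1,\dots,X_n;X)=\mathcal C(X_1;X)\times\cdots\times\mathcal C(X_n;X)$, with composition $\langle f_1,\dots,f_n\rangle(\langle g_{11},\dots,g_{1m_1}\rangle,\dots,\langle g_{n1},\dots,g_{nm_n}\rangle)=\langle f_1g_{11},\dots,f_1g_{1m_1},\dots,f_ng_{n1},\dots,f_ng_{nm_n}\rangle$. A multicategory is sequential if it is isomorphic to $\mathcal C_\blacktriangleright$ for some category $\mathcal C$. *)

theory Defs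
  imports Main
begin

unbundle cardinal_syntax

section \<open>Small sets\<close>

text \<open>
  HOL has no class of all sets, so ``small'' is relative to a type \<open>'u\<close> playing the role of the
  universe: the objects and arrows of all multicategories in the category of small multicategories
  are elements of \<open>'u\<close>, and small means of cardinality below that of \<open>'u\<close>.
  The assumption on \<open>'u\<close> is that its cardinal is infinite, regular and a strong limit. If \<open>'u\<close> is
  uncountable, this is the usual (Grothendieck) notion of universe. Uncountability is not imposed;
  for a countable \<open>'u\<close>, small means finite.
\<close>

definition small :: "'u set \<Rightarrow> bool" where
  "small A \<longleftrightarrow> |A| <o |UNIV :: 'u set|"

definition universe :: "'u itself \<Rightarrow> bool" where
  "universe _ \<longleftrightarrow>
     infinite (UNIV :: 'u set) \<and>
     regularCard |UNIV :: 'u set| \<and>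
     (\<forall>A :: 'u set. small A \<longrightarrow> |Pow A| <o |UNIV :: 'u set| )"

text \<open>An arbitrary coding of pairs in the universe; it is injective as soon as \<open>'u\<close> is infinite.\<close>

definition upair :: "'u \<Rightarrow> 'u \<Rightarrow> 'u" where
  "upair = curry (SOME p. inj p)"

definition ufst :: "'u \<Rightarrow> 'u" where
  "ufst z = fst (inv (case_prod upair) z)"

definition usnd :: "'u \<Rightarrow> 'u" where
  "usnd z = snd (inv (case_prod upair) z)"


section \<open>Categories\<close>

text \<open>\<open>Cmp C f g\<close> is the composite ``\<open>f\<close> after \<open>g\<close>''.\<close>

record ('o, 'a) cat =
  Ob :: "'o set"
  Ar :: "'a set"
  Src :: "'a \<Rightarrow> 'o"
  Tgt :: "'a \<Rightarrow> 'o"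
  Idn :: "'o \<Rightarrow> 'a"
  Cmp :: "'a \<Rightarrow> 'a \<Rightarrow> 'a"

definition hom :: "('o, 'a) cat \<Rightarrow> 'o \<Rightarrow> 'o \<Rightarrow> 'a set" where
  "hom C X Y = {f \<in> Ar C. Src C f = X \<and> Tgt C f = Y}"

locale category =
  fixes C :: "('o, 'a) cat"
  assumes src_ob: "f \<in> Ar C \<Longrightarrow> Src C f \<in> Ob C"
    and tgt_ob: "f \<in> Ar C \<Longrightarrow> Tgt C f \<in> Ob C"
    and idn_hom: "X \<in> Ob C \<Longrightarrow> Idn C X \<in> hom C X X"
    and cmp_hom: "\<lbrakk>f \<in> hom C Y Z; g \<in> hom C X Y\<rbrakk> \<Longrightarrow> Cmp C f g \<in> hom C X Z"
    and idn_left: "f \<in> hom C X Y \<Longrightarrow> Cmp C (Idn C Y) f = f"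
    and idn_right: "f \<in> hom C X Y \<Longrightarrow> Cmp C f (Idn C X) = f"
    and cmp_assoc: "\<lbrakk>f \<in> hom C Y Z; g \<in> hom C X Y; h \<in> hom C W X\<rbrakk>
                      \<Longrightarrow> Cmp C (Cmp C f g) h = Cmp C f (Cmp C g h)"

definition small_category :: "('u, 'u) cat \<Rightarrow> bool" where
  "small_category C \<longleftrightarrow>
     category C \<and> small (Ob C) \<and> (\<forall>X\<in>Ob C. \<forall>Y\<in>Ob C. small (hom C X Y))"

definition is_functor ::
  "('o, 'a) cat \<Rightarrow> ('p, 'b) cat \<Rightarrow> ('o \<Rightarrow> 'p) \<Rightarrow> ('a \<Rightarrow> 'b) \<Rightarrow> bool" where
  "is_functor C D Fo Fa \<longleftrightarrow>
     (\<forall>X\<in>Ob C. Fo X \<in> Ob D) \<and>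
     (\<forall>X\<in>Ob C. \<forall>Y\<in>Ob C. \<forall>f\<in>hom C X Y. Fa f \<in> hom D (Fo X) (Fo Y)) \<and>
     (\<forall>X\<in>Ob C. Fa (Idn C X) = Idn D (Fo X)) \<and>
     (\<forall>f\<in>Ar C. \<forall>g\<in>Ar C. Tgt C g = Src C f \<longrightarrow> Fa (Cmp C f g) = Cmp D (Fa f) (Fa g))"

text \<open>
  The functor \<open>(Fo, Fa) : C \<rightarrow> D\<close> has a right adjoint \<open>(Go, Ga)\<close>, with bijections
  \<open>\<phi> X Y : D(F X, Y) \<rightarrow> C(X, G Y)\<close> natural in both arguments.
\<close>

definition has_right_adjoint ::
  "('o, 'a) cat \<Rightarrow> ('p, 'b) cat \<Rightarrow> ('o \<Rightarrow> 'p) \<Rightarrow> ('a \<Rightarrow> 'b) \<Rightarrow> bool" where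
  "has_right_adjoint C D Fo Fa \<longleftrightarrow>
     (\<exists>Go Ga \<phi>. is_functor D C Go Ga \<and>
        (\<forall>X\<in>Ob C. \<forall>Y\<in>Ob D. bij_betw (\<phi> X Y) (hom D (Fo X) Y) (hom C X (Go Y))) \<and>
        (\<forall>X\<in>Ob C. \<forall>X'\<in>Ob C. \<forall>Y\<in>Ob D. \<forall>Y'\<in>Ob D.
           \<forall>h\<in>hom C X' X. \<forall>g\<in>hom D (Fo X) Y. \<forall>k\<in>hom D Y Y'.
             \<phi> X' Y' (Cmp D k (Cmp D g (Fa h))) = Cmp C (Ga k) (Cmp C (\<phi> X Y g) h)))"


section \<open>Multicategories\<close>

text \<open>\<open>Comp M f [g\<^sub>1, \<dots>, g\<^sub>n]\<close> is the composite \<open>f(g\<^sub>1, \<dots>, g\<^sub>n)\<close>.\<close>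

record ('o, 'a) mcat =
  Obj :: "'o set"
  Arr :: "'a set"
  Dom :: "'a \<Rightarrow> 'o list"
  Cod :: "'a \<Rightarrow> 'o"
  Ident :: "'o \<Rightarrow> 'a"
  Comp :: "'a \<Rightarrow> 'a list \<Rightarrow> 'a"

definition mhom :: "('o, 'a) mcat \<Rightarrow> 'o list \<Rightarrow> 'o \<Rightarrow> 'a set" where
  "mhom M As B = {f \<in> Arr M. Dom M f = As \<and> Cod M f = B}"

definition composable :: "('o, 'a) mcat \<Rightarrow> 'a \<Rightarrow> 'a list \<Rightarrow> bool" where
  "composable M f gs \<longleftrightarrow> f \<in> Arr M \<and> set gs \<subseteq> Arr M \<and> map (Cod M) gs = Dom M f"

locale multicategory =
  fixes M :: "('o, 'a) mcat"
  assumes dom_obj: "f \<in> Arr M \<Longrightarrow> set (Dom M f) \<subseteq> Obj M"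
    and cod_obj: "f \<in> Arr M \<Longrightarrow> Cod M f \<in> Obj M"
    and ident_hom: "A \<in> Obj M \<Longrightarrow> Ident M A \<in> mhom M [A] A"
    and comp_hom: "composable M f gs
                     \<Longrightarrow> Comp M f gs \<in> mhom M (concat (map (Dom M) gs)) (Cod M f)"
    and ident_left: "f \<in> Arr M \<Longrightarrow> Comp M (Ident M (Cod M f)) [f] = f"
    and ident_right: "f \<in> Arr M \<Longrightarrow> Comp M f (map (Ident M) (Dom M f)) = f"
    and comp_assoc: "\<lbrakk>composable M f gs; list_all2 (composable M) gs hss\<rbrakk>
                       \<Longrightarrow> Comp M (Comp M f gs) (concat hss) = Comp M f (map2 (Comp M) gs hss)"

text \<open>
  Smallness is imposed hom-wise. For uncountable \<open>'u\<close> this amounts to the set of all arrows being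
  small, as there is then only a small set of lists over a small set of objects.
\<close>

definition small_multicategory :: "('u, 'u) mcat \<Rightarrow> bool" where
  "small_multicategory M \<longleftrightarrow>
     multicategory M \<and> small (Obj M) \<and>
     (\<forall>As B. set As \<subseteq> Obj M \<longrightarrow> B \<in> Obj M \<longrightarrow> small (mhom M As B))"

definition is_mfunctor ::
  "('o, 'a) mcat \<Rightarrow> ('p, 'b) mcat \<Rightarrow> ('o \<Rightarrow> 'p) \<Rightarrow> ('a \<Rightarrow> 'b) \<Rightarrow> bool" where
  "is_mfunctor M N Fo Fa \<longleftrightarrow>
     (\<forall>A\<in>Obj M. Fo A \<in> Obj N) \<and>
     (\<forall>f\<in>Arr M. Fa f \<in> mhom N (map Fo (Dom M f)) (Fo (Cod M f))) \<and>
     (\<forall>A\<in>Obj M. Fa (Ident M A) = Ident N (Fo A)) \<and>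
     (\<forall>f gs. composable M f gs \<longrightarrow> Fa (Comp M f gs) = Comp N (Fa f) (map Fa gs))"

definition mcat_isomorphic :: "('o, 'a) mcat \<Rightarrow> ('p, 'b) mcat \<Rightarrow> bool" where
  "mcat_isomorphic M N \<longleftrightarrow>
     (\<exists>Fo Fa Go Ga. is_mfunctor M N Fo Fa \<and> is_mfunctor N M Go Ga \<and>
        (\<forall>A\<in>Obj M. Go (Fo A) = A) \<and> (\<forall>f\<in>Arr M. Ga (Fa f) = f) \<and>
        (\<forall>A\<in>Obj N. Fo (Go A) = A) \<and> (\<forall>f\<in>Arr N. Fa (Ga f) = f))"


section \<open>The category of small multicategories\<close>

text \<open>
  A functor, packaged with its source and target. Its action is taken to be \<open>undefined\<close> outside
  the source, so that functors with equal action on the source are equal.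
\<close>

record ('o, 'a) mlt_arrow =
  source :: "('o, 'a) mcat"
  target :: "('o, 'a) mcat"
  omap :: "'o \<Rightarrow> 'o"
  amap :: "'a \<Rightarrow> 'a"

definition restr :: "'a set \<Rightarrow> ('a \<Rightarrow> 'b) \<Rightarrow> 'a \<Rightarrow> 'b" where
  "restr A f = (\<lambda>x. if x \<in> A then f x else undefined)"

definition mk_mlt_arrow ::
  "('o, 'a) mcat \<Rightarrow> ('o, 'a) mcat \<Rightarrow> ('o \<Rightarrow> 'o) \<Rightarrow> ('a \<Rightarrow> 'a) \<Rightarrow> ('o, 'a) mlt_arrow" where
  "mk_mlt_arrow M N Fo Fa =
     \<lparr>source = M, target = N, omap = restr (Obj M) Fo, amap = restr (Arr M) Fa\<rparr>"

definition Mlt :: "(('u, 'u) mcat, ('u, 'u) mlt_arrow) cat" where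
  "Mlt = \<lparr>Ob = {M. small_multicategory M},
          Ar = {mk_mlt_arrow M N Fo Fa | M N Fo Fa.
                  small_multicategory M \<and> small_multicategory N \<and> is_mfunctor M N Fo Fa},
          Src = source,
          Tgt = target,
          Idn = (\<lambda>M. mk_mlt_arrow M M id id),
          Cmp = (\<lambda>G F. mk_mlt_arrow (source F) (target G) (omap G \<circ> omap F) (amap G \<circ> amap F))\<rparr>"

text \<open>The product in \<open>Mlt\<close>, with pairs coded in \<open>'u\<close>, and its action on functors \<open>M \<times> F\<close>.\<close>

definition mlt_times :: "('u, 'u) mcat \<Rightarrow> ('u, 'u) mcat \<Rightarrow> ('u, 'u) mcat" where
  "mlt_times M N =
     \<lparr>Obj = {upair A B | A B. A \<in> Obj M \<and> B \<in> Obj N},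
      Arr = {upair f g | f g. f \<in> Arr M \<and> g \<in> Arr N \<and> length (Dom M f) = length (Dom N g)},
      Dom = (\<lambda>h. map2 upair (Dom M (ufst h)) (Dom N (usnd h))),
      Cod = (\<lambda>h. upair (Cod M (ufst h)) (Cod N (usnd h))),
      Ident = (\<lambda>X. upair (Ident M (ufst X)) (Ident N (usnd X))),
      Comp = (\<lambda>h ks. upair (Comp M (ufst h) (map ufst ks)) (Comp N (usnd h) (map usnd ks)))\<rparr>"

definition mlt_times_arrow :: "('u, 'u) mcat \<Rightarrow> ('u, 'u) mlt_arrow \<Rightarrow> ('u, 'u) mlt_arrow" where
  "mlt_times_arrow M F =
     mk_mlt_arrow (mlt_times M (source F)) (mlt_times M (target F))
       (\<lambda>X. upair (ufst X) (omap F (usnd X)))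
       (\<lambda>h. upair (ufst h) (amap F (usnd h)))"

definition exponentiable :: "('u, 'u) mcat \<Rightarrow> bool" where
  "exponentiable M \<longleftrightarrow> has_right_adjoint Mlt Mlt (mlt_times M) (mlt_times_arrow M)"


section \<open>Promonoidal multicategories\<close>

definition unary_cat :: "('o, 'a) mcat \<Rightarrow> ('o, 'a) cat" where
  "unary_cat M =
     \<lparr>Ob = Obj M,
      Ar = {f \<in> Arr M. length (Dom M f) = 1},
      Src = (\<lambda>f. hd (Dom M f)),
      Tgt = Cod M,
      Idn = Ident M,
      Cmp = (\<lambda>f g. Comp M f [g])\<rparr>"

text \<open>
  Fix a double sequence \<open>\<Gamma>s = [\<Gamma>\<^sub>1, \<dots>, \<Gamma>\<^sub>n]\<close> of objects and an object \<open>B\<close>. The coend over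
  \<open>A\<^sub>1, \<dots>, A\<^sub>n\<close> of the sets \<open>M(A\<^sub>1, \<dots>, A\<^sub>n; B) \<times> \<Prod>\<^sub>i M(\<Gamma>\<^sub>i; A\<^sub>i)\<close> is the quotient of their disjoint
  union \<open>decomps\<close> by the equivalence relation generated by
  \<open>(f, u\<^sub>1 g\<^sub>1, \<dots>, u\<^sub>n g\<^sub>n) \<sim> (f(u\<^sub>1, \<dots>, u\<^sub>n), g\<^sub>1, \<dots>, g\<^sub>n)\<close>, for unary arrows \<open>u\<^sub>i\<close>.
\<close>

definition decomps :: "('o, 'a) mcat \<Rightarrow> 'o list list \<Rightarrow> 'o \<Rightarrow> ('a \<times> 'a list) set" where
  "decomps M \<Gamma>s B = {(f, gs). composable M f gs \<and> Cod M f = B \<and> map (Dom M) gs = \<Gamma>s}"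

definition coend_step ::
  "('o, 'a) mcat \<Rightarrow> 'o list list \<Rightarrow> 'o \<Rightarrow> (('a \<times> 'a list) \<times> ('a \<times> 'a list)) set" where
  "coend_step M \<Gamma>s B =
     {((f, map2 (\<lambda>u g. Comp M u [g]) us gs), (Comp M f us, gs)) | f us gs.
        composable M f us \<and> Cod M f = B \<and> set us \<subseteq> Ar (unary_cat M) \<and>
        set gs \<subseteq> Arr M \<and> map (Cod M) gs = map (Src (unary_cat M)) us \<and> map (Dom M) gs = \<Gamma>s}"

definition coend_rel ::
  "('o, 'a) mcat \<Rightarrow> 'o list list \<Rightarrow> 'o \<Rightarrow> (('a \<times> 'a list) \<times> ('a \<times> 'a list)) set" where
  "coend_rel M \<Gamma>s B = Restr ((coend_step M \<Gamma>s B \<union> (coend_step M \<Gamma>s B)\<inverse>)\<^sup>*) (decomps M \<Gamma>s B)"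

text \<open>
  Composition is constant on the classes, so \<open>the_elem\<close> of the image of a class is the value of
  the induced map on it.
\<close>

definition promonoidal :: "('o, 'a) mcat \<Rightarrow> bool" where
  "promonoidal M \<longleftrightarrow>
     (\<forall>\<Gamma>s B. (\<forall>\<Gamma>\<in>set \<Gamma>s. set \<Gamma> \<subseteq> Obj M) \<longrightarrow> B \<in> Obj M \<longrightarrow>
        bij_betw (\<lambda>X. the_elem ((\<lambda>(f, gs). Comp M f gs) ` X))
          (decomps M \<Gamma>s B // coend_rel M \<Gamma>s B)
          (mhom M (concat \<Gamma>s) B))"


section \<open>Representable, sequential and unary multicategories\<close>

definition preuniversal :: "('o, 'a) mcat \<Rightarrow> 'a \<Rightarrow> bool" where
  "preuniversal M u \<longleftrightarrow>
     u \<in> Arr M \<and>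
     (\<forall>B\<in>Obj M. bij_betw (\<lambda>f. Comp M f [u]) (mhom M [Cod M u] B) (mhom M (Dom M u) B))"

definition representable :: "('o, 'a) mcat \<Rightarrow> bool" where
  "representable M \<longleftrightarrow>
     (\<forall>As. set As \<subseteq> Obj M \<longrightarrow> (\<exists>u. preuniversal M u \<and> Dom M u = As)) \<and>
     (\<forall>u us. composable M u us \<and> preuniversal M u \<and> (\<forall>v\<in>set us. preuniversal M v)
        \<longrightarrow> preuniversal M (Comp M u us))"

text \<open>
  The arrow \<open>(fs, X)\<close> is the tuple \<open>fs\<close> of arrows with target \<open>X\<close>; the component \<open>X\<close> is needed to
  keep the empty tuples over different objects apart.
\<close>

definition seq_mcat :: "('o, 'a) cat \<Rightarrow> ('o, 'a list \<times> 'o) mcat" where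
  "seq_mcat C =
     \<lparr>Obj = Ob C,
      Arr = {(fs, X). X \<in> Ob C \<and> set fs \<subseteq> Ar C \<and> (\<forall>f\<in>set fs. Tgt C f = X)},
      Dom = (\<lambda>(fs, X). map (Src C) fs),
      Cod = snd,
      Ident = (\<lambda>X. ([Idn C X], X)),
      Comp = (\<lambda>(fs, X) gs. (concat (map2 (\<lambda>f (hs, _). map (Cmp C f) hs) fs gs), X))\<rparr>"

text \<open>
  It is no restriction that \<open>C\<close> lives on the same types as \<open>M\<close>, because an isomorphism makes \<open>C\<close>
  isomorphic to the category of unary arrows of \<open>M\<close>.
\<close>

definition sequential :: "('o, 'a) mcat \<Rightarrow> bool" where
  "sequential M \<longleftrightarrow> (\<exists>C :: ('o, 'a) cat. category C \<and> mcat_isomorphic M (seq_mcat C))"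

definition unary_mcat :: "('o, 'a) cat \<Rightarrow> ('o, 'a) mcat" where
  "unary_mcat C =
     \<lparr>Obj = Ob C,
      Arr = Ar C,
      Dom = (\<lambda>f. [Src C f]),
      Cod = Tgt C,
      Ident = Idn C,
      Comp = (\<lambda>f gs. Cmp C f (hd gs))\<rparr>"

end

theory Submission
  imports Defs "HOL-Library.FuncSet"
begin

text \<open>
  \<open>M\<close> is exponentiable iff for every \<open>N\<close> there is a universal bifunctor \<open>ev : M \<times> E \<rightarrow> N\<close>. If \<open>M\<close>
  is promonoidal, the objects of \<open>E\<close> are the functors \<open>M\<^sub>- \<rightarrow> N\<^sub>-\<close>, and its \<open>n\<close>-ary arrows are the
  families \<open>\<alpha>\<^sub>f\<close>, indexed by the \<open>n\<close>-ary arrows \<open>f\<close> of \<open>M\<close>, that are natural in unary arrows. The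
  composite \<open>\<alpha>(\<beta>\<^sub>1, \<dots>, \<beta>\<^sub>n)\<close> is evaluated at \<open>h\<close> by decomposing \<open>h = f(g\<^sub>1, \<dots>, g\<^sub>n)\<close>; naturality
  makes the result depend only on the class of \<open>(f, g\<^sub>1, \<dots>, g\<^sub>n)\<close> in the coend.

  Conversely, let \<open>K\<close> consist of a lower copy of \<open>M\<close>, an upper copy of \<open>M\<^sub>-\<close>, and the coend
  classes \<open>[f, g\<^sub>1, \<dots>, g\<^sub>n]\<close> as arrows from lower to upper objects. The exponential of \<open>K\<close> has an
  \<open>m\<close>-ary arrow \<open>t\<^sub>m\<close> that evaluates at \<open>g\<close> to its lower copy, and an \<open>n\<close>-ary arrow \<open>x\<close> that
  evaluates at \<open>f\<close> to \<open>[f, id, \<dots>, id]\<close>. Evaluation of \<open>x(t\<^sub>m, \<dots>, t\<^sub>m')\<close> gives a map \<open>r\<close> with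
  \<open>r(f(g\<^sub>1, \<dots>, g\<^sub>n)) = [f, g\<^sub>1, \<dots>, g\<^sub>n]\<close>, so composition is injective on classes. That \<open>r(h)\<close> is a
  class of decompositions of \<open>h\<close> with the prescribed arities follows from uniqueness of
  transposes, applied to the composition functor \<open>K \<rightarrow> M\<close> and to the functor from \<open>K\<close> to the same
  construction for the terminal multicategory, which records arities.
\<close>

section \<open>Smallness over arbitrary types\<close>

text \<open>Nothing explicit is known about the exponential of an arbitrary \<open>M\<close>, so the
  converse can only test it from outside. An object of \<open>E\<close> is a functor
  \<open>comm {1} \<rightarrow> E\<close>, and an n-ary arrow with equal inputs is a functor
  \<open>corolla n \<rightarrow> E\<close>; by transposition these are bifunctors to
  \<open>N\<close>. Since \<open>M \<times> comm {1}\<close> retains only the unary arrows of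
  \<open>M\<close>, objects of \<open>E\<close> must be functors on \<open>M\<^sub>-\<close>.

  The obstacle is surjectivity. Evaluation of \<open>x(t, ..., t)\<close> assigns a formal composite
  to every \<open>h\<close> of the right total arity, but nothing in \<open>K\<close> says that it
  composes to \<open>h\<close>. The remedy is to map the generic arrows into further exponentials,
  where they can be identified with arrows of known value; the identification then extends to their
  composites, even at an \<open>h\<close> not known to decompose. The collage of the terminal
  multicategory supplies these known arrows: there the composite is the single arrow
  \<open>Mix n ms\<close>.\<close>

definition esmall :: "'u itself \<Rightarrow> 'a set \<Rightarrow> bool" where
  "esmall _ A \<longleftrightarrow> |A| <o |UNIV :: 'u set|"

lemma esmall_small: "esmall TYPE('u) (A :: 'u set) \<longleftrightarrow> small A"
  by (simp add: esmall_def small_def)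

lemma esmall_subset: "esmall TYPE('u) B \<Longrightarrow> A \<subseteq> B \<Longrightarrow> esmall TYPE('u) A"
  unfolding esmall_def using card_of_mono1 ordLeq_ordLess_trans by blast

lemma esmall_image: "esmall TYPE('u) A \<Longrightarrow> esmall TYPE('u) (f ` A)"
  unfolding esmall_def using card_of_image ordLeq_ordLess_trans by blast

lemma esmall_inj_on: "inj_on f A \<Longrightarrow> f ` A \<subseteq> B \<Longrightarrow> esmall TYPE('u) B \<Longrightarrow> esmall TYPE('u) A"
  unfolding esmall_def by (metis card_of_ordLeq ordLeq_ordLess_trans)

lemma infinite_universe: "universe TYPE('u) \<Longrightarrow> infinite (UNIV :: 'u set)"
  by (simp add: universe_def)

lemma esmall_finite: "universe TYPE('u) \<Longrightarrow> finite A \<Longrightarrow> esmall TYPE('u) A"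
  unfolding esmall_def
  by (rule finite_ordLess_infinite)
    (use card_of_Well_order in \<open>auto simp: infinite_universe Field_card_of\<close>)

text \<open>This is the form in which regularity of the universe enters.\<close>

lemma esmall_UNION:
  assumes "universe TYPE('u)" "esmall TYPE('u) I" "\<And>i. i \<in> I \<Longrightarrow> esmall TYPE('u) (A i)"
  shows "esmall TYPE('u) (\<Union>i\<in>I. A i)"
  unfolding esmall_def
proof (rule card_of_UNION_ordLess_infinite_Field_regularCard)
  show "Cinfinite |UNIV :: 'u set|"
    using infinite_universe[OF assms(1)] card_of_Card_order unfolding cinfinite_def
      by (simp add: Field_card_of)
qed (use assms in \<open>auto simp: esmall_def universe_def\<close>)

lemma esmall_Un:
  assumes "universe TYPE('u)" "esmall TYPE('u) A" "esmall TYPE('u) B"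
  shows "esmall TYPE('u) (A \<union> B)"
  using assms infinite_universe[OF assms(1)] card_of_Un_ordLess_infinite unfolding esmall_def
    by blast

lemma esmall_Sigma:
  assumes "universe TYPE('u)" "esmall TYPE('u) A" "\<And>x. x \<in> A \<Longrightarrow> esmall TYPE('u) (B x)"
  shows "esmall TYPE('u) (Sigma A B)"
proof -
  have "Sigma A B = (\<Union>x\<in>A. Pair x ` B x)" by auto
  then show ?thesis using assms by (auto intro!: esmall_UNION esmall_image)
qed

text \<open>The strong limit assumption speaks of subsets of \<open>'u\<close> only, so
  \<open>A\<close> is first embedded in \<open>'u\<close>.\<close>

lemma esmall_Pow:
  assumes U: "universe TYPE('u)" and A: "esmall TYPE('u) A"
  shows "esmall TYPE('u) (Pow A)"
proof -
  obtain i :: "'a \<Rightarrow> 'u" where i: "inj_on i A"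
    using A card_of_ordLeq[of A "UNIV :: 'u set"] ordLess_imp_ordLeq unfolding esmall_def by blast
  have "small (i ` A)" using esmall_image[OF A, of i] by (simp add: esmall_small)
  then have P: "esmall TYPE('u) (Pow (i ` A))" using U by (simp add: universe_def esmall_def)
  have "inj_on (image i) (Pow A)" using i by (simp add: inj_on_image_Pow)
  then show ?thesis by (rule esmall_inj_on[OF _ _ P]) auto
qed

text \<open>An extensional function is determined by its graph over \<open>A\<close>, so the bound
  comes from the power set of \<open>A \<times> B\<close>.\<close>

lemma esmall_PiE:
  assumes U: "universe TYPE('u)" and A: "esmall TYPE('u) A" and B: "esmall TYPE('u) B"
  shows "esmall TYPE('u) (A \<rightarrow>\<^sub>E B)"
proof (rule esmall_inj_on)
  show "esmall TYPE('u) (Pow (A \<times> B))" using U A B by (intro esmall_Pow esmall_Sigma)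
  show "(\<lambda>f. (\<lambda>x. (x, f x)) ` A) ` (A \<rightarrow>\<^sub>E B) \<subseteq> Pow (A \<times> B)" by (auto simp: PiE_mem)
  show "inj_on (\<lambda>f. (\<lambda>x. (x, f x)) ` A) (A \<rightarrow>\<^sub>E B)"
  proof (rule inj_onI)
    fix f g assume fg: "f \<in> A \<rightarrow>\<^sub>E B" "g \<in> A \<rightarrow>\<^sub>E B" and eq: "(\<lambda>x. (x, f x)) ` A = (\<lambda>x. (x, g x)) ` A"
    show "f = g"
    proof (rule PiE_ext[OF fg])
      fix x assume "x \<in> A"
      then have "(x, f x) \<in> (\<lambda>x. (x, g x)) ` A" using eq by blast
      then show "f x = g x" by auto
    qed
  qed
qed

text \<open>The length is fixed because the set of all lists over a non-empty set is infinite, hence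
  not small when \<open>'u\<close> is countable.\<close>

lemma esmall_lists_length:
  assumes U: "universe TYPE('u)" and A: "esmall TYPE('u) A"
  shows "esmall TYPE('u) {xs. set xs \<subseteq> A \<and> length xs = n}"
proof (induction n)
  case 0
  have "{xs. set xs \<subseteq> A \<and> length xs = 0} = {[]}" by auto
  then show ?case using U by (simp add: esmall_finite)
next
  case (Suc n)
  have "{xs. set xs \<subseteq> A \<and> length xs = Suc n} \<subseteq> (\<lambda>(x, xs). x # xs) ` (A \<times> {xs. set xs \<subseteq> A \<and>
    length xs = n})"
    by (auto simp: length_Suc_conv image_iff)
  then show ?case using esmall_subset esmall_image esmall_Sigma U A Suc by meson
qed

definition esmall_mcat :: "'u itself \<Rightarrow> ('o, 'a) mcat \<Rightarrow> bool" where
  "esmall_mcat U M \<longleftrightarrow> multicategory M \<and> esmall U (Obj M) \<and>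
     (\<forall>As B. set As \<subseteq> Obj M \<longrightarrow> B \<in> Obj M \<longrightarrow> esmall U (mhom M As B))"

lemma esmall_mcat_iff: "esmall_mcat TYPE('u) (M :: ('u, 'u) mcat) \<longleftrightarrow> small_multicategory M"
  by (simp add: esmall_mcat_def small_multicategory_def esmall_small)

definition ary :: "('o, 'a) mcat \<Rightarrow> nat \<Rightarrow> 'a set" where
  "ary M n = {f \<in> Arr M. length (Dom M f) = n}"

lemma esmall_ary:
  assumes U: "universe TYPE('u)" and M: "esmall_mcat TYPE('u) M"
  shows "esmall TYPE('u) (ary M n)"
proof -
  interpret multicategory M using M by (simp add: esmall_mcat_def)
  have *: "ary M n \<subseteq> (\<Union>As\<in>{As. set As \<subseteq> Obj M \<and> length As = n}. \<Union>B\<in>Obj M. mhom M As B)"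
    using dom_obj cod_obj by (auto simp: ary_def mhom_def)
  show ?thesis
    by (rule esmall_subset[OF _ *]) (use U M in \<open>auto simp: esmall_mcat_def intro!: esmall_UNION
      esmall_lists_length\<close>)
qed

text \<open>Smallness is imposed hom by hom, so \<open>Arr M\<close> is a countable union of the
  small sets \<open>ary M n\<close>. It need not be small itself, but this bound is enough to embed
  it in \<open>'u\<close>.\<close>

lemma Arr_le_universe:
  assumes U: "universe TYPE('u)" and M: "esmall_mcat TYPE('u) M"
  shows "|Arr M| \<le>o |UNIV :: 'u set|"
proof -
  have eq: "Arr M = (\<Union>n. ary M n)" by (auto simp: ary_def)
  have "|UNIV :: nat set| \<le>o |UNIV :: 'u set|"
    using infinite_universe[OF U] infinite_iff_card_of_nat by blast
  moreover have "\<forall>n\<in>UNIV. |ary M n| \<le>o |UNIV :: 'u set|"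
    using esmall_ary[OF U M] ordLess_imp_ordLeq unfolding esmall_def by blast
  ultimately show ?thesis
    unfolding eq using card_of_UNION_ordLeq_infinite[OF infinite_universe[OF U]] by blast
qed

section \<open>Functors and bifunctors of multicategories\<close>

abbreviation same_arity :: "('o, 'a) mcat \<Rightarrow> ('p, 'b) mcat \<Rightarrow> 'a list \<Rightarrow> 'b list \<Rightarrow> bool" where
  "same_arity M X \<equiv> list_all2 (\<lambda>f a. length (Dom M f) = length (Dom X a))"

text \<open>
  Functors \<open>M \<times> X \<rightarrow> N\<close> in curried form. This avoids the coding of pairs in \<open>'u\<close> and makes sense
  for multicategories over different types.
\<close>

definition mbifun ::
  "('o, 'a) mcat \<Rightarrow> ('p, 'b) mcat \<Rightarrow> ('q, 'c) mcat \<Rightarrow> ('o \<Rightarrow> 'p \<Rightarrow> 'q) \<Rightarrow> ('a \<Rightarrow> 'b \<Rightarrow> 'c) \<Rightarrow> bool" where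
  "mbifun M X N go ga \<longleftrightarrow>
     (\<forall>A\<in>Obj M. \<forall>x\<in>Obj X. go A x \<in> Obj N) \<and>
     (\<forall>f\<in>Arr M. \<forall>a\<in>Arr X. length (Dom M f) = length (Dom X a) \<longrightarrow>
        ga f a \<in> mhom N (map2 go (Dom M f) (Dom X a)) (go (Cod M f) (Cod X a))) \<and>
     (\<forall>A\<in>Obj M. \<forall>x\<in>Obj X. ga (Ident M A) (Ident X x) = Ident N (go A x)) \<and>
     (\<forall>f gs a bs. composable M f gs \<and> composable X a bs \<and>
        same_arity M X gs bs \<longrightarrow>
        ga (Comp M f gs) (Comp X a bs) = Comp N (ga f a) (map2 ga gs bs))"

lemma composableD:
  assumes "composable M f gs"
  shows "f \<in> Arr M" "set gs \<subseteq> Arr M" "map (Cod M) gs = Dom M f" "length gs = length (Dom M f)"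
  using assms by (auto simp: composable_def) (metis length_map)

lemma composable_nth:
  "composable M f gs \<longleftrightarrow> f \<in> Arr M \<and> length gs = length (Dom M f) \<and>
     (\<forall>i<length gs. gs ! i \<in> Arr M \<and> Cod M (gs ! i) = Dom M f ! i)"
  by (auto simp: composable_def list_eq_iff_nth_eq in_set_conv_nth subset_iff)

lemma mfunctorD:
  assumes "is_mfunctor M N Fo Fa"
  shows "A \<in> Obj M \<Longrightarrow> Fo A \<in> Obj N"
    and "f \<in> Arr M \<Longrightarrow> Fa f \<in> Arr N"
    and "f \<in> Arr M \<Longrightarrow> Dom N (Fa f) = map Fo (Dom M f)"
    and "f \<in> Arr M \<Longrightarrow> Cod N (Fa f) = Fo (Cod M f)"
    and "A \<in> Obj M \<Longrightarrow> Fa (Ident M A) = Ident N (Fo A)"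
    and "composable M f gs \<Longrightarrow> Fa (Comp M f gs) = Comp N (Fa f) (map Fa gs)"
  using assms by (auto simp: is_mfunctor_def mhom_def)

lemma mfunctor_composable:
  assumes F: "is_mfunctor M N Fo Fa" and c: "composable M f gs"
  shows "composable N (Fa f) (map Fa gs)"
proof -
  note cD = composableD[OF c] and FD = mfunctorD[OF F]
  have "map (Cod N) (map Fa gs) = map Fo (map (Cod M) gs)"
    using cD(2) FD(4) by auto
  then show ?thesis using cD FD by (auto simp: composable_def)
qed

lemma mfunctor_comp:
  assumes F: "is_mfunctor M N Fo Fa" and G: "is_mfunctor N P Go Ga"
  shows "is_mfunctor M P (Go \<circ> Fo) (Ga \<circ> Fa)"
  using mfunctorD[OF F] mfunctorD[OF G] mfunctor_composable[OF F]
  by (auto simp: is_mfunctor_def mhom_def)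

lemma mfunctor_id: "multicategory M \<Longrightarrow> is_mfunctor M M id id"
  by (auto simp: is_mfunctor_def mhom_def)

context multicategory
begin

lemma ident_simps:
  assumes "A \<in> Obj M"
  shows "Ident M A \<in> Arr M" "Dom M (Ident M A) = [A]" "Cod M (Ident M A) = A"
  using ident_hom[OF assms] by (auto simp: mhom_def)

lemma comp_simps:
  assumes "composable M f gs"
  shows "Comp M f gs \<in> Arr M" "Dom M (Comp M f gs) = concat (map (Dom M) gs)" "Cod M (Comp M f gs) =
    Cod M f"
  using comp_hom[OF assms] by (auto simp: mhom_def)

lemma composable_Ident_left: "f \<in> Arr M \<Longrightarrow> Cod M f = A \<Longrightarrow> composable M (Ident M A) [f]"
  using cod_obj ident_simps by (auto simp: composable_def)

lemma composable_Ident_right: "f \<in> Arr M \<Longrightarrow> composable M f (map (Ident M) (Dom M f))"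
  using dom_obj ident_simps by (auto simp: composable_def subset_iff intro!: map_idI)

lemma composable_concat:
  assumes c: "composable M f gs" and l: "list_all2 (composable M) gs hss"
  shows "composable M (Comp M f gs) (concat hss)" "composable M f (map2 (Comp M) gs hss)"
proof -
  have "map (map (Cod M)) hss = map (Dom M) gs"
    using l by (auto simp: list_all2_conv_all_nth composable_def intro!: nth_equalityI)
  moreover have "set (concat hss) \<subseteq> Arr M"
    using l by (fastforce simp: list_all2_conv_all_nth composable_def in_set_conv_nth)
  ultimately show "composable M (Comp M f gs) (concat hss)"
    using comp_simps[OF c] by (simp add: composable_def map_concat)
  show "composable M f (map2 (Comp M) gs hss)"
    using c l comp_simps
    by (auto simp: list_all2_conv_all_nth composable_nth[of _ f])
qed

lemma dom_nth: "f \<in> Arr M \<Longrightarrow> i < length (Dom M f) \<Longrightarrow> Dom M f ! i \<in> Obj M"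
  using dom_obj nth_mem by blast

end

lemma mbifunD:
  assumes "mbifun M X N go ga"
  shows "A \<in> Obj M \<Longrightarrow> x \<in> Obj X \<Longrightarrow> go A x \<in> Obj N"
    and "f \<in> Arr M \<Longrightarrow> a \<in> Arr X \<Longrightarrow> length (Dom M f) = length (Dom X a) \<Longrightarrow> ga f a \<in> Arr N"
    and "f \<in> Arr M \<Longrightarrow> a \<in> Arr X \<Longrightarrow> length (Dom M f) = length (Dom X a) \<Longrightarrow>
      Dom N (ga f a) = map2 go (Dom M f) (Dom X a)"
    and "f \<in> Arr M \<Longrightarrow> a \<in> Arr X \<Longrightarrow> length (Dom M f) = length (Dom X a) \<Longrightarrow>
      Cod N (ga f a) = go (Cod M f) (Cod X a)"
    and "A \<in> Obj M \<Longrightarrow> x \<in> Obj X \<Longrightarrow> ga (Ident M A) (Ident X x) = Ident N (go A x)"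
    and "composable M f gs \<Longrightarrow> composable X a bs \<Longrightarrow>
      same_arity M X gs bs \<Longrightarrow>
      ga (Comp M f gs) (Comp X a bs) = Comp N (ga f a) (map2 ga gs bs)"
  using assms by (auto simp: mbifun_def mhom_def)

lemma mbifun_composable:
  assumes g: "mbifun M X N go ga" and "composable M f gs" "composable X a bs"
    and l: "same_arity M X gs bs"
  shows "composable N (ga f a) (map2 ga gs bs)"
  using assms list_all2_lengthD[OF l] mbifunD[OF g]
  by (auto simp: composable_nth list_all2_conv_all_nth)

lemma mbifun_mfunctor_right:
  assumes g: "mbifun M X N go ga" and F: "is_mfunctor Y X Fo Fa"
  shows "mbifun M Y N (\<lambda>A y. go A (Fo y)) (\<lambda>f b. ga f (Fa b))"
proof -
  note gD = mbifunD[OF g] and FD = mfunctorD[OF F]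
  show ?thesis unfolding mbifun_def
  proof (intro conjI ballI allI impI)
    fix f a assume fa: "f \<in> Arr M" "a \<in> Arr Y" "length (Dom M f) = length (Dom Y a)"
    then show "ga f (Fa a) \<in> mhom N (map2 (\<lambda>A y. go A (Fo y)) (Dom M f) (Dom Y a)) (go (Cod M f) (Fo
      (Cod Y a)))"
      using gD FD by (auto simp: mhom_def zip_map2)
  next
    fix f gs a bs
    assume *: "composable M f gs \<and> composable Y a bs \<and> same_arity M Y gs bs"
    then have "same_arity M X gs (map Fa bs)"
      using FD by (auto simp: list_all2_conv_all_nth composable_nth)
    then have "ga (Comp M f gs) (Comp X (Fa a) (map Fa bs)) = Comp N (ga f (Fa a)) (map2 ga gs (map
      Fa bs))"
      using gD(6) * mfunctor_composable[OF F] by blast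
    then show "ga (Comp M f gs) (Fa (Comp Y a bs)) = Comp N (ga f (Fa a)) (map2 (\<lambda>f b. ga f (Fa b))
      gs bs)"
      using * FD(6) by (simp add: zip_map2 case_prod_unfold comp_def)
  qed (use gD FD in auto)
qed

lemma mbifun_mfunctor_left:
  assumes g: "mbifun M X N go ga" and F: "is_mfunctor N P Fo Fa"
  shows "mbifun M X P (\<lambda>A x. Fo (go A x)) (\<lambda>f a. Fa (ga f a))"
  unfolding mbifun_def
  using mbifunD[OF g] mfunctorD[OF F] mbifun_composable[OF g]
  by (auto simp: mhom_def case_prod_unfold comp_def)

text \<open>A functor precomposed with the projection from \<open>M \<times> X\<close>. Equal
  arities matter: \<open>map2\<close> truncates to the shorter list, so \<open>eq\<close> needs
  lists of the same length.\<close>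

lemma mbifun_fst:
  assumes "is_mfunctor M N Fo Fa"
  shows "mbifun M X N (\<lambda>A x. Fo A) (\<lambda>f a. Fa f)"
proof -
  have eq: "map2 (\<lambda>x y. h x) xs ys = map h xs" if "length xs = length ys"
    for h :: "'z \<Rightarrow> 'w" and xs and ys :: "'v list"
    using that by (auto intro!: nth_equalityI)
  show ?thesis unfolding mbifun_def using mfunctorD[OF assms]
    by (auto simp: eq mhom_def list_all2_lengthD)
qed

lemma mbifun_snd:
  assumes "is_mfunctor X N Fo Fa"
  shows "mbifun M X N (\<lambda>A x. Fo x) (\<lambda>f a. Fa a)"
proof -
  have eq: "map2 (\<lambda>x y. h y) xs ys = map h ys" if "length xs = length ys"
    for h :: "'z \<Rightarrow> 'w" and ys and xs :: "'v list"
    using that by (auto intro!: nth_equalityI)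
  show ?thesis unfolding mbifun_def using mfunctorD[OF assms]
    by (auto simp: eq mhom_def list_all2_lengthD)
qed

section \<open>Small copies of multicategories\<close>

lemma mcat_transport:
  assumes M: "multicategory M" and i: "inj_on i (Obj M)" and j: "inj_on j (Arr M)"
  defines "i' \<equiv> inv_into (Obj M) i" and "j' \<equiv> inv_into (Arr M) j"
  defines "N \<equiv> \<lparr>Obj = i ` Obj M, Arr = j ` Arr M, Dom = \<lambda>a. map i (Dom M (j' a)),
    Cod = \<lambda>a. i (Cod M (j' a)), Ident = \<lambda>x. j (Ident M (i' x)), Comp = \<lambda>a bs. j (Comp M (j' a) (map
      j' bs))\<rparr>"
  shows "multicategory N" "is_mfunctor M N i j" "is_mfunctor N M i' j'"
proof -
  interpret multicategory M by fact
  have ii: "i' (i A) = A" if "A \<in> Obj M" for A using i that by (simp add: i'_def)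
  have jj: "j' (j f) = f" if "f \<in> Arr M" for f using j that by (simp add: j'_def)
  have mapii: "map (i' \<circ> i) As = As" if "set As \<subseteq> Obj M" for As
    using that ii by (auto intro!: map_idI)
  \<comment> \<open>Composability in \<open>N\<close> is an equation between images under
    \<open>i\<close>. Applying \<open>i'\<close> to both sides pulls it back, as all objects
    involved lie in \<open>Obj M\<close>.\<close>
  have c: "composable M (j' a) (map j' bs) \<and> j (j' a) = a" if "composable N a bs" for a bs
  proof -
    have *: "a \<in> j ` Arr M" "set bs \<subseteq> j ` Arr M"
      "map (\<lambda>a. i (Cod M (j' a))) bs = map i (Dom M (j' a))"
      using that by (auto simp: composable_def N_def)
    then have m: "map (i' \<circ> (\<lambda>a. i (Cod M (j' a)))) bs = map (i' \<circ> i) (Dom M (j' a))"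
      by (metis map_map)
    have "j' a \<in> Arr M" using * jj by auto
    then have "map (i' \<circ> i) (Dom M (j' a)) = Dom M (j' a)" using dom_obj mapii by auto
    moreover have "map (i' \<circ> (\<lambda>a. i (Cod M (j' a)))) bs = map (Cod M) (map j' bs)"
      using *(2) jj ii cod_obj by auto
    ultimately show ?thesis using * m jj by (auto simp: composable_def)
  qed
  show F: "is_mfunctor M N i j"
    unfolding is_mfunctor_def
  proof (intro conjI ballI allI impI)
    fix f gs assume "composable M f gs"
    then have "map (j' \<circ> j) gs = gs" "j' (j f) = f"
      using jj by (auto simp: composable_def intro!: map_idI)
    then show "j (Comp M f gs) = Comp N (j f) (map j gs)" by (simp add: N_def)
  qed (auto simp: N_def mhom_def jj ii)
  show G: "is_mfunctor N M i' j'"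
    unfolding is_mfunctor_def
  proof (intro conjI ballI allI impI)
    fix a assume "a \<in> Arr N"
    then show "j' a \<in> mhom M (map i' (Dom N a)) (i' (Cod N a))"
      by (auto simp: N_def mhom_def jj mapii dom_obj ii cod_obj)
  next
    fix a bs assume "composable N a bs"
    then show "j' (Comp N a bs) = Comp M (j' a) (map j' bs)"
      using c comp_simps(1) by (simp add: N_def jj)
  qed (auto simp: N_def ii jj ident_simps)
  show "multicategory N"
  proof
    fix a bs assume *: "composable N a bs"
    show "Comp N a bs \<in> mhom N (concat (map (Dom N) bs)) (Cod N a)"
      using c[OF *] comp_simps[of "j' a" "map j' bs"]
      by (auto simp: N_def mhom_def jj map_concat comp_def)
  next
    fix a bs hss assume *: "composable N a bs" "list_all2 (composable N) bs hss"
    have l: "list_all2 (composable M) (map j' bs) (map (map j') hss)"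
      using *(2) c by (auto simp: list_all2_conv_all_nth)
    have "j' (Comp N a bs) = Comp M (j' a) (map j' bs)" using G * by (simp add: is_mfunctor_def)
    moreover have "map j' (map2 (Comp N) bs hss) = map2 (Comp M) (map j' bs) (map (map j') hss)"
      using mfunctorD(6)[OF G] *(2) by (auto simp: list_all2_conv_all_nth intro!: nth_equalityI)
    ultimately have "Comp N (Comp N a bs) (concat hss) = j (Comp M (Comp M (j' a) (map j' bs))
      (concat (map (map j') hss)))"
      "Comp N a (map2 (Comp N) bs hss) = j (Comp M (j' a) (map2 (Comp M) (map j' bs) (map (map j')
        hss)))"
      by (simp_all add: N_def map_concat)
    then show "Comp N (Comp N a bs) (concat hss) = Comp N a (map2 (Comp N) bs hss)"
      using comp_assoc c[OF *(1)] l by simp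
  next
    fix a assume *: "a \<in> Arr N"
    then obtain f where f: "f \<in> Arr M" "a = j f" by (auto simp: N_def)
    show "Comp N (Ident N (Cod N a)) [a] = a"
      using f by (simp add: N_def jj ii cod_obj ident_simps ident_left)
    have "map j' (map (Ident N) (Dom N a)) = map (Ident M) (Dom M f)"
      using dom_obj[OF f(1)] f by (auto simp: N_def jj ii ident_simps)
    then have "Comp N a (map (Ident N) (Dom N a)) = j (Comp M (j' a) (map (Ident M) (Dom M f)))"
      by (simp add: N_def)
    then show "Comp N a (map (Ident N) (Dom N a)) = a"
      using f ident_right[OF f(1)] by (simp add: jj)
  next
    fix a assume "a \<in> Arr N"
    then show "set (Dom N a) \<subseteq> Obj N" using dom_obj by (fastforce simp: N_def jj)
  qed (auto simp: N_def jj cod_obj ii ident_simps mhom_def)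
qed

lemma mhom_image_subset:
  assumes "is_mfunctor M N Fo Fa"
  shows "Fa ` mhom M As B \<subseteq> mhom N (map Fo As) (Fo B)"
  using mfunctorD[OF assms] by (auto simp: mhom_def)

text \<open>The definition of exponentiability quantifies over multicategories in \<open>'u\<close>,
  whereas exponentials and collages live over function types and datatypes; this copy connects the
  two. Its homs are small because the inverse of \<open>j\<close> embeds them into homs of
  \<open>M\<close>.\<close>

lemma obtain_small_copy:
  fixes M :: "('o, 'a) mcat"
  assumes U: "universe TYPE('u)" and M: "esmall_mcat TYPE('u) M"
  obtains N :: "('u, 'u) mcat" and Fo Fa Go Ga where "small_multicategory N"
    "is_mfunctor M N Fo Fa" "is_mfunctor N M Go Ga"
    "\<And>A. A \<in> Obj M \<Longrightarrow> Go (Fo A) = A" "\<And>f. f \<in> Arr M \<Longrightarrow> Ga (Fa f) = f"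
    "\<And>A. A \<in> Obj N \<Longrightarrow> Fo (Go A) = A" "\<And>f. f \<in> Arr N \<Longrightarrow> Fa (Ga f) = f"
proof -
  have mM: "multicategory M" using M by (simp add: esmall_mcat_def)
  have "|Obj M| \<le>o |UNIV :: 'u set|" using M ordLess_imp_ordLeq
    by (auto simp: esmall_mcat_def esmall_def)
  then obtain i :: "'o \<Rightarrow> 'u" where i: "inj_on i (Obj M)"
    using card_of_ordLeq[of "Obj M" "UNIV :: 'u set"] by blast
  obtain j :: "'a \<Rightarrow> 'u" where j: "inj_on j (Arr M)"
    using Arr_le_universe[OF U M] card_of_ordLeq[of "Arr M" "UNIV :: 'u set"] by blast
  define N where "N = \<lparr>Obj = i ` Obj M, Arr = j ` Arr M, Dom = \<lambda>a. map i (Dom M (inv_into (Arr M) j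
    a)),
    Cod = \<lambda>a. i (Cod M (inv_into (Arr M) j a)), Ident = \<lambda>x. j (Ident M (inv_into (Obj M) i x)),
    Comp = \<lambda>a bs. j (Comp M (inv_into (Arr M) j a) (map (inv_into (Arr M) j) bs))\<rparr>"
  note N = mcat_transport[OF mM i j, folded N_def]
  have hs: "esmall TYPE('u) (mhom N As B)" if "set As \<subseteq> Obj N" "B \<in> Obj N" for As B
  proof (rule esmall_inj_on)
    let ?As = "map (inv_into (Obj M) i) As" and ?B = "inv_into (Obj M) i B"
    show "inj_on (inv_into (Arr M) j) (mhom N As B)"
      by (rule inj_on_subset[OF inj_on_inv_into[of _ j "Arr M"]]) (auto simp: N_def mhom_def)
    show "inv_into (Arr M) j ` mhom N As B \<subseteq> mhom M ?As ?B" using mhom_image_subset[OF N(3)] .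
    have "set ?As \<subseteq> Obj M" "?B \<in> Obj M" using that mfunctorD(1)[OF N(3)] by auto
    then show "esmall TYPE('u) (mhom M ?As ?B)" using M by (simp add: esmall_mcat_def)
  qed
  have "esmall TYPE('u) (Obj N)" using M by (simp add: esmall_mcat_def N_def esmall_image)
  then have s: "small_multicategory N"
    using hs N(1) unfolding small_multicategory_def esmall_small by blast
  show thesis
    by (rule that[OF s N(2,3)]) (use i j in \<open>auto simp: N_def\<close>)
qed

section \<open>Right adjoints and universal arrows\<close>

lemma inj_upair:
  assumes "universe TYPE('u)"
  shows "inj (case_prod upair :: 'u \<times> 'u \<Rightarrow> 'u)"
proof -
  have "|UNIV :: ('u \<times> 'u) set| \<le>o |UNIV :: 'u set|"
    using card_of_Times_same_infinite[OF infinite_universe[OF assms]] ordIso_iff_ordLeq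
      by (metis UNIV_Times_UNIV)
  then have "\<exists>p :: 'u \<times> 'u \<Rightarrow> 'u. inj p"
    using card_of_ordLeq[of "UNIV :: ('u \<times> 'u) set" "UNIV :: 'u set"] by auto
  then have "inj (SOME p :: 'u \<times> 'u \<Rightarrow> 'u. inj p)" by (rule someI_ex)
  then show ?thesis by (simp add: upair_def case_prod_curry)
qed

lemma upair_simps:
  assumes "universe TYPE('u)"
  shows "upair a b = upair c d \<longleftrightarrow> a = c \<and> b = (d :: 'u)"
    and "ufst (upair a b) = (a :: 'u)" and "usnd (upair a b) = (b :: 'u)"
proof -
  note i = inj_upair[OF assms]
  have "upair a b = upair c d \<longleftrightarrow> (a, b) = (c, d)"
    using inj_eq[OF i, of "(a, b)" "(c, d)"] by simp
  then show "upair a b = upair c d \<longleftrightarrow> a = c \<and> b = d" by simp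
  show "ufst (upair a b) = a" "usnd (upair a b) = b"
    using inv_f_f[OF i, of "(a, b)"] by (simp_all add: ufst_def usnd_def)
qed

text \<open>The pair \<open>(G, e)\<close> is the value of the right adjoint at \<open>Y\<close>
  together with the counit. Given an adjunction, \<open>e\<close> is the arrow that \<phi> sends to
  the identity of \<open>Go Y\<close>, and naturality makes \<phi> a left inverse of composition
  with \<open>e\<close>. Conversely, \<phi> picks the unique solution \<open>h\<close>,
  \<open>Ga k\<close> is the transpose of \<open>k\<close> after the counit, and each law follows by
  comparing two arrows after composition with a counit.\<close>

lemma has_right_adjoint_iff_universal:
  assumes C: "category C" and D: "category D" and F: "is_functor C D Fo Fa"
  shows "has_right_adjoint C D Fo Fa \<longleftrightarrow>
    (\<forall>Y\<in>Ob D. \<exists>G\<in>Ob C. \<exists>e\<in>hom D (Fo G) Y. \<forall>X\<in>Ob C. \<forall>g\<in>hom D (Fo X) Y.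
       \<exists>!h. h \<in> hom C X G \<and> Cmp D e (Fa h) = g)" (is "_ \<longleftrightarrow> ?U")
proof
  interpret C: category C by fact
  interpret D: category D by fact
  have Fh: "Fa h \<in> hom D (Fo X) (Fo Y)" if "X \<in> Ob C" "Y \<in> Ob C" "h \<in> hom C X Y" for X Y h
    using F that by (auto simp: is_functor_def)
  {
    assume "has_right_adjoint C D Fo Fa"
    then obtain Go Ga \<phi> where G: "is_functor D C Go Ga"
      and bij': "\<forall>X\<in>Ob C. \<forall>Y\<in>Ob D. bij_betw (\<phi> X Y) (hom D (Fo X) Y) (hom C X (Go Y))"
      and nat': "\<forall>X\<in>Ob C. \<forall>X'\<in>Ob C. \<forall>Y\<in>Ob D. \<forall>Y'\<in>Ob D.
           \<forall>h\<in>hom C X' X. \<forall>g\<in>hom D (Fo X) Y. \<forall>k\<in>hom D Y Y'.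
             \<phi> X' Y' (Cmp D k (Cmp D g (Fa h))) = Cmp C (Ga k) (Cmp C (\<phi> X Y g) h)"
      unfolding has_right_adjoint_def by blast
    note bij = bij'[rule_format] and nat = nat'[rule_format]
    show ?U
    proof
      fix Y assume Y: "Y \<in> Ob D"
      have GY: "Go Y \<in> Ob C" using G Y by (simp add: is_functor_def)
      obtain e where e: "e \<in> hom D (Fo (Go Y)) Y" "\<phi> (Go Y) Y e = Idn C (Go Y)"
        using bij_betwE[OF bij_betw_inv_into[OF bij[OF GY Y]]] bij_betw_inv_into_right[OF bij[OF GY
          Y]]
          C.idn_hom[OF GY] by metis
      have \<phi>e: "\<phi> X Y (Cmp D e (Fa h)) = h" and eh: "Cmp D e (Fa h) \<in> hom D (Fo X) Y"
        if X: "X \<in> Ob C" and h: "h \<in> hom C X (Go Y)" for X h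
      proof -
        show eh: "Cmp D e (Fa h) \<in> hom D (Fo X) Y" using D.cmp_hom[OF e(1) Fh[OF X GY h]] .
        \<comment> \<open>Naturality is stated for both variables at once; here \<open>k\<close> is
          the identity of \<open>Y\<close>.\<close>
        have "Cmp D (Idn D Y) (Cmp D e (Fa h)) = Cmp D e (Fa h)" using D.idn_left[OF eh] .
        moreover have "Ga (Idn D Y) = Idn C (Go Y)" using G Y by (simp add: is_functor_def)
        ultimately show "\<phi> X Y (Cmp D e (Fa h)) = h"
          using nat[OF GY X Y Y h e(1) D.idn_hom[OF Y]] e(2) C.idn_left[OF h] by simp
      qed
      show "\<exists>G\<in>Ob C. \<exists>e\<in>hom D (Fo G) Y. \<forall>X\<in>Ob C. \<forall>g\<in>hom D (Fo X) Y.
        \<exists>!h. h \<in> hom C X G \<and> Cmp D e (Fa h) = g"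
      proof (intro bexI[OF _ GY] bexI[OF _ e(1)] ballI)
        fix X g assume X: "X \<in> Ob C" and g: "g \<in> hom D (Fo X) Y"
        have h: "\<phi> X Y g \<in> hom C X (Go Y)" using bij_betwE[OF bij[OF X Y]] g by blast
        have "Cmp D e (Fa (\<phi> X Y g)) = g"
          using inj_onD[OF bij_betw_imp_inj_on[OF bij[OF X Y]] \<phi>e[OF X h] eh[OF X h] g] .
        then show "\<exists>!h. h \<in> hom C X (Go Y) \<and> Cmp D e (Fa h) = g"
          using h \<phi>e[OF X] by (intro ex1I[of _ "\<phi> X Y g"]) auto
      qed
    qed
  next
    assume ?U
    then obtain Go e where GY: "\<And>Y. Y \<in> Ob D \<Longrightarrow> Go Y \<in> Ob C"
      and e: "\<And>Y. Y \<in> Ob D \<Longrightarrow> e Y \<in> hom D (Fo (Go Y)) Y"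
      and univ: "\<And>X Y g. X \<in> Ob C \<Longrightarrow> Y \<in> Ob D \<Longrightarrow> g \<in> hom D (Fo X) Y \<Longrightarrow>
        \<exists>!h. h \<in> hom C X (Go Y) \<and> Cmp D (e Y) (Fa h) = g"
      by metis
    define \<phi> where "\<phi> X Y g = (THE h. h \<in> hom C X (Go Y) \<and> Cmp D (e Y) (Fa h) = g)" for X Y g
    have \<phi>: "\<phi> X Y g \<in> hom C X (Go Y)" "Cmp D (e Y) (Fa (\<phi> X Y g)) = g"
      if "X \<in> Ob C" "Y \<in> Ob D" "g \<in> hom D (Fo X) Y" for X Y g
      using theI'[OF univ[OF that]] by (simp_all add: \<phi>_def)
    have uniq: "h = h'" if "X \<in> Ob C" "Y \<in> Ob D" "h \<in> hom C X (Go Y)" "h' \<in> hom C X (Go Y)"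
      "Cmp D (e Y) (Fa h) = Cmp D (e Y) (Fa h')" for X Y h h'
      using univ[OF that(1,2) D.cmp_hom[OF e[OF that(2)] Fh[OF that(1) GY[OF that(2)] that(3)]]]
        that by metis
    define Ga where "Ga k = \<phi> (Go (Src D k)) (Tgt D k) (Cmp D k (e (Src D k)))" for k
    have homD: "Src D k = Y" "Tgt D k = Y'" "Y \<in> Ob D" "Y' \<in> Ob D" if "k \<in> hom D Y Y'" for k Y Y'
      using that D.src_ob D.tgt_ob by (auto simp: hom_def)
    have Ga: "Ga k \<in> hom C (Go Y) (Go Y')" "Cmp D (e Y') (Fa (Ga k)) = Cmp D k (e Y)"
      if k: "k \<in> hom D Y Y'" for k Y Y'
      using \<phi>[OF GY[OF homD(3)[OF k]] homD(4)[OF k] D.cmp_hom[OF k e[OF homD(3)[OF k]]]]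
      by (simp_all add: Ga_def homD[OF k])
    have Fcmp: "Fa (Cmp C f g) = Cmp D (Fa f) (Fa g)" if "f \<in> hom C Y Z" "g \<in> hom C X Y"
      for f g X Y Z
      using F that by (auto simp: is_functor_def hom_def)
    have GaF: "is_functor D C Go Ga"
      unfolding is_functor_def
    proof (intro conjI ballI impI)
      fix Y assume Y: "Y \<in> Ob D"
      have i: "Idn D Y \<in> hom D Y Y" using D.idn_hom[OF Y] .
      have "Fa (Idn C (Go Y)) = Idn D (Fo (Go Y))" using F GY[OF Y] by (simp add: is_functor_def)
      then have "Cmp D (e Y) (Fa (Ga (Idn D Y))) = Cmp D (e Y) (Fa (Idn C (Go Y)))"
        using Ga(2)[OF i] D.idn_left[OF e[OF Y]] D.idn_right[OF e[OF Y]] by simp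
      then show "Ga (Idn D Y) = Idn C (Go Y)"
        using uniq[OF GY[OF Y] Y Ga(1)[OF i] C.idn_hom[OF GY[OF Y]]] by simp
    next
      fix k l assume kl: "k \<in> Ar D" "l \<in> Ar D" "Tgt D l = Src D k"
      define X Y Z where "X = Src D l" and "Y = Src D k" and "Z = Tgt D k"
      have k: "k \<in> hom D Y Z" and l: "l \<in> hom D X Y"
        using kl by (auto simp: hom_def X_def Y_def Z_def)
      note ob = homD(3)[OF l] homD(3)[OF k] homD(4)[OF k]
      note Gk = Ga[OF k] and Gl = Ga[OF l] and Gkl = Ga[OF D.cmp_hom[OF k l]]
      have Fk: "Fa (Ga k) \<in> hom D (Fo (Go Y)) (Fo (Go Z))"
        and Fl: "Fa (Ga l) \<in> hom D (Fo (Go X)) (Fo (Go Y))"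
        using Fh Gk(1) Gl(1) GY ob by auto
      have "Cmp D (e Z) (Fa (Cmp C (Ga k) (Ga l))) = Cmp D (e Z) (Cmp D (Fa (Ga k)) (Fa (Ga l)))"
        using Fcmp[OF Gk(1) Gl(1)] by simp
      also have "\<dots> = Cmp D (Cmp D (e Z) (Fa (Ga k))) (Fa (Ga l))"
        using D.cmp_assoc[OF e[OF ob(3)] Fk Fl] by simp
      also have "\<dots> = Cmp D k (Cmp D (e Y) (Fa (Ga l)))"
        using Gk(2) D.cmp_assoc[OF k e[OF ob(2)] Fl] by simp
      also have "\<dots> = Cmp D (Cmp D k l) (e X)"
        using Gl(2) D.cmp_assoc[OF k l e[OF ob(1)]] by simp
      also have "\<dots> = Cmp D (e Z) (Fa (Ga (Cmp D k l)))" using Gkl(2) by simp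
      finally show "Ga (Cmp D k l) = Cmp C (Ga k) (Ga l)"
        using uniq[OF GY[OF ob(1)] ob(3) Gkl(1) C.cmp_hom[OF Gk(1) Gl(1)]] by simp
    qed (use GY Ga in auto)
    have bij: "bij_betw (\<phi> X Y) (hom D (Fo X) Y) (hom C X (Go Y))" if X: "X \<in> Ob C"
      and Y: "Y \<in> Ob D" for X Y
    proof (rule bij_betw_byWitness[where f' = "\<lambda>h. Cmp D (e Y) (Fa h)"])
      have eh: "Cmp D (e Y) (Fa h) \<in> hom D (Fo X) Y" if "h \<in> hom C X (Go Y)" for h
        using D.cmp_hom[OF e[OF Y] Fh[OF X GY[OF Y] that]] .
      then show "(\<lambda>h. Cmp D (e Y) (Fa h)) ` hom C X (Go Y) \<subseteq> hom D (Fo X) Y" by blast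
      show "\<forall>h\<in>hom C X (Go Y). \<phi> X Y (Cmp D (e Y) (Fa h)) = h"
        using uniq[OF X Y] \<phi>[OF X Y eh] by blast
    qed (use \<phi>[OF X Y] in auto)
    have nat: "\<phi> X' Y' (Cmp D k (Cmp D g (Fa h))) = Cmp C (Ga k) (Cmp C (\<phi> X Y g) h)"
      if X: "X \<in> Ob C" and X': "X' \<in> Ob C" and Y: "Y \<in> Ob D" and Y': "Y' \<in> Ob D"
        and h: "h \<in> hom C X' X" and g: "g \<in> hom D (Fo X) Y" and k: "k \<in> hom D Y Y'"
          for X X' Y Y' h g k
    proof -
      note p = \<phi>[OF X Y g]
      have Fh': "Fa h \<in> hom D (Fo X') (Fo X)" using Fh[OF X' X h] .
      have kgh: "Cmp D k (Cmp D g (Fa h)) \<in> hom D (Fo X') Y'"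
        using D.cmp_hom[OF k D.cmp_hom[OF g Fh']] .
      have ph: "Cmp C (\<phi> X Y g) h \<in> hom C X' (Go Y)" using C.cmp_hom[OF p(1) h] .
      have Fp: "Fa (\<phi> X Y g) \<in> hom D (Fo X) (Fo (Go Y))" using Fh[OF X GY[OF Y] p(1)] .
      have Fph: "Fa (Cmp C (\<phi> X Y g) h) \<in> hom D (Fo X') (Fo (Go Y))" using Fh[OF X' GY[OF Y] ph] .
      have Fk: "Fa (Ga k) \<in> hom D (Fo (Go Y)) (Fo (Go Y'))"
        using Fh[OF GY[OF Y] GY[OF Y'] Ga(1)[OF k]] .
      have "Cmp D (e Y') (Fa (Cmp C (Ga k) (Cmp C (\<phi> X Y g) h)))
        = Cmp D (Cmp D (e Y') (Fa (Ga k))) (Fa (Cmp C (\<phi> X Y g) h))"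
        using Fcmp[OF Ga(1)[OF k] ph] D.cmp_assoc[OF e[OF Y'] Fk Fph] by simp
      also have "\<dots> = Cmp D k (Cmp D (e Y) (Cmp D (Fa (\<phi> X Y g)) (Fa h)))"
        using Ga(2)[OF k] D.cmp_assoc[OF k e[OF Y] Fph] Fcmp[OF p(1) h] by simp
      also have "\<dots> = Cmp D k (Cmp D g (Fa h))"
        using D.cmp_assoc[OF e[OF Y] Fp Fh'] p(2) by simp
      finally show ?thesis
        using uniq[OF X' Y' \<phi>(1)[OF X' Y' kgh] C.cmp_hom[OF Ga(1)[OF k] ph]] \<phi>(2)[OF X' Y' kgh]
          by simp
    qed
    show "has_right_adjoint C D Fo Fa"
      unfolding has_right_adjoint_def using GaF bij nat by blast
  }
qed

section \<open>Products and the category of small multicategories\<close>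

lemma mlt_times_simps:
  assumes U: "universe TYPE('u)"
  shows "Dom (mlt_times M X) (upair f a) = map2 upair (Dom M f) (Dom X (a :: 'u))"
    "Cod (mlt_times M X) (upair f a) = upair (Cod M f) (Cod X a)"
    "Ident (mlt_times M X) (upair A x) = upair (Ident M A) (Ident X x)"
    "Comp (mlt_times M X) (upair f a) ks = upair (Comp M f (map ufst ks)) (Comp X a (map usnd ks))"
    "upair A x \<in> Obj (mlt_times M X) \<longleftrightarrow> A \<in> Obj M \<and> x \<in> Obj X"
    "upair f a \<in> Arr (mlt_times M X) \<longleftrightarrow> f \<in> Arr M \<and> a \<in> Arr X \<and> length (Dom M f) = length (Dom X a)"
  by (auto simp: mlt_times_def upair_simps[OF U])

lemma mlt_times_cases:
  shows "A \<in> Obj (mlt_times M X) \<Longrightarrow> (\<And>B x. A = upair B x \<Longrightarrow> B \<in> Obj M \<Longrightarrow> x \<in> Obj X \<Longrightarrow> P) \<Longrightarrow> P"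
    "h \<in> Arr (mlt_times M X) \<Longrightarrow> (\<And>f a. h = upair f a \<Longrightarrow> f \<in> Arr M \<Longrightarrow> a \<in> Arr X \<Longrightarrow>
       length (Dom M f) = length (Dom X a) \<Longrightarrow> P) \<Longrightarrow> P"
  by (auto simp: mlt_times_def)

lemma map_ufst_usnd:
  assumes U: "universe TYPE('u)" and "length xs = length ys"
  shows "map ufst (map2 upair xs ys) = (xs :: 'u list)" "map usnd (map2 upair xs ys) =
    (ys :: 'u list)"
  using assms(2) by (auto simp: upair_simps[OF U] intro!: nth_equalityI)

lemma composable_mlt_times:
  assumes U: "universe TYPE('u)"
  shows "composable (mlt_times M X) h ks \<longleftrightarrow> (\<exists>f gs a (bs :: 'u list). h = upair f a \<and> ks =
    map2 upair gs bs \<and>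
     composable M f gs \<and> composable X a bs \<and> same_arity M X gs bs)"
    (is "_ \<longleftrightarrow> ?R")
proof
  note t = mlt_times_simps[OF U]
  {
    assume c: "composable (mlt_times M X) h ks"
    then obtain f a where fa: "h = upair f a" "f \<in> Arr M" "a \<in> Arr X" "length (Dom M f) =
      length (Dom X a)"
      by (auto simp: composable_nth elim: mlt_times_cases)
    define gs bs where "gs = map ufst ks" and "bs = map usnd ks"
    have l: "length ks = length (Dom M f)" using c fa by (simp add: composable_nth t)
    have ks: "ks ! i = upair (gs ! i) (bs ! i) \<and> gs ! i \<in> Arr M \<and> bs ! i \<in> Arr X \<and>
       length (Dom M (gs ! i)) = length (Dom X (bs ! i)) \<and> Cod M (gs ! i) = Dom M f ! i \<and>
         Cod X (bs ! i) = Dom X a ! i"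
      if "i < length ks" for i
    proof -
      have "ks ! i \<in> Arr (mlt_times M X)" and cd: "Cod (mlt_times M X) (ks ! i) =
        Dom (mlt_times M X) h ! i"
        using c that by (auto simp: composable_nth)
      then obtain g b where gb: "ks ! i = upair g b" "g \<in> Arr M" "b \<in> Arr X" "length (Dom M g) =
        length (Dom X b)"
        by (auto elim: mlt_times_cases)
      then show ?thesis using cd that fa l
        by (simp add: gs_def bs_def t upair_simps[OF U])
    qed
    have "ks = map2 upair gs bs"
      using ks by (auto simp: gs_def bs_def intro!: nth_equalityI)
    moreover have "length gs = length ks" "length bs = length ks" by (simp_all add: gs_def bs_def)
    moreover from this have "composable M f gs" "composable X a bs"
      "same_arity M X gs bs"
      using ks l fa by (simp_all add: composable_nth list_all2_conv_all_nth)
    ultimately show ?R using fa(1) by blast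
  next
    assume ?R
    then show "composable (mlt_times M X) h ks"
      by (auto simp: composable_nth list_all2_conv_all_nth t)
  }
qed

text \<open>This translates the coded pairs of \<open>mlt_times\<close> into curried bifunctors.
  Once \<open>exponentiable_iff\<close> has used it, \<open>upair\<close> does not occur any
  more.\<close>

lemma is_mfunctor_mlt_times:
  assumes U: "universe TYPE('u)"
  shows "is_mfunctor (mlt_times M (X :: ('u, 'u) mcat)) N Fo Fa \<longleftrightarrow>
    mbifun M X N (\<lambda>A x. Fo (upair A x)) (\<lambda>f a. Fa (upair f a))" (is "?L \<longleftrightarrow> ?R")
proof
  note t = mlt_times_simps[OF U] and u = upair_simps[OF U]
  have m: "map Fo (map2 upair xs ys) = map2 (\<lambda>x y. Fo (upair x y)) xs ys" for Fo :: "'u \<Rightarrow> 'z"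
    and xs ys
    by (simp add: case_prod_unfold comp_def)
  {
    assume F: ?L
    show ?R unfolding mbifun_def
    proof (intro conjI ballI allI impI)
      fix f a assume "f \<in> Arr M" "a \<in> Arr X" "length (Dom M f) = length (Dom X a)"
      then have "upair f a \<in> Arr (mlt_times M X)" by (simp add: t)
      from mfunctorD(2-4)[OF F this]
      show "Fa (upair f a) \<in> mhom N (map2 (\<lambda>A x. Fo (upair A x)) (Dom M f) (Dom X a)) (Fo (upair
        (Cod M f) (Cod X a)))"
        by (simp only: mhom_def t m) simp
    next
      fix f gs a bs
      assume *: "composable M f gs \<and> composable X a bs \<and> same_arity M X gs bs"
      then have "composable (mlt_times M X) (upair f a) (map2 upair gs bs)"
        using composable_mlt_times[OF U] by blast
      from mfunctorD(6)[OF F this] * list_all2_lengthD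
      show "Fa (upair (Comp M f gs) (Comp X a bs)) = Comp N (Fa (upair f a)) (map2 (\<lambda>f a. Fa (upair
        f a)) gs bs)"
        by (metis t(4) map_ufst_usnd[OF U] m)
    qed (use mfunctorD(1,5)[OF F] in \<open>auto simp: t simp flip: t(3)\<close>)
  next
    assume g: ?R
    note gD = mbifunD[OF g]
    show ?L unfolding is_mfunctor_def
    proof (intro conjI ballI allI impI)
      fix h assume "h \<in> Arr (mlt_times M X)"
      then show "Fa h \<in> mhom N (map Fo (Dom (mlt_times M X) h)) (Fo (Cod (mlt_times M X) h))"
        using gD by (auto simp: mhom_def t m elim!: mlt_times_cases)
    next
      fix h ks assume "composable (mlt_times M X) h ks"
      then obtain f gs a bs where *: "h = upair f a" "ks = map2 upair gs bs" "composable M f gs"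
        "composable X a bs"
        and l: "same_arity M X gs bs"
        unfolding composable_mlt_times[OF U] by blast
      show "Fa (Comp (mlt_times M X) h ks) = Comp N (Fa h) (map Fa ks)"
        by (simp only: * t(4) map_ufst_usnd[OF U list_all2_lengthD[OF l]] gD(6)[OF *(3,4) l] m[of
          Fa])
    qed (use gD in \<open>auto simp: t elim!: mlt_times_cases\<close>)
  }
qed

lemma multicategory_mlt_times:
  assumes U: "universe TYPE('u)" and "multicategory M" "multicategory (X :: ('u, 'u) mcat)"
  shows "multicategory (mlt_times M X)"
proof -
  interpret M: multicategory M by fact
  interpret X: multicategory X by fact
  note t = mlt_times_simps[OF U] and u = upair_simps[OF U] and mu = map_ufst_usnd[OF U]
  note c = composable_mlt_times[OF U]
  show ?thesis
  proof
    fix h assume h: "h \<in> Arr (mlt_times M X)"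
    then obtain f a where fa: "h = upair f a" "f \<in> Arr M" "a \<in> Arr X" "length (Dom M f) =
      length (Dom X a)"
      by (rule mlt_times_cases)
    have "upair A x \<in> Obj (mlt_times M X)" if "(A, x) \<in> set (zip (Dom M f) (Dom X a))" for A x
      using set_zip_leftD[OF that] set_zip_rightD[OF that] M.dom_obj[OF fa(2)] X.dom_obj[OF fa(3)]
        by (auto simp: t)
    then show "set (Dom (mlt_times M X) h) \<subseteq> Obj (mlt_times M X)" by (auto simp: fa(1) t(1))
    show "Cod (mlt_times M X) h \<in> Obj (mlt_times M X)"
      using fa M.cod_obj X.cod_obj by (simp add: t)
    show "Comp (mlt_times M X) (Ident (mlt_times M X) (Cod (mlt_times M X) h)) [h] = h"
      using fa M.ident_left X.ident_left by (simp add: t u)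
    have "map (Ident (mlt_times M X)) (map2 upair (Dom M f) (Dom X a)) =
      map2 upair (map (Ident M) (Dom M f)) (map (Ident X) (Dom X a))"
      using fa by (auto simp: t intro!: nth_equalityI)
    then show "Comp (mlt_times M X) h (map (Ident (mlt_times M X)) (Dom (mlt_times M X) h)) = h"
      using fa M.ident_right X.ident_right by (simp only: t(1,4) mu length_map)
  next
    fix h ks assume "composable (mlt_times M X) h ks"
    then obtain f gs a bs where *: "h = upair f a" "ks = map2 upair gs bs" "composable M f gs"
      "composable X a bs"
      and l: "same_arity M X gs bs" unfolding c by blast
    have "length (concat (map (Dom M) gs)) = length (concat (map (Dom X) bs)) \<and>
      map2 upair (concat (map (Dom M) gs)) (concat (map (Dom X) bs))
      = concat (map2 (\<lambda>g b. map2 upair (Dom M g) (Dom X b)) gs bs)"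
      using l by (induction rule: list_all2_induct) auto
    moreover have "Comp (mlt_times M X) h ks = upair (Comp M f gs) (Comp X a bs)"
      by (simp only: *(1,2) t(4) mu[OF list_all2_lengthD[OF l]])
    moreover have "map (Dom (mlt_times M X)) ks = map2 (\<lambda>g b. map2 upair (Dom M g) (Dom X b)) gs bs"
      by (simp add: *(2) t case_prod_unfold comp_def)
    ultimately show "Comp (mlt_times M X) h ks \<in> mhom (mlt_times M X) (concat (map (Dom (mlt_times M
      X)) ks)) (Cod (mlt_times M X) h)"
      using *(1) M.comp_simps[OF *(3)] X.comp_simps[OF *(4)] by (simp add: mhom_def t)
  next
    fix h ks hss
    assume A: "composable (mlt_times M X) h ks"
      and B: "list_all2 (composable (mlt_times M X)) ks hss"
    from A obtain f gs a bs where *: "h = upair f a" "ks = map2 upair gs bs" "composable M f gs"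
      "composable X a bs"
      and l: "same_arity M X gs bs" unfolding c by blast
    let ?F = "map (map ufst) hss" and ?S = "map (map usnd) hss"
    have len: "length gs = length bs" "length hss = length gs"
      using l B * by (auto dest!: list_all2_lengthD)
    have nth: "composable M (gs ! i) (map ufst (hss ! i)) \<and> composable X (bs ! i) (map usnd (hss !
      i))"
      if "i < length gs" for i
    proof -
      have "composable (mlt_times M X) (upair (gs ! i) (bs ! i)) (hss ! i)"
        using B that len * by (auto simp: list_all2_conv_all_nth)
      then show ?thesis unfolding c by (auto simp: u mu simp del: map_map dest!: list_all2_lengthD)
    qed
    have l2: "list_all2 (composable M) gs ?F" "list_all2 (composable X) bs ?S"
      using nth len by (auto simp: list_all2_conv_all_nth)
    have m: "map ufst (map2 (Comp (mlt_times M X)) ks hss) = map2 (Comp M) gs ?F"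
      "map usnd (map2 (Comp (mlt_times M X)) ks hss) = map2 (Comp X) bs ?S"
      using len * by (auto simp: t u intro!: nth_equalityI)
    show "Comp (mlt_times M X) (Comp (mlt_times M X) h ks) (concat hss) =
      Comp (mlt_times M X) h (map2 (Comp (mlt_times M X)) ks hss)"
      using M.comp_assoc[OF *(3) l2(1)] X.comp_assoc[OF *(4) l2(2)]
      by (simp only: *(1) t(4) m) (simp only: *(2) mu[OF len(1)] t(4) map_concat)
  qed (auto simp: t mhom_def M.ident_simps X.ident_simps elim!: mlt_times_cases)
qed

lemma small_mlt_times:
  assumes U: "universe TYPE('u)" and M: "small_multicategory M"
    and X: "small_multicategory (X :: ('u, 'u) mcat)"
  shows "small_multicategory (mlt_times M X)"
proof -
  interpret M: multicategory M using M by (simp add: small_multicategory_def)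
  interpret X: multicategory X using X by (simp add: small_multicategory_def)
  have "Obj (mlt_times M X) = (\<lambda>(A, x). upair A x) ` (Obj M \<times> Obj X)"
    by (auto simp: mlt_times_def)
  then have o: "esmall TYPE('u) (Obj (mlt_times M X))"
    using M X by (simp only:) (intro esmall_image esmall_Sigma[OF U], auto simp:
      small_multicategory_def esmall_small)
  have a: "esmall TYPE('u) (mhom (mlt_times M X) As B)"
    if "set As \<subseteq> Obj (mlt_times M X)" "B \<in> Obj (mlt_times M X)" for As B
  proof (rule esmall_subset)
    let ?H = "mhom M (map ufst As) (ufst B) \<times> mhom X (map usnd As) (usnd B)"
    have m: "set (map ufst As) \<subseteq> Obj M" "ufst B \<in> Obj M" "set (map usnd As) \<subseteq> Obj X"
      "usnd B \<in> Obj X"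
      using that by (auto simp: upair_simps[OF U] elim!: mlt_times_cases dest!: subsetD)
    show "esmall TYPE('u) ((\<lambda>(f, a). upair f a) ` ?H)"
      using m M X by (intro esmall_image esmall_Sigma[OF U]) (auto simp: small_multicategory_def
        esmall_small)
    show "mhom (mlt_times M X) As B \<subseteq> (\<lambda>(f, a). upair f a) ` ?H"
    proof
      fix h assume "h \<in> mhom (mlt_times M X) As B"
      then have h: "h \<in> Arr (mlt_times M X)" "Dom (mlt_times M X) h = As" "Cod (mlt_times M X) h =
        B"
        by (auto simp: mhom_def)
      from h(1) show "h \<in> (\<lambda>(f, a). upair f a) ` ?H"
      proof (rule mlt_times_cases)
        fix f a assume *: "h = upair f a" "f \<in> Arr M" "a \<in> Arr X" "length (Dom M f) =
          length (Dom X a)"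
        then have "(f, a) \<in> ?H"
          using h(2,3) by (auto simp: mhom_def mlt_times_simps[OF U] map_ufst_usnd[OF U]
            upair_simps[OF U] simp del: map_map)
        then show ?thesis using * by force
      qed
    qed
  qed
  show ?thesis
    using o a multicategory_mlt_times[OF U M.multicategory_axioms X.multicategory_axioms]
    by (simp add: small_multicategory_def esmall_small)
qed

lemma mk_mlt_arrow_eq_iff:
  "mk_mlt_arrow M N Fo Fa = mk_mlt_arrow M N Fo' Fa' \<longleftrightarrow>
     (\<forall>A\<in>Obj M. Fo A = Fo' A) \<and> (\<forall>f\<in>Arr M. Fa f = Fa' f)"
  by (auto simp: mk_mlt_arrow_def restr_def fun_eq_iff)

lemma mk_mlt_arrow_simps [simp]:
  "source (mk_mlt_arrow M N Fo Fa) = M" "target (mk_mlt_arrow M N Fo Fa) = N"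
  "A \<in> Obj M \<Longrightarrow> omap (mk_mlt_arrow M N Fo Fa) A = Fo A"
  "f \<in> Arr M \<Longrightarrow> amap (mk_mlt_arrow M N Fo Fa) f = Fa f"
  by (auto simp: mk_mlt_arrow_def restr_def)

lemma hom_Mlt:
  "F \<in> hom Mlt M N \<longleftrightarrow> small_multicategory M \<and> small_multicategory N \<and>
     (\<exists>Fo Fa. is_mfunctor M N Fo Fa \<and> F = mk_mlt_arrow M N Fo Fa)"
  by (auto simp: hom_def Mlt_def) blast

lemma Ob_Mlt: "Ob Mlt = {M. small_multicategory M}"
  by (simp add: Mlt_def)

lemma Cmp_Mlt:
  assumes "is_mfunctor M N Fo Fa"
  shows "Cmp Mlt (mk_mlt_arrow N P Go Ga) (mk_mlt_arrow M N Fo Fa) = mk_mlt_arrow M P (Go \<circ> Fo) (Ga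
    \<circ> Fa)"
  using mfunctorD(1,2)[OF assms] by (simp add: Mlt_def mk_mlt_arrow_eq_iff)

lemma Idn_Mlt: "Idn Mlt M = mk_mlt_arrow M M id id"
  by (simp add: Mlt_def)

lemma category_Mlt: "category Mlt"
proof
  fix F :: "('u, 'u) mlt_arrow"
  assume "F \<in> Ar Mlt"
  then show "Src Mlt F \<in> Ob Mlt" "Tgt Mlt F \<in> Ob Mlt" by (auto simp: Mlt_def)
next
  fix M :: "('u, 'u) mcat"
  assume "M \<in> Ob Mlt"
  then show "Idn Mlt M \<in> hom Mlt M M"
    using mfunctor_id by (auto simp: hom_Mlt Ob_Mlt Idn_Mlt small_multicategory_def)
next
  fix F G and M N P :: "('u, 'u) mcat"
  assume "F \<in> hom Mlt N P" "G \<in> hom Mlt M N"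
  then show "Cmp Mlt F G \<in> hom Mlt M P"
    using mfunctor_comp by (fastforce simp: hom_Mlt Cmp_Mlt)
next
  fix F and M N :: "('u, 'u) mcat"
  assume F: "F \<in> hom Mlt M N"
  then have "is_mfunctor M M id id" using mfunctor_id
    by (auto simp: hom_Mlt small_multicategory_def)
  then show "Cmp Mlt (Idn Mlt N) F = F" "Cmp Mlt F (Idn Mlt M) = F"
    using F by (auto simp: hom_Mlt Idn_Mlt Cmp_Mlt)
next
  fix F G H and M N P Q :: "('u, 'u) mcat"
  assume *: "F \<in> hom Mlt P Q" "G \<in> hom Mlt N P" "H \<in> hom Mlt M N"
  obtain Fo Fa Go Ga Ho Ha where "F = mk_mlt_arrow P Q Fo Fa"
    "is_mfunctor N P Go Ga" "G = mk_mlt_arrow N P Go Ga" "is_mfunctor M N Ho Ha" "H =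
      mk_mlt_arrow M N Ho Ha"
    using * by (auto simp: hom_Mlt)
  then show "Cmp Mlt (Cmp Mlt F G) H = Cmp Mlt F (Cmp Mlt G H)"
    by (simp add: Cmp_Mlt mfunctor_comp comp_assoc)
qed

lemma mlt_times_arrow_mk:
  assumes U: "universe TYPE('u)"
  shows "mlt_times_arrow M (mk_mlt_arrow X Y Ho (Ha :: 'u \<Rightarrow> 'u)) = mk_mlt_arrow (mlt_times M X)
    (mlt_times M Y)
    (\<lambda>z. upair (ufst z) (Ho (usnd z))) (\<lambda>h. upair (ufst h) (Ha (usnd h)))"
  by (auto simp: mlt_times_arrow_def mk_mlt_arrow_eq_iff upair_simps[OF U] elim!: mlt_times_cases)

text \<open>The identity of \<open>M \<times> Y\<close> is read as the bifunctor
  \<open>upair\<close>, and \<open>H\<close> is substituted in its second variable.\<close>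

lemma mfunctor_mlt_times_right:
  assumes U: "universe TYPE('u)" and H: "is_mfunctor X Y Ho (Ha :: 'u \<Rightarrow> 'u)"
  shows "is_mfunctor (mlt_times M X) (mlt_times M Y) (\<lambda>z. upair (ufst z) (Ho (usnd z))) (\<lambda>h. upair
    (ufst h) (Ha (usnd h)))"
proof -
  have "is_mfunctor (mlt_times M Y) (mlt_times M Y) id id"
    using composable_mlt_times[OF U] by (auto simp: is_mfunctor_def mhom_def)
  then have "mbifun M Y (mlt_times M Y) upair upair"
    by (simp add: is_mfunctor_mlt_times[OF U])
  from mbifun_mfunctor_right[OF this H] show ?thesis
    by (simp add: is_mfunctor_mlt_times[OF U] upair_simps[OF U])
qed

lemma is_functor_mlt_times:
  assumes U: "universe TYPE('u)" and M: "small_multicategory (M :: ('u, 'u) mcat)"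
  shows "is_functor Mlt Mlt (mlt_times M) (mlt_times_arrow M)"
  unfolding is_functor_def
proof (intro conjI ballI impI)
  fix X :: "('u, 'u) mcat" assume "X \<in> Ob Mlt"
  then show "mlt_times M X \<in> Ob Mlt" using small_mlt_times[OF U M] by (simp add: Ob_Mlt)
  show "mlt_times_arrow M (Idn Mlt X) = Idn Mlt (mlt_times M X)"
    by (auto simp: Idn_Mlt mlt_times_arrow_mk[OF U] mk_mlt_arrow_eq_iff upair_simps[OF U] elim!:
      mlt_times_cases)
next
  fix X Y :: "('u, 'u) mcat" and F assume "F \<in> hom Mlt X Y"
  then obtain Fo Fa where F: "small_multicategory X" "small_multicategory Y" "is_mfunctor X Y Fo Fa"
    "F = mk_mlt_arrow X Y Fo Fa" by (auto simp: hom_Mlt)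
  show "mlt_times_arrow M F \<in> hom Mlt (mlt_times M X) (mlt_times M Y)"
    unfolding hom_Mlt F(4) mlt_times_arrow_mk[OF U]
    using mfunctor_mlt_times_right[OF U F(3)] small_mlt_times[OF U M] F(1,2) by blast
next
  fix F G :: "('u, 'u) mlt_arrow"
  assume "F \<in> Ar Mlt" "G \<in> Ar Mlt" "Tgt Mlt G = Src Mlt F"
  then obtain X Y Z Fo Fa Go Ga where *: "F = mk_mlt_arrow Y Z Fo Fa" "G = mk_mlt_arrow X Y Go Ga"
    "is_mfunctor X Y Go Ga" by (auto simp: Mlt_def)
  show "mlt_times_arrow M (Cmp Mlt F G) = Cmp Mlt (mlt_times_arrow M F) (mlt_times_arrow M G)"
    using mfunctor_mlt_times_right[OF U *(3)]
    by (simp add: *(1,2) Cmp_Mlt *(3) mlt_times_arrow_mk[OF U] upair_simps[OF U] comp_def)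
qed

section \<open>Exponentials as universal bifunctors\<close>

text \<open>The equation \<open>ev \<circ> (M \<times> h) = g\<close> in curried form. Outside
  \<open>Obj X\<close> and \<open>Arr X\<close> the values of \<open>ho\<close> and
  \<open>ha\<close> are arbitrary, so uniqueness of a transpose can only mean equality on these
  sets.\<close>

definition transposes ::
  "('o, 'a) mcat \<Rightarrow> ('p, 'b) mcat \<Rightarrow> ('q, 'c) mcat \<Rightarrow> ('o \<Rightarrow> 'q \<Rightarrow> 'r) \<Rightarrow> ('a \<Rightarrow> 'c \<Rightarrow> 'd) \<Rightarrow>
   ('o \<Rightarrow> 'p \<Rightarrow> 'r) \<Rightarrow> ('a \<Rightarrow> 'b \<Rightarrow> 'd) \<Rightarrow> ('p \<Rightarrow> 'q) \<Rightarrow> ('b \<Rightarrow> 'c) \<Rightarrow> bool" where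
  "transposes M X E eo ea go ga ho ha \<longleftrightarrow> is_mfunctor X E ho ha \<and>
     (\<forall>A\<in>Obj M. \<forall>x\<in>Obj X. eo A (ho x) = go A x) \<and>
     (\<forall>f\<in>Arr M. \<forall>a\<in>Arr X. length (Dom M f) = length (Dom X a) \<longrightarrow> ea f (ha a) = ga f a)"

text \<open>
  HOL only allows quantification over \<open>X\<close> of one fixed type here; by transport the universal
  property extends to small multicategories over any types.
\<close>

definition universal_ev ::
  "('u, 'u) mcat \<Rightarrow> ('p, 'b) mcat \<Rightarrow> ('u, 'u) mcat \<Rightarrow> ('u \<Rightarrow> 'u \<Rightarrow> 'p) \<Rightarrow> ('u \<Rightarrow> 'u \<Rightarrow> 'b) \<Rightarrow> bool" where
  "universal_ev M N E eo ea \<longleftrightarrow> small_multicategory E \<and> mbifun M E N eo ea \<and>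
     (\<forall>(X :: ('u, 'u) mcat) go ga. small_multicategory X \<and> mbifun M X N go ga \<longrightarrow>
        (\<exists>ho ha. transposes M X E eo ea go ga ho ha) \<and>
        (\<forall>ho ha ho' ha'. transposes M X E eo ea go ga ho ha \<and> transposes M X E eo ea go ga ho' ha' \<longrightarrow>
           (\<forall>x\<in>Obj X. ho x = ho' x) \<and> (\<forall>a\<in>Arr X. ha a = ha' a)))"

lemma Cmp_times_arrow_eq_iff:
  assumes U: "universe TYPE('u)" and h: "is_mfunctor X E ho (ha :: 'u \<Rightarrow> 'u)"
  shows "Cmp Mlt (mk_mlt_arrow (mlt_times M E) N eo ea) (mlt_times_arrow M (mk_mlt_arrow X E ho ha))
      = mk_mlt_arrow (mlt_times M X) N go ga \<longleftrightarrow>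
    transposes M X E (\<lambda>A x. eo (upair A x)) (\<lambda>f a. ea (upair f a)) (\<lambda>A x. go (upair A x)) (\<lambda>f a. ga
      (upair f a)) ho ha"
proof -
  have "Cmp Mlt (mk_mlt_arrow (mlt_times M E) N eo ea) (mlt_times_arrow M (mk_mlt_arrow X E ho ha))
    =
    mk_mlt_arrow (mlt_times M X) N (\<lambda>z. eo (upair (ufst z) (ho (usnd z)))) (\<lambda>z. ea (upair (ufst z)
      (ha (usnd z))))"
    using mfunctor_mlt_times_right[OF U h] by (simp add: mlt_times_arrow_mk[OF U] Cmp_Mlt comp_def)
  moreover have "(\<forall>z\<in>Obj (mlt_times M X). P z) \<longleftrightarrow> (\<forall>A\<in>Obj M. \<forall>x\<in>Obj X. P (upair A x))"
    "(\<forall>z\<in>Arr (mlt_times M X). P z) \<longleftrightarrow>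
     (\<forall>f\<in>Arr M. \<forall>a\<in>Arr X. length (Dom M f) = length (Dom X a) \<longrightarrow> P (upair f a))" for P
    by (auto simp: mlt_times_def)
  ultimately show ?thesis
    using h by (simp add: mk_mlt_arrow_eq_iff transposes_def upair_simps[OF U])
qed

lemma exponentiable_iff:
  assumes U: "universe TYPE('u)" and M: "small_multicategory (M :: ('u, 'u) mcat)"
  shows "exponentiable M \<longleftrightarrow>
    (\<forall>N :: ('u, 'u) mcat. small_multicategory N \<longrightarrow> (\<exists>E eo ea. universal_ev M N E eo ea))"
proof -
  have "exponentiable M \<longleftrightarrow> (\<forall>N. small_multicategory N \<longrightarrow> (\<exists>E. small_multicategory E \<and>
      (\<exists>e\<in>hom Mlt (mlt_times M E) N. \<forall>X. small_multicategory X \<longrightarrow> (\<forall>g\<in>hom Mlt (mlt_times M X) N.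
         \<exists>!h. h \<in> hom Mlt X E \<and> Cmp Mlt e (mlt_times_arrow M h) = g))))"
    unfolding exponentiable_def
      has_right_adjoint_iff_universal[OF category_Mlt category_Mlt is_functor_mlt_times[OF U M]]
    by (auto simp: Ob_Mlt)
  also have "\<dots> \<longleftrightarrow> (\<forall>N :: ('u, 'u) mcat. small_multicategory N \<longrightarrow> (\<exists>E eo ea. universal_ev M N E eo
    ea))"
    (is "(\<forall>N. _ \<longrightarrow> ?P N) \<longleftrightarrow> (\<forall>N. _ \<longrightarrow> ?Q N)")
  proof -
    have cong: "(\<forall>N. S N \<longrightarrow> P N) \<longleftrightarrow> (\<forall>N. S N \<longrightarrow> Q N)"
      if "\<And>N. S N \<Longrightarrow> P N \<Longrightarrow> Q N" "\<And>N. S N \<Longrightarrow> Q N \<Longrightarrow> P N" for S P Q :: "('u, 'u) mcat \<Rightarrow> bool"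
      using that by blast
    {
      fix N :: "('u, 'u) mcat"
      assume N: "small_multicategory N"
      assume "\<exists>E. small_multicategory E \<and> (\<exists>e\<in>hom Mlt (mlt_times M E) N. \<forall>X. small_multicategory X \<longrightarrow>
        (\<forall>g\<in>hom Mlt (mlt_times M X) N. \<exists>!h. h \<in> hom Mlt X E \<and> Cmp Mlt e (mlt_times_arrow M h) = g))"
      then obtain E e where E: "small_multicategory E" and e: "e \<in> hom Mlt (mlt_times M E) N"
        and univ: "\<And>X g. small_multicategory X \<Longrightarrow> g \<in> hom Mlt (mlt_times M X) N \<Longrightarrow>
          \<exists>!h. h \<in> hom Mlt X E \<and> Cmp Mlt e (mlt_times_arrow M h) = g" by blast
      obtain eo ea where eF: "is_mfunctor (mlt_times M E) N eo ea"
        and e_eq: "e = mk_mlt_arrow (mlt_times M E) N eo ea"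
        using e by (auto simp: hom_Mlt)
      define eo' ea' where "eo' = (\<lambda>A x. eo (upair A x))" and "ea' = (\<lambda>f a. ea (upair f a))"
      have b: "mbifun M E N eo' ea'"
        using eF by (simp add: is_mfunctor_mlt_times[OF U] eo'_def ea'_def)
      {
        fix X :: "('u, 'u) mcat" and go ga
        assume X: "small_multicategory X" "mbifun M X N go ga"
        define g where "g = mk_mlt_arrow (mlt_times M X) N (\<lambda>z. go (ufst z) (usnd z)) (\<lambda>z. ga (ufst
          z) (usnd z))"
        have g: "g \<in> hom Mlt (mlt_times M X) N"
          using X small_mlt_times[OF U M] N
          by (auto simp: hom_Mlt g_def is_mfunctor_mlt_times[OF U] upair_simps[OF U] intro!: exI)
        \<comment> \<open>The triangle in \<open>Mlt\<close> is literally a transposition, so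
          existence and uniqueness of \<open>h\<close> carry over.\<close>
        have tr: "Cmp Mlt e (mlt_times_arrow M (mk_mlt_arrow X E ho ha)) = g \<longleftrightarrow>
          transposes M X E eo' ea' go ga ho ha"
          if h: "is_mfunctor X E ho ha" for ho ha
          by (simp add: e_eq g_def Cmp_times_arrow_eq_iff[OF U h] upair_simps[OF U] eo'_def ea'_def)
        from univ[OF X(1) g] obtain h where "h \<in> hom Mlt X E" "Cmp Mlt e (mlt_times_arrow M h) = g"
          by blast
        then have ex: "\<exists>ho ha. transposes M X E eo' ea' go ga ho ha"
          using tr by (auto simp: hom_Mlt)
        have uniq: "(\<forall>x\<in>Obj X. ho x = ho' x) \<and> (\<forall>a\<in>Arr X. ha a = ha' a)"
          if t: "transposes M X E eo' ea' go ga ho ha" "transposes M X E eo' ea' go ga ho' ha'"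
            for ho ha ho' ha'
        proof -
          have h: "is_mfunctor X E ho ha" "is_mfunctor X E ho' ha'"
            using t by (simp_all add: transposes_def)
          then have "mk_mlt_arrow X E ho ha \<in> hom Mlt X E" "mk_mlt_arrow X E ho' ha' \<in> hom Mlt X E"
            using X(1) E by (auto simp: hom_Mlt)
          then have "mk_mlt_arrow X E ho ha = mk_mlt_arrow X E ho' ha'"
            using univ[OF X(1) g] t tr[OF h(1)] tr[OF h(2)] by blast
          then show ?thesis by (simp add: mk_mlt_arrow_eq_iff)
        qed
        note ex uniq
      }
      then have "universal_ev M N E eo' ea'"
        using E b unfolding universal_ev_def by blast
      then have "\<exists>E eo ea. universal_ev M N E eo ea" by blast
    }
    note LR = this
    {
      fix N :: "('u, 'u) mcat"
      assume N: "small_multicategory N"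
      assume "\<exists>E eo ea. universal_ev M N E eo ea"
      then obtain E eo ea where E: "universal_ev M N E eo ea" by blast
      define e where "e = mk_mlt_arrow (mlt_times M E) N (\<lambda>z. eo (ufst z) (usnd z)) (\<lambda>z. ea (ufst z)
        (usnd z))"
      have sE: "small_multicategory E" using E by (simp add: universal_ev_def)
      have e: "e \<in> hom Mlt (mlt_times M E) N"
        using E small_mlt_times[OF U M sE] N
        by (auto simp: hom_Mlt e_def is_mfunctor_mlt_times[OF U] upair_simps[OF U] universal_ev_def
          intro!: exI)
      have "\<exists>!h. h \<in> hom Mlt X E \<and> Cmp Mlt e (mlt_times_arrow M h) = g"
        if X: "small_multicategory X" and g: "g \<in> hom Mlt (mlt_times M X) N" for X g
      proof -
        obtain go ga where gF: "is_mfunctor (mlt_times M X) N go ga"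
          and g_eq: "g = mk_mlt_arrow (mlt_times M X) N go ga"
          using g by (auto simp: hom_Mlt)
        define go' ga' where "go' = (\<lambda>A x. go (upair A x))" and "ga' = (\<lambda>f a. ga (upair f a))"
        have gb: "mbifun M X N go' ga'" using gF
          by (simp add: is_mfunctor_mlt_times[OF U] go'_def ga'_def)
        have tr: "Cmp Mlt e (mlt_times_arrow M (mk_mlt_arrow X E ho ha)) = g \<longleftrightarrow>
          transposes M X E eo ea go' ga' ho ha"
          if h: "is_mfunctor X E ho ha" for ho ha
          by (simp add: e_def g_eq Cmp_times_arrow_eq_iff[OF U h] upair_simps[OF U] go'_def ga'_def)
        from E X gb obtain ho ha where h: "transposes M X E eo ea go' ga' ho ha"
          unfolding universal_ev_def by blast
        show ?thesis
        proof (rule ex1I[of _ "mk_mlt_arrow X E ho ha"])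
          show "mk_mlt_arrow X E ho ha \<in> hom Mlt X E \<and> Cmp Mlt e (mlt_times_arrow M (mk_mlt_arrow X
            E ho ha)) = g"
            using h tr X sE by (auto simp: hom_Mlt transposes_def)
          fix k assume k: "k \<in> hom Mlt X E \<and> Cmp Mlt e (mlt_times_arrow M k) = g"
          then obtain ko ka where kF: "is_mfunctor X E ko ka" and k_eq: "k = mk_mlt_arrow X E ko ka"
            by (auto simp: hom_Mlt)
          then have t: "transposes M X E eo ea go' ga' ko ka" using k tr by simp
          have "(\<forall>x\<in>Obj X. ko x = ho x) \<and> (\<forall>a\<in>Arr X. ka a = ha a)"
            using E X gb t h unfolding universal_ev_def by blast
          then show "k = mk_mlt_arrow X E ho ha" by (simp add: k_eq mk_mlt_arrow_eq_iff)
        qed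
      qed
      then have "\<exists>E. small_multicategory E \<and> (\<exists>e\<in>hom Mlt (mlt_times M E) N. \<forall>X. small_multicategory
        X \<longrightarrow>
        (\<forall>g\<in>hom Mlt (mlt_times M X) N. \<exists>!h. h \<in> hom Mlt X E \<and> Cmp Mlt e (mlt_times_arrow M h) = g))"
        using e sE by blast
    }
    note RL = this
    show ?thesis
    proof (rule cong)
      fix N assume "small_multicategory N" "?P N"
      then show "?Q N" by (rule LR)
    next
      fix N assume "small_multicategory N" "?Q N"
      then show "?P N" by (rule RL)
    qed
  qed
  finally show ?thesis .
qed

lemma transposesD:
  assumes "transposes M X E eo ea go ga ho ha"
  shows "is_mfunctor X E ho ha"
    and "A \<in> Obj M \<Longrightarrow> x \<in> Obj X \<Longrightarrow> eo A (ho x) = go A x"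
    and "f \<in> Arr M \<Longrightarrow> a \<in> Arr X \<Longrightarrow> length (Dom M f) = length (Dom X a) \<Longrightarrow> ea f (ha a) = ga f a"
  using assms by (auto simp: transposes_def)

lemma transposes_compose:
  assumes h: "transposes M X E eo ea go ga ho ha" and F: "is_mfunctor Y X Fo Fa"
  shows "transposes M Y E eo ea (\<lambda>A y. go A (Fo y)) (\<lambda>f b. ga f (Fa b)) (ho \<circ> Fo) (ha \<circ> Fa)"
  using mfunctor_comp[OF F transposesD(1)[OF h]] transposesD(2,3)[OF h] mfunctorD[OF F]
  by (auto simp: transposes_def)

lemma universal_evD:
  assumes "universal_ev M N E eo ea"
  shows "small_multicategory E" "multicategory E" "mbifun M E N eo ea"
  using assms by (auto simp: universal_ev_def small_multicategory_def)

lemma universal_ev_transpose: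
  fixes X :: "('p, 'b) mcat" and M :: "('u, 'u) mcat"
  assumes U: "universe TYPE('u)" and E: "universal_ev M N E eo ea"
    and X: "esmall_mcat TYPE('u) X" and g: "mbifun M X N go ga"
  obtains ho ha where "transposes M X E eo ea go ga ho ha"
proof -
  obtain X' :: "('u, 'u) mcat" and Fo Fa Go Ga where X': "small_multicategory X'"
    and F: "is_mfunctor X X' Fo Fa" and G: "is_mfunctor X' X Go Ga"
    and GF: "\<And>x. x \<in> Obj X \<Longrightarrow> Go (Fo x) = x" "\<And>a. a \<in> Arr X \<Longrightarrow> Ga (Fa a) = a"
    using obtain_small_copy[OF U X] by metis
  obtain ho ha where "transposes M X' E eo ea (\<lambda>A x. go A (Go x)) (\<lambda>f a. ga f (Ga a)) ho ha"
    using E X' mbifun_mfunctor_right[OF g G] unfolding universal_ev_def by blast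
  from transposes_compose[OF this F]
  have "transposes M X E eo ea go ga (ho \<circ> Fo) (ha \<circ> Fa)"
    using GF by (auto simp: transposes_def)
  then show thesis by (rule that)
qed

lemma universal_ev_unique:
  fixes X :: "('p, 'b) mcat" and M :: "('u, 'u) mcat"
  assumes U: "universe TYPE('u)" and E: "universal_ev M N E eo ea"
    and X: "esmall_mcat TYPE('u) X" and g: "mbifun M X N go ga"
    and h: "transposes M X E eo ea go ga ho ha" and h': "transposes M X E eo ea go ga ho' ha'"
  shows "x \<in> Obj X \<Longrightarrow> ho x = ho' x" "a \<in> Arr X \<Longrightarrow> ha a = ha' a"
proof -
  obtain X' :: "('u, 'u) mcat" and Fo Fa Go Ga where X': "small_multicategory X'"
    and F: "is_mfunctor X X' Fo Fa" and G: "is_mfunctor X' X Go Ga"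
    and GF: "\<And>x. x \<in> Obj X \<Longrightarrow> Go (Fo x) = x" "\<And>a. a \<in> Arr X \<Longrightarrow> Ga (Fa a) = a"
    using obtain_small_copy[OF U X] by metis
  have *: "(\<forall>x\<in>Obj X'. (ho \<circ> Go) x = (ho' \<circ> Go) x) \<and> (\<forall>a\<in>Arr X'. (ha \<circ> Ga) a = (ha' \<circ> Ga) a)"
    using E X' mbifun_mfunctor_right[OF g G] transposes_compose[OF h G] transposes_compose[OF h' G]
    unfolding universal_ev_def by blast
  show "x \<in> Obj X \<Longrightarrow> ho x = ho' x"
    using *[THEN conjunct1, rule_format, of "Fo x"] mfunctorD(1)[OF F] GF by simp
  show "a \<in> Arr X \<Longrightarrow> ha a = ha' a"
    using *[THEN conjunct2, rule_format, of "Fa a"] mfunctorD(2)[OF F] GF by simp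
qed

text \<open>Here the target \<open>N\<close> is replaced by a copy \<open>N'\<close> in
  \<open>'u\<close>. Evaluation into \<open>N'\<close> is followed by the isomorphism back to
  \<open>N\<close>; by \<open>tr\<close>, transposing \<open>g\<close> for it amounts to
  transposing, for \<open>N'\<close>, the bifunctor \<open>g\<close> followed by the isomorphism
  from \<open>N\<close> to \<open>N'\<close>.\<close>

lemma exponentiable_universal_ev:
  fixes N :: "('p, 'b) mcat" and M :: "('u, 'u) mcat"
  assumes U: "universe TYPE('u)" and M: "small_multicategory M" and ex: "exponentiable M"
    and N: "esmall_mcat TYPE('u) N"
  obtains E eo ea where "universal_ev M N E eo ea"
proof -
  obtain N' :: "('u, 'u) mcat" and Fo Fa Go Ga where N': "small_multicategory N'"
    and F: "is_mfunctor N N' Fo Fa" and G: "is_mfunctor N' N Go Ga"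
    and GF: "\<And>x. x \<in> Obj N \<Longrightarrow> Go (Fo x) = x" "\<And>a. a \<in> Arr N \<Longrightarrow> Ga (Fa a) = a"
    and FG: "\<And>x. x \<in> Obj N' \<Longrightarrow> Fo (Go x) = x" "\<And>a. a \<in> Arr N' \<Longrightarrow> Fa (Ga a) = a"
    using obtain_small_copy[OF U N] by metis
  obtain E eo ea where E: "universal_ev M N' E eo ea"
    using exponentiable_iff[OF U M] ex N' by blast
  note e = universal_evD[OF E]
  have tr: "transposes M X E (\<lambda>A x. Go (eo A x)) (\<lambda>f a. Ga (ea f a)) go ga ho ha \<longleftrightarrow>
      transposes M X E eo ea (\<lambda>A x. Fo (go A x)) (\<lambda>f a. Fa (ga f a)) ho ha"
    if g: "mbifun M X N go ga" for X :: "('u, 'u) mcat" and go ga ho ha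
  proof (cases "is_mfunctor X E ho ha")
    case True
    note h = mfunctorD[OF True]
    have "Go (eo A (ho x)) = go A x \<longleftrightarrow> eo A (ho x) = Fo (go A x)" if "A \<in> Obj M" "x \<in> Obj X" for A x
      using GF(1)[OF mbifunD(1)[OF g that]] FG(1)[OF mbifunD(1)[OF e(3) that(1) h(1)[OF that(2)]]]
        by metis
    moreover have "Ga (ea f (ha a)) = ga f a \<longleftrightarrow> ea f (ha a) = Fa (ga f a)"
      if "f \<in> Arr M" "a \<in> Arr X" "length (Dom M f) = length (Dom X a)" for f a
    proof -
      have "length (Dom M f) = length (Dom E (ha a))" using that h(3) by simp
      from GF(2)[OF mbifunD(2)[OF g that]] FG(2)[OF mbifunD(2)[OF e(3) that(1) h(2)[OF that(2)]
        this]]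
      show ?thesis by metis
    qed
    ultimately show ?thesis by (simp add: transposes_def)
  qed (simp add: transposes_def)
  have "universal_ev M N E (\<lambda>A x. Go (eo A x)) (\<lambda>f a. Ga (ea f a))"
    unfolding universal_ev_def
  proof (intro conjI allI impI)
    fix X :: "('u, 'u) mcat" and go ga
    assume X: "small_multicategory X \<and> mbifun M X N go ga"
    then have g: "mbifun M X N go ga" "mbifun M X N' (\<lambda>A x. Fo (go A x)) (\<lambda>f a. Fa (ga f a))"
      using mbifun_mfunctor_left[OF _ F] by blast+
    have *: "(\<exists>ho ha. transposes M X E eo ea (\<lambda>A x. Fo (go A x)) (\<lambda>f a. Fa (ga f a)) ho ha) \<and>
      (\<forall>ho ha ho' ha'. transposes M X E eo ea (\<lambda>A x. Fo (go A x)) (\<lambda>f a. Fa (ga f a)) ho ha \<and>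
         transposes M X E eo ea (\<lambda>A x. Fo (go A x)) (\<lambda>f a. Fa (ga f a)) ho' ha' \<longrightarrow>
         (\<forall>x\<in>Obj X. ho x = ho' x) \<and> (\<forall>a\<in>Arr X. ha a = ha' a))"
      using E X g(2) unfolding universal_ev_def by blast
    then show "\<exists>ho ha. transposes M X E (\<lambda>A x. Go (eo A x)) (\<lambda>f a. Ga (ea f a)) go ga ho ha"
      by (simp only: tr[OF g(1)])
    fix ho ha ho' ha'
    assume "transposes M X E (\<lambda>A x. Go (eo A x)) (\<lambda>f a. Ga (ea f a)) go ga ho ha \<and>
      transposes M X E (\<lambda>A x. Go (eo A x)) (\<lambda>f a. Ga (ea f a)) go ga ho' ha'"
    with * show "\<forall>x\<in>Obj X. ho x = ho' x" "\<forall>a\<in>Arr X. ha a = ha' a"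
      unfolding tr[OF g(1)] by blast+
  qed (use e mbifun_mfunctor_left[OF e(3) G] in auto)
  then show thesis by (rule that)
qed

text \<open>The exponential constructed below has functions as objects, so it does not live over
  \<open>'u\<close>. Its small copy has the same universal property: transposes are pushed into the
  copy by \<open>Fo\<close>, \<open>Fa\<close> and pulled back by \<open>Go\<close>,
  \<open>Ga\<close>.\<close>

lemma exponentiableI:
  fixes M :: "('u, 'u) mcat"
  assumes U: "universe TYPE('u)" and M: "small_multicategory M"
    and E: "\<And>N :: ('u, 'u) mcat. small_multicategory N \<Longrightarrow> esmall_mcat TYPE('u) (E N :: ('p,
      'b) mcat)"
    and e: "\<And>N :: ('u, 'u) mcat. small_multicategory N \<Longrightarrow> mbifun M (E N) N (eo N) (ea N)"
    and ex: "\<And>(N :: ('u, 'u) mcat) (X :: ('u, 'u) mcat) go ga. small_multicategory N \<Longrightarrow>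
      multicategory X \<Longrightarrow>
      mbifun M X N go ga \<Longrightarrow> \<exists>ho ha. transposes M X (E N) (eo N) (ea N) go ga ho ha"
    and uniq: "\<And>(N :: ('u, 'u) mcat) (X :: ('u, 'u) mcat) go ga ho ha ho' ha'. small_multicategory N
      \<Longrightarrow>
      multicategory X \<Longrightarrow> mbifun M X N go ga \<Longrightarrow> transposes M X (E N) (eo N) (ea N) go ga ho ha \<Longrightarrow>
      transposes M X (E N) (eo N) (ea N) go ga ho' ha' \<Longrightarrow>
      (\<forall>x\<in>Obj X. ho x = ho' x) \<and> (\<forall>a\<in>Arr X. ha a = ha' a)"
  shows "exponentiable M"
  unfolding exponentiable_iff[OF U M]
proof (intro allI impI)
  fix N :: "('u, 'u) mcat" assume N: "small_multicategory N"
  obtain E' :: "('u, 'u) mcat" and Fo Fa Go Ga where E': "small_multicategory E'"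
    and F: "is_mfunctor (E N) E' Fo Fa" and G: "is_mfunctor E' (E N) Go Ga"
    and GF: "\<And>x. x \<in> Obj (E N) \<Longrightarrow> Go (Fo x) = x" "\<And>a. a \<in> Arr (E N) \<Longrightarrow> Ga (Fa a) = a"
    and FG: "\<And>x. x \<in> Obj E' \<Longrightarrow> Fo (Go x) = x" "\<And>a. a \<in> Arr E' \<Longrightarrow> Fa (Ga a) = a"
    using obtain_small_copy[OF U E[OF N]] by metis
  have "universal_ev M N E' (\<lambda>A x. eo N A (Go x)) (\<lambda>f a. ea N f (Ga a))"
    unfolding universal_ev_def
  proof (intro conjI allI impI)
    fix X :: "('u, 'u) mcat" and go ga
    assume X: "small_multicategory X \<and> mbifun M X N go ga"
    then have mX: "multicategory X" and g: "mbifun M X N go ga"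
      by (auto simp: small_multicategory_def)
    obtain ho ha where h: "transposes M X (E N) (eo N) (ea N) go ga ho ha"
      using ex[OF N mX g] by blast
    note hD = transposesD[OF h] and hF = mfunctorD[OF transposesD(1)[OF h]]
    have "transposes M X E' (\<lambda>A x. eo N A (Go x)) (\<lambda>f a. ea N f (Ga a)) go ga (Fo \<circ> ho) (Fa \<circ> ha)"
      using mfunctor_comp[OF hD(1) F] hD(2,3) hF GF by (auto simp: transposes_def)
    then show "\<exists>ho ha. transposes M X E' (\<lambda>A x. eo N A (Go x)) (\<lambda>f a. ea N f (Ga a)) go ga ho ha"
      by blast
    have down: "transposes M X (E N) (eo N) (ea N) go ga (Go \<circ> ho) (Ga \<circ> ha)"
      if "transposes M X E' (\<lambda>A x. eo N A (Go x)) (\<lambda>f a. ea N f (Ga a)) go ga ho ha" for ho ha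
      using that mfunctor_comp[OF _ G] by (auto simp: transposes_def)
    fix ho ha ho' ha'
    assume "transposes M X E' (\<lambda>A x. eo N A (Go x)) (\<lambda>f a. ea N f (Ga a)) go ga ho ha \<and>
      transposes M X E' (\<lambda>A x. eo N A (Go x)) (\<lambda>f a. ea N f (Ga a)) go ga ho' ha'"
    then have t: "transposes M X E' (\<lambda>A x. eo N A (Go x)) (\<lambda>f a. ea N f (Ga a)) go ga ho ha"
      "transposes M X E' (\<lambda>A x. eo N A (Go x)) (\<lambda>f a. ea N f (Ga a)) go ga ho' ha'" by auto
    note h = mfunctorD[OF transposesD(1)[OF t(1)]] and h' = mfunctorD[OF transposesD(1)[OF t(2)]]
    have "Go (ho x) = Go (ho' x)" if "x \<in> Obj X"
      for x using uniq[OF N mX g down[OF t(1)] down[OF t(2)]] that by auto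
    then show "\<forall>x\<in>Obj X. ho x = ho' x" using FG(1)[OF h(1)] FG(1)[OF h'(1)] by metis
    have "Ga (ha a) = Ga (ha' a)" if "a \<in> Arr X"
      for a using uniq[OF N mX g down[OF t(1)] down[OF t(2)]] that by auto
    then show "\<forall>a\<in>Arr X. ha a = ha' a" using FG(2)[OF h(2)] FG(2)[OF h'(2)] by metis
  qed (use E' mbifun_mfunctor_right[OF e[OF N] G] in auto)
  then show "\<exists>E eo ea. universal_ev M N E eo ea" by blast
qed

section \<open>Decompositions up to the coend relation\<close>

lemma Ar_unary_cat: "Ar (unary_cat M) = ary M 1"
  by (simp add: unary_cat_def ary_def)

lemma Src_unary_cat: "Src (unary_cat M) = (\<lambda>f. hd (Dom M f))"
  by (simp add: unary_cat_def)

lemma ary1_Dom: "u \<in> ary M (Suc 0) \<Longrightarrow> Dom M u = [hd (Dom M u)]"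
  by (cases "Dom M u") (auto simp: ary_def)

text \<open>With each \<open>g_i\<close> as a one-element list, the composites
  \<open>u_i g_i\<close> are an instance of the double composition in \<open>comp_assoc\<close>, and
  concatenation gives back \<open>gs\<close>.\<close>

lemma map2_singleton_Comp: "map2 (\<lambda>u g. Comp M u [g]) us gs = map2 (Comp M) us (map (\<lambda>g. [g]) gs)"
  by (simp add: zip_map2 case_prod_unfold comp_def)

lemma concat_singletons: "concat (map (\<lambda>g. [g]) gs) = gs"
  by (induction gs) auto

context multicategory
begin

lemma coend_stepE:
  assumes "(x, y) \<in> coend_step M \<Gamma>s B"
  obtains f us gs where "x = (f, map2 (Comp M) us (map (\<lambda>g. [g]) gs))" "y = (Comp M f us, gs)"
    "composable M f us" "Cod M f = B" "set us \<subseteq> ary M 1"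
    "list_all2 (composable M) us (map (\<lambda>g. [g]) gs)" "map (Dom M) gs = \<Gamma>s"
proof -
  obtain f us gs where *: "x = (f, map2 (\<lambda>u g. Comp M u [g]) us gs)" "y = (Comp M f us, gs)"
    "composable M f us" "Cod M f = B" "set us \<subseteq> ary M 1" "set gs \<subseteq> Arr M"
    "map (Cod M) gs = map (\<lambda>f. hd (Dom M f)) us" "map (Dom M) gs = \<Gamma>s"
    using assms unfolding coend_step_def Ar_unary_cat Src_unary_cat mem_Collect_eq prod.inject
      by blast
  have "list_all2 (composable M) us (map (\<lambda>g. [g]) gs)"
  proof -
    have l: "length us = length gs" using *(7) by (metis length_map)
    have "composable M (us ! i) [gs ! i]" if "i < length gs" for i
    proof -
      have u: "us ! i \<in> ary M 1" using *(5) that l by (simp add: subset_iff)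
      have "Cod M (gs ! i) = hd (Dom M (us ! i))"
        using arg_cong[OF *(7), of "\<lambda>xs. xs ! i"] that l by simp
      then show ?thesis using u *(6) that ary1_Dom[of "us ! i" M]
        by (auto simp: composable_def ary_def)
    qed
    then show ?thesis using l by (simp add: list_all2_conv_all_nth)
  qed
  then show thesis using that * map2_singleton_Comp by metis
qed

lemma coend_stepI:
  assumes c: "composable M f us" and u: "set us \<subseteq> ary M 1"
    and l: "list_all2 (composable M) us (map (\<lambda>g. [g]) gs)"
  shows "((f, map2 (Comp M) us (map (\<lambda>g. [g]) gs)), (Comp M f us, gs)) \<in> coend_step M (map (Dom M)
    gs) (Cod M f)"
proof -
  have "set gs \<subseteq> Arr M" using l by (auto simp: list_all2_conv_all_nth composable_def
    in_set_conv_nth)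
  moreover have "map (Cod M) gs = map (\<lambda>u. hd (Dom M u)) us"
    using l by (auto simp: list_all2_conv_all_nth composable_nth intro!: nth_equalityI) (metis
      hd_conv_nth length_greater_0_conv lessI list.size(3,4) nth_Cons_0 zero_less_one less_Suc0
      One_nat_def)
  ultimately show ?thesis
    unfolding coend_step_def Ar_unary_cat Src_unary_cat map2_singleton_Comp mem_Collect_eq
    using c u by blast
qed

lemma decomps_concat:
  assumes "composable M f us" and l: "list_all2 (composable M) us (map (\<lambda>g. [g]) gs)"
  shows "(f, map2 (Comp M) us (map (\<lambda>g. [g]) gs)) \<in> decomps M (map (Dom M) gs) (Cod M f)"
    and "(Comp M f us, gs) \<in> decomps M (map (Dom M) gs) (Cod M f)"
    and "Comp M f (map2 (Comp M) us (map (\<lambda>g. [g]) gs)) = Comp M (Comp M f us) gs"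
proof -
  note c = composable_concat[OF assms, unfolded concat_singletons]
  have "map (Dom M) (map2 (Comp M) us (map (\<lambda>g. [g]) gs)) = map (Dom M) gs"
    using l comp_simps(2) by (auto simp: list_all2_conv_all_nth intro!: nth_equalityI)
  then show "(f, map2 (Comp M) us (map (\<lambda>g. [g]) gs)) \<in> decomps M (map (Dom M) gs) (Cod M f)"
    using c by (simp add: decomps_def)
  show "(Comp M f us, gs) \<in> decomps M (map (Dom M) gs) (Cod M f)"
    using c comp_simps[OF assms(1)] by (simp add: decomps_def)
  show "Comp M f (map2 (Comp M) us (map (\<lambda>g. [g]) gs)) = Comp M (Comp M f us) gs"
    using comp_assoc[OF assms, unfolded concat_singletons] by simp
qed

text \<open>Hence the restriction in \<open>coend_rel\<close> removes only the reflexive pairs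
  outside \<open>decomps\<close>; no zigzag between decompositions is lost.\<close>

lemma coend_step_decomps: "coend_step M \<Gamma>s B \<subseteq> decomps M \<Gamma>s B \<times> decomps M \<Gamma>s B"
proof
  fix p assume "p \<in> coend_step M \<Gamma>s B"
  then show "p \<in> decomps M \<Gamma>s B \<times> decomps M \<Gamma>s B"
    by (cases p) (metis coend_stepE decomps_concat(1,2) mem_Sigma_iff)
qed

lemma equiv_coend_rel: "equiv (decomps M \<Gamma>s B) (coend_rel M \<Gamma>s B)"
proof (rule equivI)
  let ?R = "coend_step M \<Gamma>s B \<union> (coend_step M \<Gamma>s B)\<inverse>"
  show "coend_rel M \<Gamma>s B \<subseteq> decomps M \<Gamma>s B \<times> decomps M \<Gamma>s B" by (auto simp: coend_rel_def)
  show "refl_on (decomps M \<Gamma>s B) (coend_rel M \<Gamma>s B)" by (auto simp: refl_on_def coend_rel_def)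
  have "sym (?R\<^sup>*)" by (rule sym_rtrancl) (auto simp: sym_def)
  then show "sym (coend_rel M \<Gamma>s B)" by (auto simp: coend_rel_def sym_def)
  show "trans (coend_rel M \<Gamma>s B)" by (auto simp: coend_rel_def trans_def intro: rtrancl_trans)
qed

lemma coend_rel_invariant:
  assumes "(x, y) \<in> coend_rel M \<Gamma>s B"
    and step: "\<And>f us gs. composable M f us \<Longrightarrow> Cod M f = B \<Longrightarrow> set us \<subseteq> ary M 1 \<Longrightarrow>
      list_all2 (composable M) us (map (\<lambda>g. [g]) gs) \<Longrightarrow> map (Dom M) gs = \<Gamma>s \<Longrightarrow>
      (P (f, map2 (Comp M) us (map (\<lambda>g. [g]) gs)) \<longleftrightarrow> P (Comp M f us, gs))"
  shows "P x \<longleftrightarrow> P y"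
proof -
  have st: "P a \<longleftrightarrow> P b" if "(a, b) \<in> coend_step M \<Gamma>s B" for a b
    using that by (rule coend_stepE) (use step in simp)
  have "(x, y) \<in> (coend_step M \<Gamma>s B \<union> (coend_step M \<Gamma>s B)\<inverse>)\<^sup>*"
    using assms(1) by (simp add: coend_rel_def)
  then show ?thesis by (induction rule: rtrancl_induct) (use st in auto)
qed

text \<open>The universal property of the coend: a function descends to classes once it does not
  notice unary arrows moving across. Taking the predicate \<open>\<phi> z = \<phi> y\<close> reduces
  it to the invariance of predicates.\<close>

lemma coend_rel_constant:
  assumes "(x, y) \<in> coend_rel M \<Gamma>s B"
    and step: "\<And>f us gs. composable M f us \<Longrightarrow> Cod M f = B \<Longrightarrow> set us \<subseteq> ary M 1 \<Longrightarrow>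
      list_all2 (composable M) us (map (\<lambda>g. [g]) gs) \<Longrightarrow> map (Dom M) gs = \<Gamma>s \<Longrightarrow>
      \<phi> (f, map2 (Comp M) us (map (\<lambda>g. [g]) gs)) = \<phi> (Comp M f us, gs)"
  shows "\<phi> x = \<phi> y"
  using coend_rel_invariant[of x y \<Gamma>s B "\<lambda>z. \<phi> z = \<phi> y"] assms by auto

lemma coend_rel_Comp:
  assumes "((f, gs), (f', gs')) \<in> coend_rel M \<Gamma>s B"
  shows "Comp M f gs = Comp M f' gs'"
  using coend_rel_constant[OF assms, of "\<lambda>(f, gs). Comp M f gs"] decomps_concat(3) by simp

lemma coend_rel_step:
  assumes "composable M f us" "set us \<subseteq> ary M 1" "list_all2 (composable M) us (map (\<lambda>g. [g]) gs)"
  shows "((f, map2 (Comp M) us (map (\<lambda>g. [g]) gs)), (Comp M f us, gs)) \<in> coend_rel M (map (Dom M)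
    gs) (Cod M f)"
  using coend_stepI[OF assms] coend_step_decomps by (auto simp: coend_rel_def)

text \<open>Composition is constant on classes (\<open>cl\<close>), so bijectivity can be stated on
  representatives. The conditions on objects disappear because they follow from
  \<open>h \<in> Arr M\<close> in the surjectivity part and from the presence of a decomposition in
  the injectivity part.\<close>

lemma promonoidal_iff:
  "promonoidal M \<longleftrightarrow>
     (\<forall>h\<in>Arr M. \<forall>\<Gamma>s. concat \<Gamma>s = Dom M h \<longrightarrow>
        (\<exists>f gs. composable M f gs \<and> map (Dom M) gs = \<Gamma>s \<and> Comp M f gs = h)) \<and>
     (\<forall>\<Gamma>s B f gs f' gs'. (f, gs) \<in> decomps M \<Gamma>s B \<and> (f', gs') \<in> decomps M \<Gamma>s B \<and> Comp M f gs =
       Comp M f' gs' \<longrightarrow>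
        ((f, gs), (f', gs')) \<in> coend_rel M \<Gamma>s B)" (is "_ \<longleftrightarrow> ?S \<and> ?I")
proof -
  let ?c = "\<lambda>X. the_elem ((\<lambda>(f, gs). Comp M f gs) ` X)"
  let ?Q = "\<lambda>\<Gamma>s B. decomps M \<Gamma>s B // coend_rel M \<Gamma>s B"
  have cl: "?c (coend_rel M \<Gamma>s B `` {(f, gs)}) = Comp M f gs" if "(f, gs) \<in> decomps M \<Gamma>s B"
    for \<Gamma>s B f gs
  proof -
    have "(\<lambda>(f, gs). Comp M f gs) ` (coend_rel M \<Gamma>s B `` {(f, gs)}) =
        (\<lambda>_. Comp M f gs) ` (coend_rel M \<Gamma>s B `` {(f, gs)})"
      by (rule image_cong[OF refl]) (auto dest: coend_rel_Comp)
    moreover have "coend_rel M \<Gamma>s B `` {(f, gs)} \<noteq> {}"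
      using equiv_class_self[OF equiv_coend_rel that] by blast
    ultimately have "(\<lambda>(f, gs). Comp M f gs) ` (coend_rel M \<Gamma>s B `` {(f, gs)}) = {Comp M f gs}"
      by (simp add: image_constant_conv)
    then show ?thesis by simp
  qed
  have ob: "(\<forall>\<Gamma>\<in>set \<Gamma>s. set \<Gamma> \<subseteq> Obj M) \<and> B \<in> Obj M" if "(f, gs) \<in> decomps M \<Gamma>s B" for f gs \<Gamma>s B
    using that dom_obj cod_obj by (fastforce simp: decomps_def composable_def)
  have img: "?c ` ?Q \<Gamma>s B = (\<lambda>(f, gs). Comp M f gs) ` decomps M \<Gamma>s B" for \<Gamma>s B
    using cl by (force simp: quotient_def image_iff)
  have sub: "(\<lambda>(f, gs). Comp M f gs) ` decomps M \<Gamma>s B \<subseteq> mhom M (concat \<Gamma>s) B" for \<Gamma>s B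
    using comp_simps by (auto simp: decomps_def mhom_def)
  have eq: "(\<lambda>(f, gs). Comp M f gs) ` decomps M \<Gamma>s B = mhom M (concat \<Gamma>s) B \<longleftrightarrow>
      mhom M (concat \<Gamma>s) B \<subseteq> (\<lambda>(f, gs). Comp M f gs) ` decomps M \<Gamma>s B" for \<Gamma>s B
    using sub[of \<Gamma>s B] by (simp only: set_eq_subset simp_thms)
  have inj: "inj_on ?c (?Q \<Gamma>s B) \<longleftrightarrow> (\<forall>f gs f' gs'. (f, gs) \<in> decomps M \<Gamma>s B \<and>
    (f', gs') \<in> decomps M \<Gamma>s B \<and>
     Comp M f gs = Comp M f' gs' \<longrightarrow> ((f, gs), (f', gs')) \<in> coend_rel M \<Gamma>s B)" for \<Gamma>s B
  proof
    assume i: "inj_on ?c (?Q \<Gamma>s B)"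
    show "\<forall>f gs f' gs'. (f, gs) \<in> decomps M \<Gamma>s B \<and> (f', gs') \<in> decomps M \<Gamma>s B \<and>
     Comp M f gs = Comp M f' gs' \<longrightarrow> ((f, gs), (f', gs')) \<in> coend_rel M \<Gamma>s B"
    proof (intro allI impI, elim conjE)
      fix f gs f' gs'
      assume *: "(f, gs) \<in> decomps M \<Gamma>s B" "(f', gs') \<in> decomps M \<Gamma>s B" "Comp M f gs =
        Comp M f' gs'"
      then have "coend_rel M \<Gamma>s B `` {(f, gs)} = coend_rel M \<Gamma>s B `` {(f', gs')}"
        using inj_onD[OF i] cl quotientI by metis
      then show "((f, gs), (f', gs')) \<in> coend_rel M \<Gamma>s B"
        using eq_equiv_class[OF _ equiv_coend_rel *(2)] by blast
    qed
  next
    assume i: "\<forall>f gs f' gs'. (f, gs) \<in> decomps M \<Gamma>s B \<and> (f', gs') \<in> decomps M \<Gamma>s B \<and>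
     Comp M f gs = Comp M f' gs' \<longrightarrow> ((f, gs), (f', gs')) \<in> coend_rel M \<Gamma>s B"
    show "inj_on ?c (?Q \<Gamma>s B)"
    proof (rule inj_onI)
      fix X Y assume "X \<in> ?Q \<Gamma>s B" "Y \<in> ?Q \<Gamma>s B" and eq: "?c X = ?c Y"
      then obtain f gs f' gs' where *: "(f, gs) \<in> decomps M \<Gamma>s B" "X = coend_rel M \<Gamma>s B `` {(f,
        gs)}"
        "(f', gs') \<in> decomps M \<Gamma>s B" "Y = coend_rel M \<Gamma>s B `` {(f', gs')}"
        by (auto elim!: quotientE)
      then have "((f, gs), (f', gs')) \<in> coend_rel M \<Gamma>s B" using i eq cl by metis
      then show "X = Y" using * equiv_class_eq[OF equiv_coend_rel] by blast
    qed
  qed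
  have "promonoidal M \<longleftrightarrow> (\<forall>\<Gamma>s B. (\<forall>\<Gamma>\<in>set \<Gamma>s. set \<Gamma> \<subseteq> Obj M) \<longrightarrow> B \<in> Obj M \<longrightarrow>
      mhom M (concat \<Gamma>s) B \<subseteq> (\<lambda>(f, gs). Comp M f gs) ` decomps M \<Gamma>s B) \<and>
    (\<forall>\<Gamma>s B. (\<forall>\<Gamma>\<in>set \<Gamma>s. set \<Gamma> \<subseteq> Obj M) \<longrightarrow> B \<in> Obj M \<longrightarrow> inj_on ?c (?Q \<Gamma>s B))"
    unfolding promonoidal_def bij_betw_def img eq by blast
  also have "(\<forall>\<Gamma>s B. (\<forall>\<Gamma>\<in>set \<Gamma>s. set \<Gamma> \<subseteq> Obj M) \<longrightarrow> B \<in> Obj M \<longrightarrow>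
      mhom M (concat \<Gamma>s) B \<subseteq> (\<lambda>(f, gs). Comp M f gs) ` decomps M \<Gamma>s B) \<longleftrightarrow> ?S" (is "?S' \<longleftrightarrow> _")
  proof
    assume S': ?S'
    show ?S
    proof (intro ballI allI impI)
      fix h \<Gamma>s assume h: "h \<in> Arr M" "concat \<Gamma>s = Dom M h"
      then have "\<forall>\<Gamma>\<in>set \<Gamma>s. set \<Gamma> \<subseteq> Obj M" using dom_obj[OF h(1)] by (auto simp flip: h(2))
      moreover have "h \<in> mhom M (concat \<Gamma>s) (Cod M h)" using h by (simp add: mhom_def)
      ultimately have "h \<in> (\<lambda>(f, gs). Comp M f gs) ` decomps M \<Gamma>s (Cod M h)"
        using S' cod_obj[OF h(1)] by blast
      then show "\<exists>f gs. composable M f gs \<and> map (Dom M) gs = \<Gamma>s \<and> Comp M f gs = h"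
        by (auto simp: decomps_def)
    qed
  next
    assume S: ?S
    show ?S'
    proof (intro allI impI subsetI)
      fix \<Gamma>s B h assume h: "h \<in> mhom M (concat \<Gamma>s) B"
      then obtain f gs where *: "composable M f gs" "map (Dom M) gs = \<Gamma>s" "Comp M f gs = h"
        using S by (fastforce simp: mhom_def)
      moreover have "Cod M f = B" using comp_simps(3)[OF *(1)] *(3) h by (simp add: mhom_def)
      ultimately show "h \<in> (\<lambda>(f, gs). Comp M f gs) ` decomps M \<Gamma>s B" by (force simp: decomps_def)
    qed
  qed
  also have "(\<forall>\<Gamma>s B. (\<forall>\<Gamma>\<in>set \<Gamma>s. set \<Gamma> \<subseteq> Obj M) \<longrightarrow> B \<in> Obj M \<longrightarrow> inj_on ?c (?Q \<Gamma>s B)) \<longleftrightarrow> ?I"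
    unfolding inj using ob by blast
  finally show ?thesis .
qed

end

section \<open>Representable, sequential and unary multicategories\<close>

lemma (in multicategory) preuniversal_inj:
  assumes "preuniversal M u" "f \<in> Arr M" "f' \<in> Arr M" "Dom M f = [Cod M u]" "Dom M f' = [Cod M u]"
    "Cod M f = Cod M f'" "Comp M f [u] = Comp M f' [u]"
  shows "f = f'"
proof -
  have "inj_on (\<lambda>f. Comp M f [u]) (mhom M [Cod M u] (Cod M f))"
    using assms(1) cod_obj[OF assms(2)] by (auto simp: preuniversal_def bij_betw_def)
  then show ?thesis by (rule inj_onD) (use assms in \<open>auto simp: mhom_def\<close>)
qed

lemma (in multicategory) preuniversal_factor:
  assumes u: "preuniversal M u" and h: "h \<in> Arr M" "Dom M h = Dom M u"
  obtains k where "k \<in> Arr M" "Dom M k = [Cod M u]" "Cod M k = Cod M h" "Comp M k [u] = h"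
proof -
  have "h \<in> (\<lambda>f. Comp M f [u]) ` mhom M [Cod M u] (Cod M h)"
    using u h cod_obj[OF h(1)] by (auto simp: preuniversal_def bij_betw_def mhom_def)
  then show thesis using that by (auto simp: mhom_def)
qed

text \<open>Let \<open>us\<close> consist of preuniversal arrows on the blocks and let
  \<open>v\<close> be preuniversal on their codomains; closure under composition makes
  \<open>v(us)\<close> preuniversal. Existence: an \<open>h\<close> factors as
  \<open>k(v(us))\<close>, which is \<open>(k v)(us)\<close>. Uniqueness: each class contains a pair
  with second component \<open>us\<close>, and its first component is determined by the
  composite.\<close>

lemma representable_imp_promonoidal:
  assumes M: "multicategory M" and rep: "representable M"
  shows "promonoidal M"
proof -
  interpret multicategory M by fact
  obtain U where U: "\<And>As. set As \<subseteq> Obj M \<Longrightarrow> preuniversal M (U As) \<and> Dom M (U As) = As"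
    using rep unfolding representable_def by metis
  have Uarr: "U As \<in> Arr M" if "set As \<subseteq> Obj M"
    for As using U[OF that] by (simp add: preuniversal_def)
  define us where "us \<Gamma>s = map U \<Gamma>s" for \<Gamma>s
  define v where "v \<Gamma>s = U (map (Cod M) (us \<Gamma>s))" for \<Gamma>s
  have us: "set (us \<Gamma>s) \<subseteq> Arr M" "map (Dom M) (us \<Gamma>s) = \<Gamma>s" "set (map (Cod M) (us \<Gamma>s)) \<subseteq> Obj M"
    if "\<forall>\<Gamma>\<in>set \<Gamma>s. set \<Gamma> \<subseteq> Obj M" for \<Gamma>s
    using that U Uarr cod_obj by (auto simp: us_def intro!: map_idI)
  have v: "preuniversal M (v \<Gamma>s)" "v \<Gamma>s \<in> Arr M" "Dom M (v \<Gamma>s) = map (Cod M) (us \<Gamma>s)"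
    "composable M (v \<Gamma>s) (us \<Gamma>s)" "preuniversal M (Comp M (v \<Gamma>s) (us \<Gamma>s))"
    if "\<forall>\<Gamma>\<in>set \<Gamma>s. set \<Gamma> \<subseteq> Obj M" for \<Gamma>s
  proof -
    show v: "preuniversal M (v \<Gamma>s)" "v \<Gamma>s \<in> Arr M" "Dom M (v \<Gamma>s) = map (Cod M) (us \<Gamma>s)"
      using U Uarr us(3)[OF that] by (auto simp: v_def)
    show c: "composable M (v \<Gamma>s) (us \<Gamma>s)" using v us[OF that] by (simp add: composable_def)
    have "\<forall>w\<in>set (us \<Gamma>s). preuniversal M w" using that U by (auto simp: us_def)
    then show "preuniversal M (Comp M (v \<Gamma>s) (us \<Gamma>s))" using rep v c unfolding representable_def
      by blast
  qed
  have ob: "\<forall>\<Gamma>\<in>set \<Gamma>s. set \<Gamma> \<subseteq> Obj M" if "(f, gs) \<in> decomps M \<Gamma>s B" for f gs \<Gamma>s B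
    using that dom_obj by (fastforce simp: decomps_def composable_def)
  show ?thesis unfolding promonoidal_iff
  proof (intro conjI ballI allI impI)
    fix h \<Gamma>s assume h: "h \<in> Arr M" "concat \<Gamma>s = Dom M h"
    then have \<Gamma>s: "\<forall>\<Gamma>\<in>set \<Gamma>s. set \<Gamma> \<subseteq> Obj M" using dom_obj[OF h(1)] by (auto simp flip: h(2))
    have "Dom M h = Dom M (Comp M (v \<Gamma>s) (us \<Gamma>s))"
      using comp_simps(2)[OF v(4)[OF \<Gamma>s]] us(2)[OF \<Gamma>s] h(2) by simp
    then obtain k where k: "k \<in> Arr M" "Dom M k = [Cod M (v \<Gamma>s)]" "Comp M k [Comp M (v \<Gamma>s) (us \<Gamma>s)]
      = h"
      using preuniversal_factor[OF v(5)[OF \<Gamma>s] h(1)] comp_simps(3)[OF v(4)[OF \<Gamma>s]] by metis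
    have c: "composable M k [v \<Gamma>s]" using k v[OF \<Gamma>s] by (simp add: composable_def)
    have l: "list_all2 (composable M) [v \<Gamma>s] [us \<Gamma>s]" using v(4)[OF \<Gamma>s] by simp
    have "Comp M (Comp M k [v \<Gamma>s]) (us \<Gamma>s) = h" using comp_assoc[OF c l] k by simp
    moreover have "composable M (Comp M k [v \<Gamma>s]) (us \<Gamma>s)" using composable_concat(1)[OF c l]
      by simp
    ultimately show "\<exists>f gs. composable M f gs \<and> map (Dom M) gs = \<Gamma>s \<and> Comp M f gs = h"
      using us(2)[OF \<Gamma>s] by blast
  next
    \<comment> \<open>Each \<open>g_i\<close> is a unary \<open>w_i\<close> after the preuniversal
      arrow on its domain; moving the \<open>w_i\<close> across to \<open>f\<close> leaves
      \<open>us\<close> on the right.\<close>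
    have norm: "\<exists>f'. ((f, gs), (f', us \<Gamma>s)) \<in> coend_rel M \<Gamma>s B" if d: "(f, gs) \<in> decomps M \<Gamma>s B"
      for f gs \<Gamma>s B
    proof -
      note \<Gamma>s = ob[OF d]
      have c: "composable M f gs" and "Cod M f = B" and dom: "map (Dom M) gs = \<Gamma>s"
        using d by (auto simp: decomps_def)
      have len: "length (us \<Gamma>s) = length gs" using dom by (auto simp: us_def)
      have "\<exists>w. w \<in> Arr M \<and> Dom M w = [Cod M (us \<Gamma>s ! i)] \<and> Cod M w = Cod M (gs ! i) \<and>
        Comp M w [us \<Gamma>s ! i] = gs ! i"
        if i: "i < length gs" for i
      proof -
        have "gs ! i \<in> Arr M" using c i by (simp add: composable_nth)
        moreover have "set (Dom M (gs ! i)) \<subseteq> Obj M" using dom_obj calculation by blast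
        moreover have "us \<Gamma>s ! i = U (Dom M (gs ! i))" using i by (auto simp: us_def simp flip: dom)
        ultimately show ?thesis using preuniversal_factor[of "us \<Gamma>s ! i" "gs ! i"] U by metis
      qed
      then obtain w where w: "\<And>i. i < length gs \<Longrightarrow> w i \<in> Arr M \<and> Dom M (w i) = [Cod M (us \<Gamma>s ! i)] \<and>
        Cod M (w i) = Cod M (gs ! i) \<and> Comp M (w i) [us \<Gamma>s ! i] = gs ! i" by metis
      define ws where "ws = map w [0..<length gs]"
      have ws: "composable M f ws" "set ws \<subseteq> ary M 1"
        using w c by (auto simp: ws_def composable_nth ary_def)
      have wl: "list_all2 (composable M) ws (map (\<lambda>g. [g]) (us \<Gamma>s))"
        using w us(1)[OF \<Gamma>s] len by (auto simp: list_all2_conv_all_nth ws_def composable_def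
          subset_iff)
      have "map2 (Comp M) ws (map (\<lambda>g. [g]) (us \<Gamma>s)) = gs"
        using w len by (auto simp: ws_def intro!: nth_equalityI)
      with coend_rel_step[OF ws wl] show ?thesis using us(2)[OF \<Gamma>s] \<open>Cod M f = B\<close> by auto
    qed
    fix \<Gamma>s B f gs f' gs'
    assume *: "(f, gs) \<in> decomps M \<Gamma>s B \<and> (f', gs') \<in> decomps M \<Gamma>s B \<and> Comp M f gs = Comp M f' gs'"
    then have \<Gamma>s: "\<forall>\<Gamma>\<in>set \<Gamma>s. set \<Gamma> \<subseteq> Obj M" using ob by blast
    obtain k k' where k: "((f, gs), (k, us \<Gamma>s)) \<in> coend_rel M \<Gamma>s B" "((f', gs'), (k', us \<Gamma>s)) \<in>
      coend_rel M \<Gamma>s B"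
      using norm * by blast
    then have d: "(k, us \<Gamma>s) \<in> decomps M \<Gamma>s B" "(k', us \<Gamma>s) \<in> decomps M \<Gamma>s B"
      by (auto simp: coend_rel_def)
    then have kc: "composable M k (us \<Gamma>s)" "composable M k' (us \<Gamma>s)" "Cod M k = B" "Cod M k' = B"
      by (auto simp: decomps_def)
    then have kd: "k \<in> Arr M" "k' \<in> Arr M" "Dom M k = Dom M (v \<Gamma>s)" "Dom M k' = Dom M (v \<Gamma>s)"
      using v(3)[OF \<Gamma>s] by (auto simp: composable_def)
    \<comment> \<open>Arrows out of a preuniversal arrow's codomain are separated only by composing
      with it, so \<open>k\<close> and \<open>k'\<close> are themselves factored through
      \<open>v\<close>; their factors are then compared along the preuniversal
      \<open>v(us)\<close>.\<close>
    obtain l where l: "l \<in> Arr M" "Dom M l = [Cod M (v \<Gamma>s)]" "Cod M l = Cod M k" "Comp M l [v \<Gamma>s] =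
      k"
      using preuniversal_factor[OF v(1)[OF \<Gamma>s] kd(1,3)] by blast
    obtain l' where l': "l' \<in> Arr M" "Dom M l' = [Cod M (v \<Gamma>s)]" "Cod M l' = Cod M k'"
      "Comp M l' [v \<Gamma>s] = k'"
      using preuniversal_factor[OF v(1)[OF \<Gamma>s] kd(2,4)] by blast
    have vl: "list_all2 (composable M) [v \<Gamma>s] [us \<Gamma>s]" using v(4)[OF \<Gamma>s] by simp
    have lc: "composable M l [v \<Gamma>s]" "composable M l' [v \<Gamma>s]"
      using l l' v[OF \<Gamma>s] by (simp_all add: composable_def)
    have "Comp M k (us \<Gamma>s) = Comp M k' (us \<Gamma>s)"
      using k * coend_rel_Comp by metis
    then have "Comp M l [Comp M (v \<Gamma>s) (us \<Gamma>s)] = Comp M l' [Comp M (v \<Gamma>s) (us \<Gamma>s)]"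
      using comp_assoc[OF lc(1) vl] comp_assoc[OF lc(2) vl] l(4) l'(4) by simp
    then have "l = l'"
      using preuniversal_inj[OF v(5)[OF \<Gamma>s] l(1) l'(1)] l l' kc comp_simps(3)[OF v(4)[OF \<Gamma>s]]
        by simp
    then have "k = k'" using l(4) l'(4) by simp
    then show "((f, gs), (f', gs')) \<in> coend_rel M \<Gamma>s B"
      using k equiv_coend_rel[of \<Gamma>s B] by (meson equiv_def symE transE)
  qed
qed

section \<open>Sequential multicategories, by way of codiagonals\<close>

text \<open>
  In \<open>seq_mcat C\<close> one takes for \<open>\<delta> n B\<close> the tuple of \<open>n\<close> identities of \<open>B\<close>.
\<close>

lemma promonoidal_of_codiagonals:
  assumes M: "multicategory M"
    and \<delta>: "\<And>B n. B \<in> Obj M \<Longrightarrow> \<delta> n B \<in> Arr M \<and> Dom M (\<delta> n B) = replicate n B \<and> Cod M (\<delta> n B) = B"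
    and surj: "\<And>h \<Gamma>s. h \<in> Arr M \<Longrightarrow> concat \<Gamma>s = Dom M h \<Longrightarrow>
      \<exists>gs. composable M (\<delta> (length \<Gamma>s) (Cod M h)) gs \<and> map (Dom M) gs = \<Gamma>s \<and>
        Comp M (\<delta> (length \<Gamma>s) (Cod M h)) gs = h"
    and inj: "\<And>n B gs gs'. B \<in> Obj M \<Longrightarrow> composable M (\<delta> n B) gs \<Longrightarrow> composable M (\<delta> n B) gs' \<Longrightarrow>
      map (Dom M) gs = map (Dom M) gs' \<Longrightarrow> Comp M (\<delta> n B) gs = Comp M (\<delta> n B) gs' \<Longrightarrow> gs = gs'"
  shows "promonoidal M"
proof -
  interpret multicategory M by fact
  show ?thesis unfolding promonoidal_iff
  proof (intro conjI ballI allI impI)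
    fix h \<Gamma>s assume "h \<in> Arr M" "concat \<Gamma>s = Dom M h"
    then show "\<exists>f gs. composable M f gs \<and> map (Dom M) gs = \<Gamma>s \<and> Comp M f gs = h" using surj by blast
  next
    have norm: "\<exists>gs'. ((f, gs), (\<delta> (length \<Gamma>s) B, gs')) \<in> coend_rel M \<Gamma>s B"
      if d: "(f, gs) \<in> decomps M \<Gamma>s B" for f gs \<Gamma>s B
    proof -
      have c: "composable M f gs" and B: "Cod M f = B" and dom: "map (Dom M) gs = \<Gamma>s"
        using d by (auto simp: decomps_def)
      have f: "f \<in> Arr M" using c by (simp add: composable_def)
      have len: "length \<Gamma>s = length (map (\<lambda>A. [A]) (Dom M f))" "length gs = length (Dom M f)"
        using c dom by (auto simp: composable_nth)
      \<comment> \<open>\<open>surj\<close> is applied to \<open>f\<close> itself with its domain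
        cut into singletons. The factors \<open>us\<close> are then unary, and moving them across
        replaces \<open>(f, gs)\<close> by the codiagonal paired with the arrows
        \<open>u_i g_i\<close>.\<close>
      obtain us where us: "composable M (\<delta> (length \<Gamma>s) B) us" "map (Dom M) us =
        map (\<lambda>A. [A]) (Dom M f)"
        "Comp M (\<delta> (length \<Gamma>s) B) us = f"
        using surj[OF f concat_singletons, folded len(1)] B by auto
      have "length us = length gs" using us(2) len by (metis length_map)
      moreover have "Dom M (us ! i) = [Dom M f ! i]" if "i < length us" for i
        using arg_cong[OF us(2), of "\<lambda>xs. xs ! i"] that calculation len by simp
      ultimately have "set us \<subseteq> ary M 1" "list_all2 (composable M) us (map (\<lambda>g. [g]) gs)"
        using us(1) c by (auto simp: composable_nth list_all2_conv_all_nth ary_def in_set_conv_nth)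
      from coend_rel_step[OF us(1) this] have "((\<delta> (length \<Gamma>s) B, map2 (Comp M) us (map (\<lambda>g. [g])
        gs)), (f, gs)) \<in> coend_rel M \<Gamma>s B"
        using us(3) dom \<delta>[of B "length \<Gamma>s"] cod_obj[OF f] B by simp
      then show ?thesis using equiv_coend_rel[of \<Gamma>s B] by (meson equiv_def symE)
    qed
    fix \<Gamma>s B f gs f' gs'
    assume *: "(f, gs) \<in> decomps M \<Gamma>s B \<and> (f', gs') \<in> decomps M \<Gamma>s B \<and> Comp M f gs = Comp M f' gs'"
    obtain hs hs' where k: "((f, gs), (\<delta> (length \<Gamma>s) B, hs)) \<in> coend_rel M \<Gamma>s B"
      "((f', gs'), (\<delta> (length \<Gamma>s) B, hs')) \<in> coend_rel M \<Gamma>s B"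
      using norm * by blast
    then have d: "(\<delta> (length \<Gamma>s) B, hs) \<in> decomps M \<Gamma>s B" "(\<delta> (length \<Gamma>s) B, hs') \<in> decomps M \<Gamma>s B"
      by (auto simp: coend_rel_def)
    have "B \<in> Obj M" using * cod_obj by (auto simp: decomps_def composable_def)
    moreover have "Comp M (\<delta> (length \<Gamma>s) B) hs = Comp M (\<delta> (length \<Gamma>s) B) hs'"
      using k * coend_rel_Comp by metis
    ultimately have "hs = hs'" using inj d by (auto simp: decomps_def)
    then show "((f, gs), (f', gs')) \<in> coend_rel M \<Gamma>s B"
      using k equiv_coend_rel[of \<Gamma>s B] by (meson equiv_def symE transE)
  qed
qed

lemma concat_eq_iff_lengths:
  "map length xss = map length yss \<Longrightarrow> concat xss = concat yss \<longleftrightarrow> xss = yss"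
proof (induction xss arbitrary: yss)
  case (Cons xs xss)
  then show ?case by (cases yss) auto
qed auto

lemma obtain_split:
  assumes "concat xss = map h ys"
  obtains yss where "concat yss = ys" "map (map h) yss = xss"
  using assms
proof (induction xss arbitrary: ys thesis)
  case Nil
  then show ?case by (metis concat.simps(1) list.map_disc_iff list.simps(8))
next
  case (Cons xs xss)
  from Cons.prems(2) obtain ys1 ys2 where ys: "ys = ys1 @ ys2" "xs = map h ys1" "concat xss =
    map h ys2"
    by (auto simp: append_eq_map_conv)
  from Cons.IH[OF _ ys(3)] obtain yss where "concat yss = ys2" "map (map h) yss = xss" by blast
  then show ?case using Cons.prems(1)[of "ys1 # yss"] ys by simp
qed

text \<open>Composing with a tuple of identities merely concatenates tuples. A decomposition through
  it with prescribed blocks is therefore a way of cutting a tuple at prescribed places, which exists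
  and is unique. The isomorphism carries this from \<open>seq_mcat C\<close> to
  \<open>M\<close>.\<close>

lemma sequential_imp_promonoidal:
  assumes M: "multicategory M" and seq: "sequential M"
  shows "promonoidal M"
proof -
  interpret multicategory M by fact
  obtain C :: "('a, 'b) cat" and Fo Fa Go Ga where C: "category C"
    and F: "is_mfunctor M (seq_mcat C) Fo Fa" and G: "is_mfunctor (seq_mcat C) M Go Ga"
    and GF: "\<And>A. A \<in> Obj M \<Longrightarrow> Go (Fo A) = A" "\<And>f. f \<in> Arr M \<Longrightarrow> Ga (Fa f) = f"
    and FG: "\<And>A. A \<in> Obj (seq_mcat C) \<Longrightarrow> Fo (Go A) = A" "\<And>f. f \<in> Arr (seq_mcat C) \<Longrightarrow> Fa (Ga f) = f"
    using seq unfolding sequential_def mcat_isomorphic_def by blast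
  interpret C: category C by fact
  note FD = mfunctorD[OF F] and GD = mfunctorD[OF G]
  let ?S = "seq_mcat C"
  have Obj_S: "Obj ?S = Ob C" and Cod_S: "Cod ?S = snd" and Dom_S: "Dom ?S (fs, X) = map (Src C) fs"
    and Arr_S: "(fs, X) \<in> Arr ?S \<longleftrightarrow> X \<in> Ob C \<and> set fs \<subseteq> Ar C \<and> (\<forall>f\<in>set fs. Tgt C f = X)" for fs X
    by (auto simp: seq_mcat_def)
  define d where "d n X = (replicate n (Idn C X), X)" for n :: nat and X
  have d: "d n X \<in> Arr ?S" "Dom ?S (d n X) = replicate n X" "Cod ?S (d n X) = X" if "X \<in> Ob C"
    for n X
    using C.idn_hom[OF that] that by (auto simp: d_def Arr_S Dom_S Cod_S hom_def)
  have dC: "Comp ?S (d n X) gs = (concat (map fst gs), X)"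
    if c: "composable ?S (d n X) gs" "X \<in> Ob C" for n X gs
  proof -
    have "map2 (\<lambda>f (hs, _). map (Cmp C f) hs) (replicate n (Idn C X)) gs = map fst gs"
    proof (rule nth_equalityI)
      show len: "length (map2 (\<lambda>f (hs, _). map (Cmp C f) hs) (replicate n (Idn C X)) gs) =
        length (map fst gs)"
        using c d(2)[OF c(2)] by (simp add: composable_nth)
      fix i assume "i < length (map2 (\<lambda>f (hs, _). map (Cmp C f) hs) (replicate n (Idn C X)) gs)"
      then have i: "i < n" "i < length gs" by auto
      obtain hs Y where hs: "gs ! i = (hs, Y)" by force
      have "(hs, Y) \<in> Arr ?S" "Y = X" using c i d(2)[OF c(2)] hs
        by (auto simp: composable_nth Cod_S)
      then have "map (Cmp C (Idn C X)) hs = hs"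
        using C.idn_left by (force simp: Arr_S hom_def intro!: map_idI)
      then show "map2 (\<lambda>f (hs, _). map (Cmp C f) hs) (replicate n (Idn C X)) gs ! i =
        map fst gs ! i"
        using i hs by simp
    qed
    then show ?thesis by (simp add: seq_mcat_def d_def)
  qed
  have FoOb: "Fo A \<in> Ob C" if "A \<in> Obj M" for A using FD(1)[OF that] Obj_S by simp
  have GD': "composable M (Ga f) (map Ga gs)" "Ga (Comp ?S f gs) = Comp M (Ga f) (map Ga gs)"
    if "composable ?S f gs" for f gs
    using mfunctor_composable[OF G that] GD(6)[OF that] .
  show ?thesis
  proof (rule promonoidal_of_codiagonals[OF M, where \<delta> = "\<lambda>n B. Ga (d n (Fo B))"])
    show "Ga (d n (Fo B)) \<in> Arr M \<and> Dom M (Ga (d n (Fo B))) = replicate n B \<and>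
      Cod M (Ga (d n (Fo B))) = B"
      if "B \<in> Obj M" for B n
      using d[OF FoOb[OF that]] GD(2-4) GF(1)[OF that] by simp
    fix h \<Gamma>s assume h: "h \<in> Arr M" and \<Gamma>s: "concat \<Gamma>s = Dom M h"
    let ?X = "Fo (Cod M h)"
    have X: "?X \<in> Ob C" using FoOb[OF cod_obj[OF h]] .
    obtain fs where fs: "Fa h = (fs, ?X)" using FD(4)[OF h] Cod_S by (metis prod.collapse)
    have fsA: "(fs, ?X) \<in> Arr ?S" using FD(2)[OF h] fs by simp
    have "concat (map (map Fo) \<Gamma>s) = map (Src C) fs"
      using FD(3)[OF h] fs Dom_S \<Gamma>s by (simp flip: map_concat)
    \<comment> \<open>The tuple is cut where \<open>\<Gamma>s\<close> cuts its list of
      sources.\<close>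
    then obtain fss where fss: "concat fss = fs" "map (map (Src C)) fss = map (map Fo) \<Gamma>s"
      by (rule obtain_split)
    define gs where "gs = map (\<lambda>fs. (fs, ?X)) fss"
    have gsA: "set gs \<subseteq> Arr ?S" using fsA by (fastforce simp: gs_def Arr_S simp flip: fss(1))
    have len: "length fss = length \<Gamma>s" using fss(2) by (metis length_map)
    have c: "composable ?S (d (length \<Gamma>s) ?X) gs"
      using d[OF X] gsA len by (auto simp: composable_nth gs_def Cod_S)
    have "Comp ?S (d (length \<Gamma>s) ?X) gs = Fa h"
      using dC[OF c X] fs fss by (simp add: gs_def comp_def)
    then have C1: "Comp M (Ga (d (length \<Gamma>s) ?X)) (map Ga gs) = h" using GD'(2)[OF c] GF(2)[OF h]
      by simp
    have "map (Dom M) (map Ga gs) = map (map Go) (map (Dom ?S) gs)" using gsA GD(3) by auto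
    also have "map (Dom ?S) gs = map (map Fo) \<Gamma>s" using fss(2) by (simp add: gs_def Dom_S comp_def)
    also have "map (map Go) \<dots> = \<Gamma>s"
    proof -
      have "Go (Fo A) = A" if "\<Gamma> \<in> set \<Gamma>s" "A \<in> set \<Gamma>" for \<Gamma> A
      proof (rule GF(1))
        have "A \<in> set (Dom M h)" using that by (auto simp flip: \<Gamma>s)
        then show "A \<in> Obj M" using dom_obj[OF h] by blast
      qed
      then show ?thesis by (auto intro!: map_idI)
    qed
    finally show "\<exists>gs. composable M (Ga (d (length \<Gamma>s) ?X)) gs \<and> map (Dom M) gs = \<Gamma>s \<and>
      Comp M (Ga (d (length \<Gamma>s) ?X)) gs = h"
      using GD'(1)[OF c] C1 by blast
  next
    fix n B gs gs'
    assume B: "B \<in> Obj M" and c: "composable M (Ga (d n (Fo B))) gs" "composable M (Ga (d n (Fo B)))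
      gs'"
      and dom: "map (Dom M) gs = map (Dom M) gs'"
        and eq: "Comp M (Ga (d n (Fo B))) gs = Comp M (Ga (d n (Fo B))) gs'"
    have dA: "Fa (Ga (d n (Fo B))) = d n (Fo B)" using FG(2) d(1)[OF FoOb[OF B]] by blast
    have fst_eq: "map fst (map Fa gs) = map fst (map Fa gs')"
    proof (rule concat_eq_iff_lengths[THEN iffD1])
      have *: "map length (map fst (map Fa gs)) = map length (map (Dom M) gs)"
        if "composable M (Ga (d n (Fo B))) gs" for gs
      proof -
        have "length (fst (Fa g)) = length (Dom M g)" if "g \<in> Arr M" for g
          using FD(3)[OF that] Dom_S by (metis length_map prod.collapse)
        then show ?thesis using that by (auto simp: composable_def)
      qed
      show "map length (map fst (map Fa gs)) = map length (map fst (map Fa gs'))"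
        unfolding *[OF c(1)] *[OF c(2)] dom ..
      have "Comp ?S (d n (Fo B)) (map Fa gs) = Comp ?S (d n (Fo B)) (map Fa gs')"
        using FD(6)[OF c(1)] FD(6)[OF c(2)] eq dA by simp
      then show "concat (map fst (map Fa gs)) = concat (map fst (map Fa gs'))"
        using dC[OF mfunctor_composable[OF F c(1), unfolded dA] FoOb[OF B]]
          dC[OF mfunctor_composable[OF F c(2), unfolded dA] FoOb[OF B]] by simp
    qed
    \<comment> \<open>Equality of the underlying tuples is not enough, since there is an empty tuple
      over every object. The codomains agree because both lists are composable with the same
      arrow.\<close>
    show "gs = gs'"
    proof (rule nth_equalityI)
      show len: "length gs = length gs'" using dom by (metis length_map)
      fix i assume i: "i < length gs"
      have "gs ! i \<in> Arr M" "gs' ! i \<in> Arr M" "Cod M (gs ! i) = Cod M (gs' ! i)"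
        using c i len by (auto simp: composable_nth)
      moreover have "fst (Fa (gs ! i)) = fst (Fa (gs' ! i))"
        using arg_cong[OF fst_eq, of "\<lambda>xs. xs ! i"] i len by simp
      ultimately have "Fa (gs ! i) = Fa (gs' ! i)" using FD(4) Cod_S by (metis prod_eq_iff)
      then show "gs ! i = gs' ! i" using GF(2) \<open>gs ! i \<in> Arr M\<close> \<open>gs' ! i \<in> Arr M\<close> by metis
    qed
  qed
qed

section \<open>Unary multicategories\<close>

lemma small_unary_mcat:
  assumes U: "universe TYPE('u)" and C: "small_category (C :: ('u, 'u) cat)"
  shows "small_multicategory (unary_mcat C)"
proof -
  interpret category C using C by (simp add: small_category_def)
  have "multicategory (unary_mcat C)"
  proof
    fix f gs assume "composable (unary_mcat C) f gs"
    then have "f \<in> Ar C" "length gs = 1" "hd gs \<in> Ar C" "Tgt C (hd gs) = Src C f" "gs = [hd gs]"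
      by (cases gs; auto simp: composable_def unary_mcat_def)+
    then have *: "f \<in> hom C (Src C f) (Tgt C f)" "hd gs \<in> hom C (Src C (hd gs)) (Src C f)" "gs =
      [hd gs]"
      by (auto simp: hom_def)
    have "concat (map (\<lambda>f. [Src C f]) gs) = [Src C (hd gs)]" by (subst *(3)) simp
    then show "Comp (unary_mcat C) f gs \<in> mhom (unary_mcat C) (concat (map (Dom (unary_mcat C)) gs))
      (Cod (unary_mcat C) f)"
      using cmp_hom[OF *(1,2)] by (auto simp: unary_mcat_def mhom_def hom_def)
  next
    fix f gs hss assume c: "composable (unary_mcat C) f gs"
      and l: "list_all2 (composable (unary_mcat C)) gs hss"
    from c obtain g where g: "gs = [g]" "f \<in> Ar C" "g \<in> Ar C" "Tgt C g = Src C f"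
      by (auto simp: composable_def unary_mcat_def)
    with l obtain h where h: "hss = [[h]]" "h \<in> Ar C" "Tgt C h = Src C g"
      by (auto simp: composable_def unary_mcat_def list_all2_Cons1)
    show "Comp (unary_mcat C) (Comp (unary_mcat C) f gs) (concat hss) = Comp (unary_mcat C) f (map2
      (Comp (unary_mcat C)) gs hss)"
      using cmp_assoc[of f "Src C f" "Tgt C f" g "Src C g" h "Src C h"] g h
        by (simp add: unary_mcat_def hom_def)
  qed (use src_ob tgt_ob idn_hom idn_left idn_right in \<open>auto simp: unary_mcat_def mhom_def hom_def\<close>)
  moreover have "small (mhom (unary_mcat C) As B)" if "set As \<subseteq> Ob C" "B \<in> Ob C" for As B
  proof -
    have *: "mhom (unary_mcat C) As B \<subseteq> hom C (hd As) B"
      by (auto simp: mhom_def unary_mcat_def hom_def)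
    show ?thesis
    proof (cases "As = []")
      case True
      then have "mhom (unary_mcat C) As B = {}" by (auto simp: mhom_def unary_mcat_def)
      then show ?thesis using esmall_finite[OF U, of "{} :: 'u set"] by (simp add: esmall_small)
    next
      case False
      then have "hd As \<in> Ob C" using that by auto
      then have "small (hom C (hd As) B)" using C that by (simp add: small_category_def)
      then show ?thesis using esmall_subset[OF _ *, where 'u = 'u] by (simp add: esmall_small)
    qed
  qed
  ultimately show ?thesis using C by (simp add: small_multicategory_def small_category_def
    unary_mcat_def)
qed

text \<open>The blocks \<open>[]\<close> and \<open>[X]\<close> concatenate to the domain of the
  identity of \<open>X\<close>, but a decomposition with these blocks would contain a nullary
  arrow.\<close>

lemma not_promonoidal_unary_mcat:
  assumes U: "universe TYPE('u)" and C: "small_category (C :: ('u, 'u) cat)" and X: "X \<in> Ob C"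
  shows "\<not> promonoidal (unary_mcat C)"
proof
  interpret multicategory "unary_mcat C" using small_unary_mcat[OF U C]
    by (simp add: small_multicategory_def)
  interpret C: category C using C by (simp add: small_category_def)
  assume "promonoidal (unary_mcat C)"
  note surj = this[unfolded promonoidal_iff, THEN conjunct1, rule_format]
  have "Idn C X \<in> Arr (unary_mcat C)" "concat [[], [X]] = Dom (unary_mcat C) (Idn C X)"
    using C.idn_hom[OF X] by (auto simp: unary_mcat_def hom_def)
  from surj[OF this] obtain f gs where "composable (unary_mcat C) f gs" "map (Dom (unary_mcat C)) gs
    = [[], [X]]"
    by (elim exE conjE) (rule that)
  then show False by (auto simp: unary_mcat_def)
qed

section \<open>The exponential of a promonoidal multicategory\<close>

text \<open>An object of the exponential will be a pair of an object map and a map of unary arrows;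
  an arrow will be a triple of domain, codomain and family. The projections are named after the
  evaluation that they perform.\<close>

abbreviation ev_obj :: "'o \<Rightarrow> ('o \<Rightarrow> 'p) \<times> 'f \<Rightarrow> 'p" where
  "ev_obj A F \<equiv> fst F A"

abbreviation ev_un :: "'a \<Rightarrow> 'e \<times> ('a \<Rightarrow> 'b) \<Rightarrow> 'b" where
  "ev_un u F \<equiv> snd F u"

abbreviation ev_arr :: "'a \<Rightarrow> 'e \<times> 'f \<times> ('a \<Rightarrow> 'b) \<Rightarrow> 'b" where
  "ev_arr f \<alpha> \<equiv> snd (snd \<alpha>) f"

text \<open>
  Functors \<open>M\<^sub>- \<rightarrow> N\<^sub>-\<close>; they are extensional, so that a functor is determined by its action.
\<close>

definition expo_obj :: "('o, 'a) mcat \<Rightarrow> ('p, 'b) mcat \<Rightarrow> (('o \<Rightarrow> 'p) \<times> ('a \<Rightarrow> 'b)) set" where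
  "expo_obj M N = {F. fst F \<in> Obj M \<rightarrow>\<^sub>E Obj N \<and> snd F \<in> extensional (ary M 1) \<and>
     (\<forall>u\<in>ary M 1. ev_un u F \<in> mhom N (map (fst F) (Dom M u)) (ev_obj (Cod M u) F)) \<and>
     (\<forall>A\<in>Obj M. ev_un (Ident M A) F = Ident N (ev_obj A F)) \<and>
     (\<forall>u\<in>ary M 1. \<forall>v\<in>ary M 1. composable M u [v] \<longrightarrow>
        ev_un (Comp M u [v]) F = Comp N (ev_un u F) [ev_un v F])}"

text \<open>The family does not determine its domain and codomain, so these are stored with it. The
  last two conditions are naturality under unary arrows, first in all inputs simultaneously, then at
  the output; the functors in \<open>Fs\<close> and \<open>G\<close> act on the other side.\<close>

definition expo_arr :: "('o, 'a) mcat \<Rightarrow> ('p, 'b) mcat \<Rightarrow>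
    ((('o \<Rightarrow> 'p) \<times> ('a \<Rightarrow> 'b)) list \<times> (('o \<Rightarrow> 'p) \<times> ('a \<Rightarrow> 'b)) \<times> ('a \<Rightarrow> 'b)) set" where
  "expo_arr M N = {(Fs, G, \<alpha>). set Fs \<subseteq> expo_obj M N \<and> G \<in> expo_obj M N \<and>
    \<alpha> \<in> extensional (ary M (length Fs)) \<and>
     (\<forall>f\<in>ary M (length Fs). \<alpha> f \<in> mhom N (map2 ev_obj (Dom M f) Fs) (ev_obj (Cod M f) G)) \<and>
     (\<forall>f us. f \<in> ary M (length Fs) \<and> composable M f us \<and> set us \<subseteq> ary M 1 \<longrightarrow>
        \<alpha> (Comp M f us) = Comp N (\<alpha> f) (map2 ev_un us Fs)) \<and>
     (\<forall>v f. v \<in> ary M 1 \<and> f \<in> ary M (length Fs) \<and> composable M v [f] \<longrightarrow>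
        \<alpha> (Comp M v [f]) = Comp N (ev_un v G) [\<alpha> f])}"

text \<open>The identity of \<open>F\<close> is the action of \<open>F\<close> on unary arrows. In a
  composite, \<open>SOME\<close> picks any decomposition of \<open>h\<close> with the arities
  dictated by \<open>\<beta>s\<close>; arities suffice, as they determine how \<open>Dom M h\<close>
  is cut into blocks. Independence of the choice is \<open>ev_Comp\<close>.\<close>

definition expo :: "('o, 'a) mcat \<Rightarrow> ('p, 'b) mcat \<Rightarrow>
    (('o \<Rightarrow> 'p) \<times> ('a \<Rightarrow> 'b),
     (('o \<Rightarrow> 'p) \<times> ('a \<Rightarrow> 'b)) list \<times> (('o \<Rightarrow> 'p) \<times> ('a \<Rightarrow> 'b)) \<times> ('a \<Rightarrow> 'b)) mcat" where
  "expo M N =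
     \<lparr>Obj = expo_obj M N, Arr = expo_arr M N, Dom = fst, Cod = fst \<circ> snd,
      Ident = (\<lambda>F. ([F], F, snd F)),
      Comp = (\<lambda>\<alpha> \<beta>s. (concat (map fst \<beta>s), fst (snd \<alpha>),
        \<lambda>h\<in>ary M (length (concat (map fst \<beta>s))).
          case SOME (f, gs). composable M f gs \<and> map (length \<circ> Dom M) gs = map (length \<circ> fst) \<beta>s \<and>
            Comp M f gs = h
          of (f, gs) \<Rightarrow> Comp N (ev_arr f \<alpha>) (map2 ev_arr gs \<beta>s)))\<rparr>"

text \<open>Lists over \<open>unit\<close> carry no information but their length, which makes this
  an instance of \<open>obtain_split\<close>.\<close>

lemma obtain_split_length:
  assumes "length (concat xss) = length ys"
  obtains yss where "concat yss = ys" "map length yss = map length xss"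
proof -
  have "concat (map (map (\<lambda>_. ())) xss) = map (\<lambda>_. ()) ys"
    using assms by (simp add: list_eq_iff_nth_eq flip: map_concat)
  then obtain yss where "concat yss = ys" "map (map (\<lambda>_. ())) yss = map (map (\<lambda>_. ())) xss"
    by (rule obtain_split)
  moreover from arg_cong[OF this(2), of "map length"] have "map length yss = map length xss"
    by (simp add: comp_def)
  ultimately show thesis using that by blast
qed

lemma map2_concat:
  "list_all2 (\<lambda>xs ys. length xs = length ys) xss yss \<Longrightarrow>
    map2 f (concat xss) (concat yss) = concat (map2 (map2 f) xss yss)"
  by (induction rule: list_all2_induct) auto

context multicategory
begin

lemma composable_split:
  assumes c: "composable M f gs" and h: "composable M (Comp M f gs) hs"
  obtains hss where "concat hss = hs" "list_all2 (composable M) gs hss"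
proof -
  have "concat (map (Dom M) gs) = map (Cod M) hs"
    using h comp_simps[OF c] by (simp add: composable_def)
  then obtain hss where hss: "concat hss = hs" "map (map (Cod M)) hss = map (Dom M) gs"
    by (rule obtain_split)
  have "list_all2 (composable M) gs hss"
    unfolding list_all2_conv_all_nth
  proof (intro conjI allI impI)
    show len: "length gs = length hss" using hss(2) by (metis length_map)
    fix i assume i: "i < length gs"
    have "map (Cod M) (hss ! i) = Dom M (gs ! i)" using arg_cong[OF hss(2), of "\<lambda>xs. xs ! i"] i len
      by simp
    moreover have "set (hss ! i) \<subseteq> set hs" using nth_mem[of i hss] i len unfolding hss(1)[symmetric]
      by (simp del: nth_mem) blast
    ultimately show "composable M (gs ! i) (hss ! i)" using h c i by (auto simp: composable_def)
  qed
  with hss(1) show thesis by (rule that)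
qed

end

section \<open>Evaluation and composition in the exponential\<close>

locale promonoidal_pair = M: multicategory M + N: multicategory N
  for M :: "('o, 'a) mcat" and N :: "('p, 'b) mcat" +
  assumes promonoidal: "promonoidal M"
begin

abbreviation "E \<equiv> expo M N"

lemma expo_simps: "Obj E = expo_obj M N" "Arr E = expo_arr M N" "Dom E = fst" "Cod E = fst \<circ> snd"
  "Ident E F = ([F], F, snd F)"
  by (simp_all add: expo_def)

lemma arity_conv: "map (length \<circ> Dom M) gs = map (length \<circ> fst) \<beta>s \<longleftrightarrow>
    same_arity M E gs \<beta>s"
  by (auto simp: expo_simps list_all2_conv_all_nth list_eq_iff_nth_eq)

text \<open>This is the surjectivity half of promonoidality. Only the arities of
  \<open>\<beta>s\<close> are given, so the blocks of objects are cut from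
  \<open>Dom M h\<close>.\<close>

lemma decompose:
  assumes h: "h \<in> Arr M" and len: "length (Dom M h) = length (concat (map (Dom E) \<beta>s))"
  obtains f gs where "composable M f gs" "same_arity M E gs \<beta>s" "Comp M f gs = h"
proof -
  obtain \<Gamma>s where \<Gamma>s: "concat \<Gamma>s = Dom M h" "map length \<Gamma>s = map length (map (Dom E) \<beta>s)"
    using obtain_split_length[OF len[symmetric]] by blast
  obtain f gs where fgs: "composable M f gs" "map (Dom M) gs = \<Gamma>s" "Comp M f gs = h"
    using promonoidal h \<Gamma>s(1) unfolding M.promonoidal_iff by blast
  have "map (length \<circ> Dom M) gs = map (length \<circ> fst) \<beta>s"
    using \<Gamma>s(2) by (simp add: expo_simps flip: fgs(2))
  then show thesis using that[OF fgs(1) _ fgs(3)] arity_conv by blast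
qed

lemma decompose_ary:
  assumes "h \<in> ary M (length (concat (map (Dom E) \<beta>s)))"
  obtains f gs where "composable M f gs" "Comp M f gs = h" "same_arity M E gs \<beta>s"
proof (rule decompose[of h \<beta>s])
  show "h \<in> Arr M" "length (Dom M h) = length (concat (map (Dom E) \<beta>s))"
    using assms by (auto simp: ary_def)
  fix f gs assume "composable M f gs" "same_arity M E gs \<beta>s" "Comp M f gs = h"
  then show thesis using that by blast
qed

lemma objD:
  assumes "F \<in> Obj E"
  shows "A \<in> Obj M \<Longrightarrow> ev_obj A F \<in> Obj N"
    and "u \<in> ary M 1 \<Longrightarrow> ev_un u F \<in> Arr N"
    and "u \<in> ary M 1 \<Longrightarrow> Dom N (ev_un u F) = map (fst F) (Dom M u)"
    and "u \<in> ary M 1 \<Longrightarrow> Cod N (ev_un u F) = ev_obj (Cod M u) F"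
    and "A \<in> Obj M \<Longrightarrow> ev_un (Ident M A) F = Ident N (ev_obj A F)"
    and "u \<in> ary M 1 \<Longrightarrow> v \<in> ary M 1 \<Longrightarrow> composable M u [v] \<Longrightarrow> ev_un (Comp M u [v]) F =
      Comp N (ev_un u F) [ev_un v F]"
  using assms by (auto simp: expo_simps expo_obj_def mhom_def)

lemma arrD:
  assumes "\<alpha> \<in> Arr E"
  shows "set (Dom E \<alpha>) \<subseteq> Obj E" "Cod E \<alpha> \<in> Obj E"
    and "f \<in> Arr M \<Longrightarrow> length (Dom M f) = length (Dom E \<alpha>) \<Longrightarrow> ev_arr f \<alpha> \<in> Arr N"
    and "f \<in> Arr M \<Longrightarrow> length (Dom M f) = length (Dom E \<alpha>) \<Longrightarrow> Dom N (ev_arr f \<alpha>) =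
      map2 ev_obj (Dom M f) (Dom E \<alpha>)"
    and "f \<in> Arr M \<Longrightarrow> length (Dom M f) = length (Dom E \<alpha>) \<Longrightarrow> Cod N (ev_arr f \<alpha>) =
      ev_obj (Cod M f) (Cod E \<alpha>)"
    and "length (Dom M f) = length (Dom E \<alpha>) \<Longrightarrow> composable M f us \<Longrightarrow> set us \<subseteq> ary M 1 \<Longrightarrow>
      ev_arr (Comp M f us) \<alpha> = Comp N (ev_arr f \<alpha>) (map2 ev_un us (Dom E \<alpha>))"
    and "v \<in> ary M 1 \<Longrightarrow> length (Dom M f) = length (Dom E \<alpha>) \<Longrightarrow> composable M v [f] \<Longrightarrow>
      ev_arr (Comp M v [f]) \<alpha> = Comp N (ev_un v (Cod E \<alpha>)) [ev_arr f \<alpha>]"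
  using assms by (auto simp: expo_simps expo_arr_def mhom_def ary_def composable_def)

lemma arr_eqI:
  assumes "\<alpha> \<in> Arr E" "\<beta> \<in> Arr E" "Dom E \<alpha> = Dom E \<beta>" "Cod E \<alpha> = Cod E \<beta>"
    and "\<And>f. f \<in> Arr M \<Longrightarrow> length (Dom M f) = length (Dom E \<beta>) \<Longrightarrow> ev_arr f \<alpha> = ev_arr f \<beta>"
  shows "\<alpha> = \<beta>"
proof -
  have "snd (snd \<alpha>) = snd (snd \<beta>)"
    by (rule extensionalityI[of _ "ary M (length (Dom E \<beta>))"])
      (use assms in \<open>auto simp: expo_simps expo_arr_def ary_def\<close>)
  then show ?thesis using assms(3,4) by (simp add: expo_simps prod_eq_iff)
qed

lemma composable_ev:
  assumes a: "composable E \<alpha> \<beta>s" and f: "composable M f gs"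
    and l: "same_arity M E gs \<beta>s"
  shows "composable N (ev_arr f \<alpha>) (map2 ev_arr gs \<beta>s)"
proof -
  have "length (Dom M f) = length (Dom E \<alpha>)"
    using a f list_all2_lengthD[OF l] by (simp add: composable_nth)
  then show ?thesis
    using a f l arrD(3-5) by (auto simp: composable_nth list_all2_conv_all_nth)
qed

lemma composable_ev_un:
  assumes a: "\<alpha> \<in> Arr E" and f: "composable M f us" and len: "length (Dom M f) = length (Dom E \<alpha>)"
    and us: "set us \<subseteq> ary M 1"
  shows "composable N (ev_arr f \<alpha>) (map2 ev_un us (Dom E \<alpha>))"
proof -
  have "us ! i \<in> ary M 1" "Dom E \<alpha> ! i \<in> Obj E" if "i < length us" for i
    using us that subsetD[OF arrD(1)[OF a] nth_mem] subsetD[OF us nth_mem] f len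
      by (simp_all add: composable_nth)
  then show ?thesis
    using f len arrD(3-5)[OF a] objD(2,4) by (auto simp: composable_nth)
qed

text \<open>The heart of this direction, where the injectivity half of promonoidality is used. The
  decomposition picked by \<open>SOME\<close> and the given one lie in the same coend class, so it
  suffices that the right-hand side is unchanged by a generating step. On one side of the step,
  naturality of the \<open>\<beta>s\<close> at the output brings out the unary arrows; on the other,
  naturality of \<alpha> in its inputs does; associativity in \<open>N\<close> matches the
  results.\<close>

lemma ev_Comp:
  assumes a: "composable E \<alpha> \<beta>s" and f: "composable M f gs"
    and l: "same_arity M E gs \<beta>s"
  shows "ev_arr (Comp M f gs) (Comp E \<alpha> \<beta>s) = Comp N (ev_arr f \<alpha>) (map2 ev_arr gs \<beta>s)"
proof -
  let ?P = "\<lambda>f' gs'. composable M f' gs' \<and> map (length \<circ> Dom M) gs' = map (length \<circ> fst) \<beta>s \<and>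
    Comp M f' gs' = Comp M f gs"
  obtain f' gs' where *: "(SOME (f', gs'). ?P f' gs') = (f', gs')" by fastforce
  have "\<exists>p. case p of (f', gs') \<Rightarrow> ?P f' gs'" using f l by (auto simp: arity_conv)
  from someI_ex[OF this] have P: "?P f' gs'" unfolding * by simp
  have fgs: "Comp M f gs \<in> ary M (length (concat (map fst \<beta>s)))"
  proof -
    have "length (concat (map (Dom M) gs)) = length (concat (map (Dom E) \<beta>s))"
      using l by (induction rule: list_all2_induct) auto
    then show ?thesis using M.comp_simps[OF f] by (simp add: ary_def expo_simps)
  qed
  \<comment> \<open>Both lists cut the domain of one and the same arrow into blocks of the same
    lengths.\<close>
  have "map (Dom M) gs' = map (Dom M) gs"
  proof (rule concat_eq_iff_lengths[THEN iffD1])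
    show "map length (map (Dom M) gs') = map length (map (Dom M) gs)"
      using P l by (simp flip: arity_conv)
    show "concat (map (Dom M) gs') = concat (map (Dom M) gs)"
      using M.comp_simps(2) P f by metis
  qed
  moreover have "Cod M f' = Cod M f" using M.comp_simps(3) P f by metis
  ultimately have "(f', gs') \<in> decomps M (map (Dom M) gs) (Cod M f)" "(f, gs) \<in> decomps M (map (Dom
    M) gs) (Cod M f)"
    using P f by (auto simp: decomps_def)
  then have rel: "((f', gs'), (f, gs)) \<in> coend_rel M (map (Dom M) gs) (Cod M f)"
    using promonoidal P unfolding M.promonoidal_iff by blast
  let ?\<phi> = "\<lambda>(f, gs). Comp N (ev_arr f \<alpha>) (map2 ev_arr gs \<beta>s)"
  have "?\<phi> (f', gs') = ?\<phi> (f, gs)"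
  proof (rule M.coend_rel_constant[OF rel])
    fix k us ls
    assume k: "composable M k us" "set us \<subseteq> ary M 1" "list_all2 (composable M) us (map (\<lambda>g. [g])
      ls)"
      and dom: "map (Dom M) ls = map (Dom M) gs"
    have ll: "same_arity M E ls \<beta>s"
    proof -
      have "map (length \<circ> Dom M) ls = map (length \<circ> Dom M) gs"
        using arg_cong[OF dom, of "map length"] by simp
      then show ?thesis using l by (simp flip: arity_conv)
    qed
    have len: "length us = length \<beta>s" "length ls = length \<beta>s" "length (Dom M k) = length (Dom E \<alpha>)"
      "length (Dom E \<alpha>) = length \<beta>s"
      using list_all2_lengthD[OF ll] list_all2_lengthD[OF k(3)] k(1) a
        by (auto simp: composable_nth)
    have \<alpha>: "\<alpha> \<in> Arr E" using a by (simp add: composable_def)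
    have nth: "us ! i \<in> ary M 1" "ls ! i \<in> Arr M" "Cod E (\<beta>s ! i) = Dom E \<alpha> ! i" "\<beta>s ! i \<in> Arr E"
      "length (Dom M (ls ! i)) = length (Dom E (\<beta>s ! i))" "composable M (us ! i) [ls ! i]"
        if i: "i < length \<beta>s" for i
    proof -
      show "us ! i \<in> ary M 1" using subsetD[OF k(2) nth_mem] i len by simp
      show "Cod E (\<beta>s ! i) = Dom E \<alpha> ! i" "\<beta>s ! i \<in> Arr E"
        using a i by (simp_all add: composable_nth)
      show "length (Dom M (ls ! i)) = length (Dom E (\<beta>s ! i))"
        using ll i len by (simp add: list_all2_conv_all_nth)
      show c: "composable M (us ! i) [ls ! i]"
        using k(3) i len by (simp add: list_all2_conv_all_nth)
      then show "ls ! i \<in> Arr M" by (simp add: composable_def)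
    qed
    have e: "map2 ev_arr (map2 (Comp M) us (map (\<lambda>g. [g]) ls)) \<beta>s =
        map2 (Comp N) (map2 ev_un us (Dom E \<alpha>)) (map (\<lambda>x. [x]) (map2 ev_arr ls \<beta>s))"
    proof (rule nth_equalityI)
      fix i assume "i < length (map2 ev_arr (map2 (Comp M) us (map (\<lambda>g. [g]) ls)) \<beta>s)"
      then have i: "i < length \<beta>s" using len by simp
      show "map2 ev_arr (map2 (Comp M) us (map (\<lambda>g. [g]) ls)) \<beta>s ! i =
        map2 (Comp N) (map2 ev_un us (Dom E \<alpha>)) (map (\<lambda>x. [x]) (map2 ev_arr ls \<beta>s)) ! i"
        using i len nth[OF i] arrD(7)[OF nth(4)[OF i] nth(1)[OF i] nth(5)[OF i] nth(6)[OF i]]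
          by simp
    qed (use len in simp)
    have c1: "composable N (ev_arr k \<alpha>) (map2 ev_un us (Dom E \<alpha>))"
      by (rule composable_ev_un[OF \<alpha> k(1) len(3) k(2)])
    have c2: "list_all2 (composable N) (map2 ev_un us (Dom E \<alpha>)) (map (\<lambda>x. [x]) (map2 ev_arr ls
      \<beta>s))"
      unfolding list_all2_conv_all_nth
    proof (intro conjI allI impI)
      fix i assume "i < length (map2 ev_un us (Dom E \<alpha>))"
      then have i: "i < length \<beta>s" using len by simp
      have "Dom E \<alpha> ! i \<in> Obj E" using arrD(1)[OF \<alpha>] i len by auto
      moreover have "Dom M (us ! i) = [Cod M (ls ! i)]"
        using nth(6)[OF i] by (simp add: composable_def)
      ultimately have "composable N (ev_un (us ! i) (Dom E \<alpha> ! i)) [ev_arr (ls ! i) (\<beta>s ! i)]"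
        using nth[OF i] objD(2,3) arrD(3,5)[OF nth(4)[OF i] nth(2)[OF i] nth(5)[OF i]]
          by (auto simp: composable_def)
      then show "composable N (map2 ev_un us (Dom E \<alpha>) ! i) (map (\<lambda>x. [x]) (map2 ev_arr ls \<beta>s) ! i)"
        using i len by simp
    qed (use len in simp)
    show "?\<phi> (k, map2 (Comp M) us (map (\<lambda>g. [g]) ls)) = ?\<phi> (Comp M k us, ls)"
      using N.comp_assoc[OF c1 c2] arrD(6)[OF \<alpha> len(3) k(1,2)]
        by (simp only: prod.case e concat_singletons)
  qed
  then show ?thesis
    using fgs by (simp add: expo_def * cong: conj_cong)
qed

lemma Comp_simps: "Dom E (Comp E \<alpha> \<beta>s) = concat (map (Dom E) \<beta>s)" "Cod E (Comp E \<alpha> \<beta>s) = Cod E \<alpha>"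
  by (simp_all add: expo_def)

lemma ary_Comp_unary:
  assumes "composable M f us" "set us \<subseteq> ary M 1"
  shows "length (Dom M (Comp M f us)) = length (Dom M f)"
proof -
  have "length (concat (map (Dom M) us)) = length us"
    using assms(2) by (induction us) (auto simp: ary_def)
  then show ?thesis using M.comp_simps(2)[OF assms(1)] assms(1) by (simp add: composable_nth)
qed

text \<open>Each condition at \<open>h\<close> is checked on some decomposition \<open>f(gs)\<close>
  of \<open>h\<close>. Unary arrows at the inputs are distributed over the blocks and absorbed by
  the \<open>gs\<close>, so naturality of the \<open>\<beta>s\<close> applies; a unary arrow at the
  output is absorbed by \<open>f\<close>, so naturality of \<alpha> applies.\<close>

lemma Comp_in_Arr:
  assumes a: "composable E \<alpha> \<beta>s"
  shows "Comp E \<alpha> \<beta>s \<in> Arr E"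
proof -
  let ?\<gamma> = "Comp E \<alpha> \<beta>s"
  let ?Fs = "concat (map (Dom E) \<beta>s)"
  have \<alpha>: "\<alpha> \<in> Arr E" and \<beta>s: "set \<beta>s \<subseteq> Arr E" and cod: "map (Cod E) \<beta>s = Dom E \<alpha>"
    using a by (auto simp: composable_def)
  have "set (Dom E b) \<subseteq> expo_obj M N" if "b \<in> set \<beta>s" for b
    using arrD(1)[of b] \<beta>s that expo_simps(1) by blast
  then have 1: "set ?Fs \<subseteq> expo_obj M N" unfolding set_concat set_map by blast
  have 2: "Cod E \<alpha> \<in> expo_obj M N" using arrD(2)[OF \<alpha>] by (simp add: expo_simps(1))
  have 3: "snd (snd ?\<gamma>) \<in> extensional (ary M (length ?Fs))"
    by (simp add: expo_def restrict_def extensional_def)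
  have 4: "ev_arr h ?\<gamma> \<in> mhom N (map2 ev_obj (Dom M h) ?Fs) (ev_obj (Cod M h) (Cod E \<alpha>))"
    if h: "h \<in> ary M (length ?Fs)" for h
  proof -
    obtain f gs where f: "composable M f gs" "Comp M f gs = h"
      and l: "same_arity M E gs \<beta>s"
      using decompose_ary[OF h] .
    have len: "length (Dom M f) = length (Dom E \<alpha>)" using f(1) a list_all2_lengthD[OF l]
      by (simp add: composable_nth)
    note c = N.comp_simps[OF composable_ev[OF a f(1) l]]
    have "map (Dom N) (map2 ev_arr gs \<beta>s) = map2 (map2 ev_obj) (map (Dom M) gs) (map (Dom E) \<beta>s)"
    proof (rule nth_equalityI)
      show "length (map (Dom N) (map2 ev_arr gs \<beta>s)) = length (map2 (map2 ev_obj) (map (Dom M) gs)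
        (map (Dom E) \<beta>s))" by simp
      fix i assume "i < length (map (Dom N) (map2 ev_arr gs \<beta>s))"
      then have i: "i < length gs" "i < length \<beta>s" by auto
      have "gs ! i \<in> Arr M" "\<beta>s ! i \<in> Arr E" using f(1) i \<beta>s by (auto simp: composable_nth)
      moreover have "length (Dom M (gs ! i)) = length (Dom E (\<beta>s ! i))"
        using l i by (simp add: list_all2_conv_all_nth)
      ultimately show "map (Dom N) (map2 ev_arr gs \<beta>s) ! i = map2 (map2 ev_obj) (map (Dom M) gs)
        (map (Dom E) \<beta>s) ! i"
        using arrD(4) i by simp
    qed
    also have "concat \<dots> = map2 ev_obj (concat (map (Dom M) gs)) ?Fs"
      using l by (intro map2_concat[symmetric]) (simp add: list_all2_conv_all_nth)
    finally have "Dom N (ev_arr h ?\<gamma>) = map2 ev_obj (Dom M h) ?Fs"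
      using c(2) ev_Comp[OF a f(1) l] f(2) M.comp_simps(2)[OF f(1)] by simp
    then show ?thesis
      using c(1,3) ev_Comp[OF a f(1) l] f(2) M.comp_simps(3)[OF f(1)] arrD(5)[OF \<alpha> _ len] f(1)
      by (simp add: mhom_def composable_def)
  qed
  have 5: "ev_arr (Comp M h us) ?\<gamma> = Comp N (ev_arr h ?\<gamma>) (map2 ev_un us ?Fs)"
    if h: "h \<in> ary M (length ?Fs)" and us: "composable M h us" "set us \<subseteq> ary M 1" for h us
  proof -
    obtain f gs where f: "composable M f gs" "Comp M f gs = h"
      and l: "same_arity M E gs \<beta>s"
      using decompose_ary[OF h] .
    obtain uss where uss: "concat uss = us" "list_all2 (composable M) gs uss"
      using M.composable_split[OF f(1)] us(1) f(2) by metis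
    have len: "length gs = length \<beta>s" "length uss = length \<beta>s"
      using list_all2_lengthD[OF l] list_all2_lengthD[OF uss(2)] by auto
    have nth: "composable M (gs ! i) (uss ! i)" "set (uss ! i) \<subseteq> ary M 1"
      "length (Dom M (gs ! i)) = length (Dom E (\<beta>s ! i))" "\<beta>s ! i \<in> Arr E" if "i < length \<beta>s" for i
    proof -
      show "composable M (gs ! i) (uss ! i)" "length (Dom M (gs ! i)) = length (Dom E (\<beta>s ! i))"
        using that uss(2) l len by (simp_all add: list_all2_conv_all_nth)
      have "uss ! i \<in> set uss" using that len by simp
      then show "set (uss ! i) \<subseteq> ary M 1" using us(2) by (auto simp flip: uss(1))
      show "\<beta>s ! i \<in> Arr E" using \<beta>s that by auto
    qed
    have l': "same_arity M E (map2 (Comp M) gs uss) \<beta>s"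
      using len nth ary_Comp_unary by (simp add: list_all2_conv_all_nth)
    have "ev_arr (Comp M h us) ?\<gamma> = Comp N (ev_arr f \<alpha>) (map2 ev_arr (map2 (Comp M) gs uss) \<beta>s)"
      using ev_Comp[OF a M.composable_concat(2)[OF f(1) uss(2)] l'] M.comp_assoc[OF f(1) uss(2)]
        f(2) uss(1) by simp
    also have "map2 ev_arr (map2 (Comp M) gs uss) \<beta>s =
        map2 (Comp N) (map2 ev_arr gs \<beta>s) (map2 (map2 ev_un) uss (map (Dom E) \<beta>s))"
    proof (rule nth_equalityI)
      fix i assume "i < length (map2 ev_arr (map2 (Comp M) gs uss) \<beta>s)"
      then have i: "i < length \<beta>s" using len by simp
      then show "map2 ev_arr (map2 (Comp M) gs uss) \<beta>s ! i =
          map2 (Comp N) (map2 ev_arr gs \<beta>s) (map2 (map2 ev_un) uss (map (Dom E) \<beta>s)) ! i"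
        using len arrD(6)[OF nth(4)[OF i] nth(3)[OF i] nth(1)[OF i] nth(2)[OF i]] by simp
    qed (use len in simp)
    also have "Comp N (ev_arr f \<alpha>) \<dots> =
        Comp N (Comp N (ev_arr f \<alpha>) (map2 ev_arr gs \<beta>s)) (concat (map2 (map2 ev_un) uss (map (Dom E)
          \<beta>s)))"
    proof (rule N.comp_assoc[OF composable_ev[OF a f(1) l], symmetric],
      unfold list_all2_conv_all_nth, intro conjI allI impI)
      fix i assume "i < length (map2 ev_arr gs \<beta>s)"
      then have i: "i < length \<beta>s" by simp
      then show "composable N (map2 ev_arr gs \<beta>s ! i) (map2 (map2 ev_un) uss (map (Dom E) \<beta>s) ! i)"
        using len composable_ev_un[OF nth(4)[OF i] nth(1)[OF i] nth(3)[OF i] nth(2)[OF i]] by simp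
    qed (use len in simp)
    also have "concat (map2 (map2 ev_un) uss (map (Dom E) \<beta>s)) = map2 ev_un us ?Fs"
      unfolding uss(1)[symmetric]
      by (intro map2_concat[symmetric]) (use len nth in \<open>auto simp: list_all2_conv_all_nth
        composable_nth\<close>)
    finally show ?thesis using ev_Comp[OF a f(1) l] f(2) by simp
  qed
  have 6: "ev_arr (Comp M v [h]) ?\<gamma> = Comp N (ev_un v (Cod E \<alpha>)) [ev_arr h ?\<gamma>]"
    if v: "v \<in> ary M 1" and h: "h \<in> ary M (length ?Fs)" and vh: "composable M v [h]" for v h
  proof -
    obtain f gs where f: "composable M f gs" "Comp M f gs = h"
      and l: "same_arity M E gs \<beta>s"
      using decompose_ary[OF h] .
    have len: "length (Dom M f) = length (Dom E \<alpha>)" using f(1) a list_all2_lengthD[OF l]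
      by (simp add: composable_nth)
    have vf: "composable M v [f]" using vh f M.comp_simps(3)[OF f(1)] by (auto simp: composable_def)
    have fl: "list_all2 (composable M) [f] [gs]" using f by simp
    note cc = M.composable_concat(1)[OF vf fl, simplified]
    have "Cod E \<alpha> \<in> Obj E" using arrD(2)[OF \<alpha>] .
    moreover have "Dom M v = [Cod M f]" using vf by (simp add: composable_def)
    ultimately have vN: "composable N (ev_un v (Cod E \<alpha>)) [ev_arr f \<alpha>]"
      using objD(2,3) v vf arrD(3,5)[OF \<alpha> _ len] by (auto simp: composable_def)
    have "ev_arr (Comp M v [h]) ?\<gamma> = Comp N (ev_arr (Comp M v [f]) \<alpha>) (map2 ev_arr gs \<beta>s)"
      using ev_Comp[OF a cc l] M.comp_assoc[OF vf fl] f(2) by simp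
    also have "\<dots> = Comp N (Comp N (ev_un v (Cod E \<alpha>)) [ev_arr f \<alpha>]) (map2 ev_arr gs \<beta>s)"
      using arrD(7)[OF \<alpha> v len vf] by simp
    also have "\<dots> = Comp N (ev_un v (Cod E \<alpha>)) [Comp N (ev_arr f \<alpha>) (map2 ev_arr gs \<beta>s)]"
      using N.comp_assoc[OF vN, of "[map2 ev_arr gs \<beta>s]"] composable_ev[OF a f(1) l] by simp
    finally show ?thesis using ev_Comp[OF a f(1) l] f(2) by simp
  qed
  have eq: "?\<gamma> = (?Fs, Cod E \<alpha>, snd (snd ?\<gamma>))" by (simp add: expo_def)
  show ?thesis
    unfolding expo_simps(2) expo_arr_def
    by (subst eq) (use 1 2 3 4 5 6 in blast)
qed

text \<open>For the family given by the action of \<open>F\<close>, both naturality conditions are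
  functoriality of \<open>F\<close>.\<close>

lemma Ident_in_Arr:
  assumes F: "F \<in> Obj E"
  shows "Ident E F \<in> Arr E"
proof -
  note o = objD[OF F]
  have "map2 ev_obj (Dom M u) [F] = map (fst F) (Dom M u)" if "u \<in> ary M 1" for u
    using that ary1_Dom[of u M] by (cases "Dom M u") (auto simp: ary_def)
  moreover have "ev_un (Comp M f us) F = Comp N (ev_un f F) (map2 ev_un us [F])"
    if "f \<in> ary M 1" "composable M f us" "set us \<subseteq> ary M 1" for f us
  proof -
    have "length us = 1" using that by (simp add: composable_nth ary_def)
    then obtain u where "us = [u]" by (cases us) auto
    then show ?thesis using that o(6) by simp
  qed
  moreover have "snd F \<in> extensional (ary M 1)" using F by (simp add: expo_simps expo_obj_def)
  ultimately show ?thesis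
    using F o by (auto simp: expo_simps expo_arr_def mhom_def)
qed

end

section \<open>Laws, universal property and smallness of the exponential\<close>

context promonoidal_pair
begin

lemma Comp_Ident_left:
  assumes a: "\<alpha> \<in> Arr E"
  shows "Comp E (Ident E (Cod E \<alpha>)) [\<alpha>] = \<alpha>"
proof (rule arr_eqI[OF _ a])
  let ?I = "Ident E (Cod E \<alpha>)"
  have I: "?I \<in> Arr E" using Ident_in_Arr[OF arrD(2)[OF a]] .
  then have c: "composable E ?I [\<alpha>]" using a by (simp add: composable_def expo_simps)
  show "Comp E ?I [\<alpha>] \<in> Arr E" using Comp_in_Arr[OF c] .
  fix f assume f: "f \<in> Arr M" "length (Dom M f) = length (Dom E \<alpha>)"
  have cf: "composable M (Ident M (Cod M f)) [f]" using M.composable_Ident_left[OF f(1)] by simp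
  have "ev_arr f (Comp E ?I [\<alpha>]) = Comp N (ev_arr (Ident M (Cod M f)) ?I) [ev_arr f \<alpha>]"
    using ev_Comp[OF c cf] f M.ident_left[OF f(1)] by simp
  also have "ev_arr (Ident M (Cod M f)) ?I = Ident N (Cod N (ev_arr f \<alpha>))"
    using objD(5)[OF arrD(2)[OF a] M.cod_obj[OF f(1)]] arrD(5)[OF a f] by (simp add: expo_simps)
  finally show "ev_arr f (Comp E ?I [\<alpha>]) = ev_arr f \<alpha>" using N.ident_left[OF arrD(3)[OF a f]]
    by simp
qed (simp_all add: expo_def)

lemma Comp_Ident_right:
  assumes a: "\<alpha> \<in> Arr E"
  shows "Comp E \<alpha> (map (Ident E) (Dom E \<alpha>)) = \<alpha>"
proof (rule arr_eqI[OF _ a])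
  let ?I = "map (Ident E) (Dom E \<alpha>)"
  have "Ident E F \<in> Arr E" if "F \<in> set (Dom E \<alpha>)" for F
    using Ident_in_Arr arrD(1)[OF a] that by blast
  then have c: "composable E \<alpha> ?I" using a by (auto simp: composable_def expo_simps intro!: map_idI)
  show "Comp E \<alpha> ?I \<in> Arr E" using Comp_in_Arr[OF c] .
  fix f assume f: "f \<in> Arr M" "length (Dom M f) = length (Dom E \<alpha>)"
  have obj: "A \<in> Obj M" if "A \<in> set (Dom M f)" for A using M.dom_obj[OF f(1)] that by blast
  have l: "same_arity M E (map (Ident M) (Dom M f)) ?I"
    using f(2) obj M.ident_simps(2) by (auto simp: list_all2_conv_all_nth expo_simps)
  have "ev_arr f (Comp E \<alpha> ?I) = Comp N (ev_arr f \<alpha>) (map2 ev_arr (map (Ident M) (Dom M f)) ?I)"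
    using ev_Comp[OF c M.composable_Ident_right[OF f(1)] l] M.ident_right[OF f(1)] by simp
  also have "map2 ev_arr (map (Ident M) (Dom M f)) ?I = map (Ident N) (Dom N (ev_arr f \<alpha>))"
    unfolding arrD(4)[OF a f]
  proof (rule nth_equalityI)
    fix i assume "i < length (map2 ev_arr (map (Ident M) (Dom M f)) ?I)"
    then have i: "i < length (Dom E \<alpha>)" by simp
    have "Dom E \<alpha> ! i \<in> Obj E" "Dom M f ! i \<in> Obj M"
      using subsetD[OF arrD(1)[OF a] nth_mem[OF i]] obj[OF nth_mem] i f(2) by simp_all
    then show "map2 ev_arr (map (Ident M) (Dom M f)) ?I ! i = map (Ident N) (map2 ev_obj (Dom M f)
      (Dom E \<alpha>)) ! i"
      using i f(2) objD(5) by (simp add: expo_simps(5))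
  qed (use f in simp)
  finally show "ev_arr f (Comp E \<alpha> ?I) = ev_arr f \<alpha>" using N.ident_right[OF arrD(3)[OF a f]] by simp
qed (simp_all add: expo_def comp_def)

text \<open>Both sides are evaluated at \<open>h\<close> through a two-stage decomposition:
  \<open>h = k(ls)\<close> with the arities of \<open>concat \<gamma>ss\<close>, then
  \<open>k = f(gs)\<close> with those of \<open>\<beta>s\<close>. Grouping \<open>ls\<close> into
  blocks \<open>lss\<close> under the \<open>gs\<close> also gives
  \<open>h = f(g_1(ls_1), ...)\<close>, and the claim reduces to associativity in
  \<open>N\<close>.\<close>

lemma Comp_assoc:
  assumes a: "composable E \<alpha> \<beta>s" and b: "list_all2 (composable E) \<beta>s \<gamma>ss"
  shows "Comp E (Comp E \<alpha> \<beta>s) (concat \<gamma>ss) = Comp E \<alpha> (map2 (Comp E) \<beta>s \<gamma>ss)"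
proof -
  have \<alpha>: "\<alpha> \<in> Arr E" and \<beta>: "\<And>i. i < length \<beta>s \<Longrightarrow> \<beta>s ! i \<in> Arr E \<and> Cod E (\<beta>s ! i) = Dom E \<alpha> ! i"
    and len: "length \<beta>s = length (Dom E \<alpha>)" "length \<gamma>ss = length \<beta>s"
    and bi: "\<And>i. i < length \<beta>s \<Longrightarrow> composable E (\<beta>s ! i) (\<gamma>ss ! i)"
    using a b by (auto simp: composable_nth list_all2_conv_all_nth)
  have "map (map (Cod E)) \<gamma>ss = map (Dom E) \<beta>s"
    using bi len by (auto simp: composable_def intro!: nth_equalityI)
  moreover have "set (concat \<gamma>ss) \<subseteq> Arr E"
  proof -
    have "set \<gamma>s \<subseteq> Arr E" if "\<gamma>s \<in> set \<gamma>ss" for \<gamma>s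
      using that bi len by (auto simp: in_set_conv_nth composable_def)
    then show ?thesis unfolding set_concat by blast
  qed
  ultimately have c1: "composable E (Comp E \<alpha> \<beta>s) (concat \<gamma>ss)"
    using Comp_in_Arr[OF a] by (simp add: composable_def Comp_simps map_concat del: set_concat)
  have c2: "composable E \<alpha> (map2 (Comp E) \<beta>s \<gamma>ss)"
    using \<alpha> \<beta> bi Comp_in_Arr len by (auto simp: composable_nth[of _ \<alpha>] Comp_simps)
  show ?thesis
  proof (rule arr_eqI[OF Comp_in_Arr[OF c1] Comp_in_Arr[OF c2]])
    have m: "map (Dom E) (map2 (Comp E) \<beta>s \<gamma>ss) = map (concat \<circ> map (Dom E)) \<gamma>ss"
      using len by (auto simp: Comp_simps intro!: nth_equalityI)
    have "concat (map (Dom E) (concat \<gamma>ss)) = concat (map (concat \<circ> map (Dom E)) \<gamma>ss)"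
      by (induction \<gamma>ss) auto
    then show "Dom E (Comp E (Comp E \<alpha> \<beta>s) (concat \<gamma>ss)) = Dom E (Comp E \<alpha> (map2 (Comp E) \<beta>s \<gamma>ss))"
      by (simp only: Comp_simps m)
    show "Cod E (Comp E (Comp E \<alpha> \<beta>s) (concat \<gamma>ss)) = Cod E (Comp E \<alpha> (map2 (Comp E) \<beta>s \<gamma>ss))"
      by (simp add: Comp_simps)
    fix h assume h: "h \<in> Arr M" "length (Dom M h) = length (Dom E (Comp E \<alpha> (map2 (Comp E) \<beta>s
      \<gamma>ss)))"
    then have "length (Dom M h) = length (concat (map (Dom E) (concat \<gamma>ss)))"
      using \<open>concat (map (Dom E) (concat \<gamma>ss)) = _\<close> by (simp only: Comp_simps m)
    from decompose[OF h(1) this] obtain k ls where k: "composable M k ls" "Comp M k ls = h"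
      and lk: "same_arity M E ls (concat \<gamma>ss)" .
    have "length (Dom M k) = length (concat (map (Dom E) \<beta>s))"
      using list_all2_lengthD[OF lk] k(1) c1 by (simp add: composable_nth Comp_simps)
    from decompose[OF composableD(1)[OF k(1)] this] obtain f gs where f: "composable M f gs"
      "Comp M f gs = k"
      and lf: "same_arity M E gs \<beta>s" .
    obtain lss where lss: "concat lss = ls" "list_all2 (composable M) gs lss"
      using M.composable_split[OF f(1)] k(1) f(2) by metis
    have len': "length gs = length \<beta>s" "length lss = length \<beta>s"
      using list_all2_lengthD[OF lf] list_all2_lengthD[OF lss(2)] by auto
    have ci: "composable M (gs ! i) (lss ! i)" if "i < length \<beta>s" for i
      using lss(2) that len' by (simp add: list_all2_conv_all_nth)
    \<comment> \<open>The concatenations agree by \<open>lk\<close>. Blocks have equal lengths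
      because \<open>lss ! i\<close> and \<open>\<gamma>ss ! i\<close> fill the inputs of two arrows
      of the same arity.\<close>
    have "map (map (length \<circ> Dom M)) lss = map (map (length \<circ> fst)) \<gamma>ss"
    proof (rule concat_eq_iff_lengths[THEN iffD1])
      show "map length (map (map (length \<circ> Dom M)) lss) = map length (map (map (length \<circ> fst)) \<gamma>ss)"
      proof (rule nth_equalityI)
        fix i assume "i < length (map length (map (map (length \<circ> Dom M)) lss))"
        then have i: "i < length \<beta>s" using len' by simp
        then have "length (lss ! i) = length (\<gamma>ss ! i)"
          using ci[OF i] bi[OF i] lf len' by (simp add: composable_nth list_all2_conv_all_nth)
        then show "map length (map (map (length \<circ> Dom M)) lss) ! i = map length (map (map (length \<circ>
          fst)) \<gamma>ss) ! i"
          using i len len' by simp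
      qed (use len len' in simp)
      show "concat (map (map (length \<circ> Dom M)) lss) = concat (map (map (length \<circ> fst)) \<gamma>ss)"
        using lk unfolding arity_conv[symmetric] lss(1)[symmetric] map_concat .
    qed
    note eq = this
    have li: "same_arity M E (lss ! i) (\<gamma>ss ! i)" if "i < length \<beta>s" for i
      using arg_cong[OF eq, of "\<lambda>xs. xs ! i"] that len len' by (simp flip: arity_conv)
    have l2: "same_arity M E (map2 (Comp M) gs lss) (map2 (Comp E) \<beta>s \<gamma>ss)"
    proof -
      have "length (concat (map (Dom M) (lss ! i))) = length (concat (map (Dom E) (\<gamma>ss ! i)))"
        if "i < length \<beta>s" for i
        using li[OF that] by (induction rule: list_all2_induct) auto
      then show ?thesis
        using len len' ci M.comp_simps(2) by (simp add: list_all2_conv_all_nth Comp_simps)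
    qed
    have "ev_arr h (Comp E \<alpha> (map2 (Comp E) \<beta>s \<gamma>ss)) =
        Comp N (ev_arr f \<alpha>) (map2 ev_arr (map2 (Comp M) gs lss) (map2 (Comp E) \<beta>s \<gamma>ss))"
      using ev_Comp[OF c2 M.composable_concat(2)[OF f(1) lss(2)] l2] M.comp_assoc[OF f(1) lss(2)]
        lss(1) f(2) k(2) by simp
    also have "map2 ev_arr (map2 (Comp M) gs lss) (map2 (Comp E) \<beta>s \<gamma>ss) =
        map2 (Comp N) (map2 ev_arr gs \<beta>s) (map2 (map2 ev_arr) lss \<gamma>ss)"
    proof (rule nth_equalityI)
      fix i assume "i < length (map2 ev_arr (map2 (Comp M) gs lss) (map2 (Comp E) \<beta>s \<gamma>ss))"
      then have i: "i < length \<beta>s" using len len' by simp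
      then show "map2 ev_arr (map2 (Comp M) gs lss) (map2 (Comp E) \<beta>s \<gamma>ss) ! i =
          map2 (Comp N) (map2 ev_arr gs \<beta>s) (map2 (map2 ev_arr) lss \<gamma>ss) ! i"
        using len len' ev_Comp[OF bi[OF i] ci[OF i] li[OF i]] by simp
    qed (use len len' in simp)
    also have "Comp N (ev_arr f \<alpha>) \<dots> = Comp N (Comp N (ev_arr f \<alpha>) (map2 ev_arr gs \<beta>s)) (concat
      (map2 (map2 ev_arr) lss \<gamma>ss))"
    proof (rule N.comp_assoc[OF composable_ev[OF a f(1) lf], symmetric],
      unfold list_all2_conv_all_nth, intro conjI allI impI)
      fix i assume "i < length (map2 ev_arr gs \<beta>s)"
      then have i: "i < length \<beta>s" by simp
      then show "composable N (map2 ev_arr gs \<beta>s ! i) (map2 (map2 ev_arr) lss \<gamma>ss ! i)"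
        using len len' composable_ev[OF bi[OF i] ci[OF i] li[OF i]] by simp
    qed (use len len' in simp)
    also have "concat (map2 (map2 ev_arr) lss \<gamma>ss) = map2 ev_arr ls (concat \<gamma>ss)"
      unfolding lss(1)[symmetric]
    proof (rule map2_concat[symmetric], unfold list_all2_conv_all_nth, intro conjI allI impI)
      fix i assume "i < length lss"
      then show "length (lss ! i) = length (\<gamma>ss ! i)" using list_all2_lengthD[OF li] len' by simp
    qed (use len len' in simp)
    also have "Comp N (ev_arr f \<alpha>) (map2 ev_arr gs \<beta>s) = ev_arr k (Comp E \<alpha> \<beta>s)"
      using ev_Comp[OF a f(1) lf] f(2) by simp
    also have "Comp N (ev_arr k (Comp E \<alpha> \<beta>s)) (map2 ev_arr ls (concat \<gamma>ss)) =
      ev_arr h (Comp E (Comp E \<alpha> \<beta>s) (concat \<gamma>ss))"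
      using ev_Comp[OF c1 k(1) lk] k(2) by simp
    finally show "ev_arr h (Comp E (Comp E \<alpha> \<beta>s) (concat \<gamma>ss)) = ev_arr h (Comp E \<alpha> (map2 (Comp E)
      \<beta>s \<gamma>ss))" ..
  qed
qed

lemma multicategory_expo: "multicategory E"
proof
  fix \<alpha> assume "\<alpha> \<in> Arr E"
  then show "set (Dom E \<alpha>) \<subseteq> Obj E" "Cod E \<alpha> \<in> Obj E"
    "Comp E (Ident E (Cod E \<alpha>)) [\<alpha>] = \<alpha>" "Comp E \<alpha> (map (Ident E) (Dom E \<alpha>)) = \<alpha>"
    by (fact arrD Comp_Ident_left Comp_Ident_right)+
next
  fix F assume "F \<in> Obj E"
  then show "Ident E F \<in> mhom E [F] F"
    using Ident_in_Arr by (simp add: mhom_def) (simp add: expo_simps)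
next
  fix \<alpha> \<beta>s assume "composable E \<alpha> \<beta>s"
  then show "Comp E \<alpha> \<beta>s \<in> mhom E (concat (map (Dom E) \<beta>s)) (Cod E \<alpha>)"
    using Comp_in_Arr by (simp add: mhom_def Comp_simps)
next
  fix \<alpha> \<beta>s \<gamma>ss assume "composable E \<alpha> \<beta>s" "list_all2 (composable E) \<beta>s \<gamma>ss"
  then show "Comp E (Comp E \<alpha> \<beta>s) (concat \<gamma>ss) = Comp E \<alpha> (map2 (Comp E) \<beta>s \<gamma>ss)"
    by (rule Comp_assoc)
qed

lemma mbifun_ev: "mbifun M E N ev_obj ev_arr"
  unfolding mbifun_def
proof (intro conjI ballI allI impI)
  fix f \<alpha> assume "f \<in> Arr M" "\<alpha> \<in> Arr E" "length (Dom M f) = length (Dom E \<alpha>)"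
  then show "ev_arr f \<alpha> \<in> mhom N (map2 ev_obj (Dom M f) (Dom E \<alpha>)) (ev_obj (Cod M f) (Cod E \<alpha>))"
    using arrD(3-5) by (simp add: mhom_def)
next
  fix A F assume "A \<in> Obj M" "F \<in> Obj E"
  then show "ev_obj A F \<in> Obj N" "ev_arr (Ident M A) (Ident E F) = Ident N (ev_obj A F)"
    using objD(1,5) by (simp_all add: expo_simps(5))
qed (use ev_Comp in blast)

text \<open>On objects of \<open>X\<close>, a unary arrow of \<open>M\<close> is paired with an
  identity. Naturality of the family belonging to \<open>a\<close> is functoriality of
  \<open>g\<close> applied to the two trivial decompositions of \<open>a\<close>, with identities at
  its inputs and at its output.\<close>

lemma transpose_exists:
  assumes X: "multicategory X" and g: "mbifun M X N go ga"
  shows "\<exists>ho ha. transposes M X E ev_obj ev_arr go ga ho ha"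
proof -
  interpret X: multicategory X by fact
  note gD = mbifunD[OF g]
  define ho where "ho x = (restrict (\<lambda>A. go A x) (Obj M), restrict (\<lambda>u. ga u (Ident X x)) (ary M
    1))" for x
  define ha where "ha a = (map ho (Dom X a), ho (Cod X a), restrict (\<lambda>f. ga f a) (ary M (length (Dom
    X a))))" for a
  have fst_ho: "ev_obj A (ho x) = go A x" if "A \<in> Obj M" for A x using that by (simp add: ho_def)
  have snd_ho: "ev_un u (ho x) = ga u (Ident X x)" if "u \<in> ary M 1"
    for u x using that by (simp add: ho_def)
  have ev_ha: "ev_arr f (ha a) = ga f a" if "f \<in> Arr M" "length (Dom M f) = length (Dom X a)"
    for f a
    using that by (simp add: ha_def ary_def)
  have ho: "ho x \<in> Obj E" if x: "x \<in> Obj X" for x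
  proof -
    note i = X.ident_simps[OF x]
    have cI: "composable X (Ident X x) [Ident X x]" "Comp X (Ident X x) [Ident X x] = Ident X x"
      using i X.ident_left[OF i(1)] by (simp_all add: composable_def)
    have u: "ga u (Ident X x) \<in> mhom N (map (fst (ho x)) (Dom M u)) (ev_obj (Cod M u) (ho x))"
      if "u \<in> ary M 1" for u
    proof -
      have u: "u \<in> Arr M" "length (Dom M u) = length (Dom X (Ident X x))"
        using that i by (auto simp: ary_def)
      have "map2 go (Dom M u) [x] = map (fst (ho x)) (Dom M u)"
        using ary1_Dom[of u M] that M.dom_obj[OF u(1)] fst_ho
          by (cases "Dom M u") (auto simp: ary_def)
      then show ?thesis using gD(2-4)[OF u(1) i(1) u(2)] i M.cod_obj[OF u(1)] fst_ho
        by (simp add: mhom_def)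
    qed
    have "ga (Comp M u [v]) (Ident X x) = Comp N (ga u (Ident X x)) [ga v (Ident X x)]"
      if "u \<in> ary M 1" "v \<in> ary M 1" "composable M u [v]" for u v
      using gD(6)[OF that(3) cI(1)] cI(2) that i by (simp add: ary_def)
    moreover have "Comp M u [v] \<in> ary M 1" if "u \<in> ary M 1" "v \<in> ary M 1" "composable M u [v]"
      for u v
      using M.comp_simps[OF that(3)] that by (simp add: ary_def)
    moreover have "Ident M A \<in> ary M 1" if "A \<in> Obj M" for A
      using M.ident_simps[OF that] by (simp add: ary_def)
    moreover have "fst (ho x) \<in> Obj M \<rightarrow>\<^sub>E Obj N" "snd (ho x) \<in> extensional (ary M 1)"
      using gD(1) x by (auto simp: ho_def)
    ultimately show ?thesis
      using u gD(5)[OF _ x] by (auto simp: expo_simps expo_obj_def snd_ho fst_ho)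
  qed
  have ha: "ha a \<in> Arr E" if a: "a \<in> Arr X" for a
  proof -
    let ?Fs = "map ho (Dom X a)"
    have 1: "set ?Fs \<subseteq> expo_obj M N" "ho (Cod X a) \<in> expo_obj M N"
      using ho X.dom_obj[OF a] X.cod_obj[OF a] by (auto simp: expo_simps(1))
    have 4: "ga f a \<in> mhom N (map2 ev_obj (Dom M f) ?Fs) (ev_obj (Cod M f) (ho (Cod X a)))"
      if "f \<in> ary M (length ?Fs)" for f
    proof -
      have f: "f \<in> Arr M" "length (Dom M f) = length (Dom X a)" using that by (auto simp: ary_def)
      have "map2 ev_obj (Dom M f) ?Fs = map2 go (Dom M f) (Dom X a)"
        using f(2) fst_ho M.dom_nth[OF f(1)] by (auto intro!: nth_equalityI)
      then show ?thesis using gD(2-4)[OF f(1) a f(2)] fst_ho M.cod_obj[OF f(1)]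
        by (simp add: mhom_def)
    qed
    have 5: "ga (Comp M f us) a = Comp N (ga f a) (map2 ev_un us ?Fs)"
      if f: "f \<in> ary M (length ?Fs)" and us: "composable M f us" "set us \<subseteq> ary M 1" for f us
    proof -
      have len: "length us = length (Dom X a)" using f us(1) by (simp add: ary_def composable_nth)
      have nth: "us ! i \<in> ary M 1" if "i < length us" for i using us(2) that by auto
      have "same_arity M X us (map (Ident X) (Dom X a))"
        using len nth X.ident_simps(2)[OF X.dom_nth[OF a]]
          by (auto simp: list_all2_conv_all_nth ary_def)
      from gD(6)[OF us(1) X.composable_Ident_right[OF a] this]
      have "ga (Comp M f us) a = Comp N (ga f a) (map2 ga us (map (Ident X) (Dom X a)))"
        using X.ident_right[OF a] by simp
      also have "map2 ga us (map (Ident X) (Dom X a)) = map2 ev_un us ?Fs"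
        using len nth snd_ho by (auto intro!: nth_equalityI)
      finally show ?thesis .
    qed
    have 6: "ga (Comp M v [f]) a = Comp N (ev_un v (ho (Cod X a))) [ga f a]"
      if "v \<in> ary M 1" "f \<in> ary M (length ?Fs)" "composable M v [f]" for v f
    proof -
      have "same_arity M X [f] [a]" using that by (simp add: ary_def)
      from gD(6)[OF that(3) X.composable_Ident_left[OF a refl] this]
      show ?thesis using X.ident_left[OF a] snd_ho[OF that(1)] by simp
    qed
    have ext: "snd (snd (ha a)) \<in> extensional (ary M (length ?Fs))" by (simp add: ha_def)
    have evs: "ev_arr f (ha a) = ga f a" if "f \<in> ary M (length ?Fs)"
      for f using ev_ha that by (simp add: ary_def)
    have c5: "Comp M f us \<in> ary M (length ?Fs)"
      if "f \<in> ary M (length ?Fs)" "composable M f us" "set us \<subseteq> ary M 1" for f us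
      using that ary_Comp_unary[OF that(2,3)] M.comp_simps(1)[OF that(2)] by (simp add: ary_def)
    have c6: "Comp M v [f] \<in> ary M (length ?Fs)" if "f \<in> ary M (length ?Fs)" "composable M v [f]"
      for v f
      using that M.comp_simps[OF that(2)] by (simp add: ary_def)
    have eq: "ha a = (?Fs, ho (Cod X a), snd (snd (ha a)))" by (simp add: ha_def)
    show ?thesis
      unfolding expo_simps(2) expo_arr_def
      by (subst eq) (use 1 4 5 6 ext evs c5 c6 in simp)
  qed
  have DC: "Dom E (ha a) = map ho (Dom X a)" "Cod E (ha a) = ho (Cod X a)" for a
    by (simp_all add: ha_def expo_simps)
  have "is_mfunctor X E ho ha"
    unfolding is_mfunctor_def
  proof (intro conjI ballI allI impI)
    fix a assume "a \<in> Arr X"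
    then show "ha a \<in> mhom E (map ho (Dom X a)) (ho (Cod X a))" using ha DC by (simp add: mhom_def)
  next
    fix x assume x: "x \<in> Obj X"
    show "ha (Ident X x) = Ident E (ho x)"
      using X.ident_simps[OF x] by (simp add: ha_def expo_simps) (simp add: ho_def)
  next
    fix a bs assume c: "composable X a bs"
    have cE: "composable E (ha a) (map ha bs)"
      using c ha DC by (auto simp: composable_nth)
    show "ha (Comp X a bs) = Comp E (ha a) (map ha bs)"
    proof (rule arr_eqI[OF ha[OF X.comp_simps(1)[OF c]] Comp_in_Arr[OF cE]])
      show "Dom E (ha (Comp X a bs)) = Dom E (Comp E (ha a) (map ha bs))"
        using X.comp_simps[OF c] by (simp add: DC Comp_simps map_concat comp_def)
      show "Cod E (ha (Comp X a bs)) = Cod E (Comp E (ha a) (map ha bs))"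
        using X.comp_simps[OF c] by (simp add: DC Comp_simps)
      fix h assume h: "h \<in> Arr M" "length (Dom M h) = length (Dom E (Comp E (ha a) (map ha bs)))"
      from decompose[OF h(1) h(2)[unfolded Comp_simps]] obtain f gs where f: "composable M f gs"
        "Comp M f gs = h"
        and l: "same_arity M E gs (map ha bs)" .
      have l': "same_arity M X gs bs"
        using l by (simp add: list_all2_conv_all_nth DC)
      have "length (Dom M h) = length (Dom X (Comp X a bs))"
        using h(2) X.comp_simps(2)[OF c] by (simp add: Comp_simps DC comp_def length_concat)
      then have "ev_arr h (ha (Comp X a bs)) = Comp N (ga f a) (map2 ga gs bs)"
        using ev_ha[OF h(1)] gD(6)[OF f(1) c l'] f(2) by simp
      also have "map2 ga gs bs = map2 ev_arr gs (map ha bs)"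
        using l' f(1) ev_ha by (auto simp: list_all2_conv_all_nth composable_nth intro!:
          nth_equalityI)
      also have "ga f a = ev_arr f (ha a)"
        using ev_ha[OF composableD(1)[OF f(1)]] c f(1) list_all2_lengthD[OF l']
          by (simp add: composable_nth)
      also have "Comp N (ev_arr f (ha a)) (map2 ev_arr gs (map ha bs)) =
        ev_arr h (Comp E (ha a) (map ha bs))"
        using ev_Comp[OF cE f(1) l] f(2) by simp
      finally show "ev_arr h (ha (Comp X a bs)) = ev_arr h (Comp E (ha a) (map ha bs))" .
    qed
  qed (use ho in blast)
  then have "transposes M X E ev_obj ev_arr go ga ho ha"
    using fst_ho ev_ha by (simp add: transposes_def)
  then show ?thesis by blast
qed

text \<open>Evaluation visibly determines the object maps and the families. The action of
  \<open>ho x\<close> on unary arrows is recovered from the identity of \<open>x\<close>, whose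
  image is an identity of \<open>E\<close> and has that action as its family.\<close>

lemma transpose_unique:
  assumes X: "multicategory X"
    and h: "transposes M X E ev_obj ev_arr go ga ho ha"
      and k: "transposes M X E ev_obj ev_arr go ga ko ka"
  shows "(\<forall>x\<in>Obj X. ho x = ko x) \<and> (\<forall>a\<in>Arr X. ha a = ka a)"
proof -
  interpret X: multicategory X by fact
  have un: "ev_un u (ho x) = ga u (Ident X x)"
    if h: "transposes M X E ev_obj ev_arr go ga ho ha" and u: "u \<in> ary M 1" and x: "x \<in> Obj X"
      for ho ha u x
  proof -
    have "ev_arr u (ha (Ident X x)) = ga u (Ident X x)"
      using transposesD(3)[OF h] u X.ident_simps[OF x] by (simp add: ary_def)
    then show ?thesis using mfunctorD(5)[OF transposesD(1)[OF h] x] by (simp add: expo_simps)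
  qed
  have o: "ho x = ko x" if x: "x \<in> Obj X" for x
  proof -
    have E: "ho x \<in> expo_obj M N" "ko x \<in> expo_obj M N"
      using mfunctorD(1)[OF transposesD(1)[OF h] x] mfunctorD(1)[OF transposesD(1)[OF k] x]
        by (simp_all add: expo_simps(1))
    have "fst (ho x) = fst (ko x)"
      by (rule PiE_ext[of _ "Obj M" "\<lambda>_. Obj N"])
        (use E transposesD(2)[OF h _ x] transposesD(2)[OF k _ x] in \<open>auto simp: expo_obj_def\<close>)
    moreover have "snd (ho x) = snd (ko x)"
      by (rule extensionalityI[of _ "ary M 1"])
        (use E un[OF h _ x] un[OF k _ x] in \<open>auto simp: expo_obj_def\<close>)
    ultimately show ?thesis by (simp add: prod_eq_iff)
  qed
  have "ha a = ka a" if a: "a \<in> Arr X" for a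
  proof (rule arr_eqI)
    note hF = mfunctorD[OF transposesD(1)[OF h]] and kF = mfunctorD[OF transposesD(1)[OF k]]
    show "ha a \<in> Arr E" "ka a \<in> Arr E" using hF(2) kF(2) a by auto
    have "map ho (Dom X a) = map ko (Dom X a)" using o X.dom_obj[OF a] by auto
    then show "Dom E (ha a) = Dom E (ka a)" using hF(3)[OF a] kF(3)[OF a] by simp
    show "Cod E (ha a) = Cod E (ka a)" using hF(4)[OF a] kF(4)[OF a] o[OF X.cod_obj[OF a]] by simp
    fix f assume "f \<in> Arr M" "length (Dom M f) = length (Dom E (ka a))"
    then show "ev_arr f (ha a) = ev_arr f (ka a)"
      using transposesD(3)[OF h _ a] transposesD(3)[OF k _ a] kF(3)[OF a] by simp
  qed
  with o show ?thesis by blast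
qed

lemma esmall_expo:
  assumes U: "universe TYPE('u)" and M: "esmall_mcat TYPE('u) M" and N: "esmall_mcat TYPE('u) N"
  shows "esmall_mcat TYPE('u) E"
proof -
  have "F \<in> (Obj M \<rightarrow>\<^sub>E Obj N) \<times> (ary M 1 \<rightarrow>\<^sub>E ary N 1)" if F: "F \<in> Obj E" for F
  proof -
    have "snd F u \<in> ary N 1" if "u \<in> ary M 1" for u
      using objD(2,3)[OF F that] that by (simp add: ary_def)
    then show ?thesis using F by (cases F) (auto simp: expo_simps expo_obj_def PiE_iff)
  qed
  then have sub: "Obj E \<subseteq> (Obj M \<rightarrow>\<^sub>E Obj N) \<times> (ary M 1 \<rightarrow>\<^sub>E ary N 1)" by blast
  have o: "esmall TYPE('u) (Obj E)"
    by (rule esmall_subset[OF _ sub])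
      (use U M N in \<open>intro esmall_Sigma esmall_PiE esmall_ary; simp add: esmall_mcat_def\<close>)
  have "esmall TYPE('u) (mhom E Fs G)" for Fs G
  proof (rule esmall_subset)
    show "esmall TYPE('u) ((\<lambda>\<alpha>. (Fs, G, \<alpha>)) ` (ary M (length Fs) \<rightarrow>\<^sub>E ary N (length Fs)))"
      using U M N by (intro esmall_image esmall_PiE esmall_ary)
    show "mhom E Fs G \<subseteq> (\<lambda>\<alpha>. (Fs, G, \<alpha>)) ` (ary M (length Fs) \<rightarrow>\<^sub>E ary N (length Fs))"
    proof
      fix \<alpha> assume "\<alpha> \<in> mhom E Fs G"
      then have a: "\<alpha> \<in> Arr E" "Dom E \<alpha> = Fs" "Cod E \<alpha> = G" by (auto simp: mhom_def)
      then have "ev_arr f \<alpha> \<in> ary N (length Fs)" if "f \<in> ary M (length Fs)" for f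
        using that arrD(3,4)[OF a(1), of f] by (simp add: ary_def)
      moreover have "snd (snd \<alpha>) \<in> extensional (ary M (length Fs))"
        using a by (auto simp: expo_simps expo_arr_def)
      moreover have "\<alpha> = (Fs, G, snd (snd \<alpha>))" using a by (simp add: expo_simps prod_eq_iff)
      ultimately show "\<alpha> \<in> (\<lambda>\<alpha>. (Fs, G, \<alpha>)) ` (ary M (length Fs) \<rightarrow>\<^sub>E ary N (length Fs))"
        by (intro image_eqI[where x = "snd (snd \<alpha>)"]) (auto simp: PiE_iff)
    qed
  qed
  then show ?thesis using o multicategory_expo by (simp add: esmall_mcat_def)
qed

end

lemma promonoidal_imp_exponentiable:
  fixes M :: "('u, 'u) mcat"
  assumes U: "universe TYPE('u)" and M: "small_multicategory M" and pro: "promonoidal M"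
  shows "exponentiable M"
proof -
  have p: "promonoidal_pair M N" if "small_multicategory N" for N :: "('u, 'u) mcat"
    using M pro that by (simp add: promonoidal_pair_def promonoidal_pair_axioms_def
      small_multicategory_def)
  show ?thesis
  proof (rule exponentiableI[OF U M, where E = "expo M" and eo = "\<lambda>_. ev_obj"
    and ea = "\<lambda>_. ev_arr"])
    fix N :: "('u, 'u) mcat" assume N: "small_multicategory N"
    interpret promonoidal_pair M N using p[OF N] .
    show "esmall_mcat TYPE('u) (expo M N)" using esmall_expo[OF U] M N
      by (simp add: esmall_mcat_iff)
    show "mbifun M (expo M N) N ev_obj ev_arr" by (rule mbifun_ev)
    fix X :: "('u, 'u) mcat" and go ga assume X: "multicategory X"
    show "\<exists>ho ha. transposes M X (expo M N) ev_obj ev_arr go ga ho ha" if "mbifun M X N go ga"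
      using transpose_exists[OF X that] .
    show "(\<forall>x\<in>Obj X. ho x = ho' x) \<and> (\<forall>a\<in>Arr X. ha a = ha' a)"
      if "transposes M X (expo M N) ev_obj ev_arr go ga ho ha"
        "transposes M X (expo M N) ev_obj ev_arr go ga ho' ha'" for ho ha ho' ha'
      using transpose_unique[OF X that] .
  qed
qed

section \<open>Collages\<close>

fun chop :: "nat list \<Rightarrow> 'a list \<Rightarrow> 'a list list" where
  "chop [] xs = []"
| "chop (n # ns) xs = take n xs # chop ns (drop n xs)"

lemma chop_concat: "chop (map length xss) (concat xss) = xss"
  by (induction xss) auto

text \<open>
  The collage has a lower copy \<open>Lo\<close> of \<open>M\<close>, an upper copy \<open>Up\<close> of \<open>M\<^sub>-\<close>, and formal composites
  \<open>Mix f [g\<^sub>1, \<dots>, g\<^sub>n]\<close> from lower objects to an upper one. The flag of an object is true at the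
  upper level.
\<close>

datatype 'a collage = Lo 'a | Up 'a | Mix 'a "'a list"

fun base :: "'a collage \<Rightarrow> 'a" where
  "base (Lo f) = f"
| "base (Up f) = f"
| "base (Mix f gs) = f"

text \<open>Upper arrows are unary, so composition at the upper level only acts on the outer arrow
  of a formal composite. The number \<open>n\<close> of inner arrows is fixed to keep homs small:
  nullary inner arrows do not change the domain, so without a bound one hom could contain formal
  composites of every length.\<close>

definition collage :: "nat \<Rightarrow> ('o, 'a) mcat \<Rightarrow> ('o \<times> bool, 'a collage) mcat" where
  "collage n M =
     \<lparr>Obj = Obj M \<times> UNIV,
      Arr = Lo ` Arr M \<union> Up ` ary M 1 \<union> {Mix f gs | f gs. composable M f gs \<and> length gs = n},
      Dom = (\<lambda>a. case a of Lo f \<Rightarrow> map (\<lambda>A. (A, False)) (Dom M f) | Up u \<Rightarrow> map (\<lambda>A. (A, True)) (Dom M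
        u)
        | Mix f gs \<Rightarrow> map (\<lambda>A. (A, False)) (concat (map (Dom M) gs))),
      Cod = (\<lambda>a. case a of Lo f \<Rightarrow> (Cod M f, False) | Up u \<Rightarrow> (Cod M u, True) | Mix f gs \<Rightarrow> (Cod M f,
        True)),
      Ident = (\<lambda>(A, b). if b then Up (Ident M A) else Lo (Ident M A)),
      Comp = (\<lambda>a bs. case a of
          Lo f \<Rightarrow> Lo (Comp M f (map base bs))
        | Up u \<Rightarrow> (case hd bs of Mix f gs \<Rightarrow> Mix (Comp M u [f]) gs | b \<Rightarrow> Up (Comp M u [base b]))
        | Mix f gs \<Rightarrow> Mix f (map2 (Comp M) gs (chop (map (length \<circ> Dom M) gs) (map base bs))))\<rparr>"

lemma collage_simps:
  "(A, b) \<in> Obj (collage n M) \<longleftrightarrow> A \<in> Obj M"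
  "Lo f \<in> Arr (collage n M) \<longleftrightarrow> f \<in> Arr M"
  "Up u \<in> Arr (collage n M) \<longleftrightarrow> u \<in> ary M 1"
  "Mix f gs \<in> Arr (collage n M) \<longleftrightarrow> composable M f gs \<and> length gs = n"
  "Dom (collage n M) (Lo f) = map (\<lambda>A. (A, False)) (Dom M f)"
  "Dom (collage n M) (Up u) = map (\<lambda>A. (A, True)) (Dom M u)"
  "Dom (collage n M) (Mix f gs) = map (\<lambda>A. (A, False)) (concat (map (Dom M) gs))"
  "Cod (collage n M) (Lo f) = (Cod M f, False)"
  "Cod (collage n M) (Up u) = (Cod M u, True)"
  "Cod (collage n M) (Mix f gs) = (Cod M f, True)"
  "Ident (collage n M) (A, False) = Lo (Ident M A)"
  "Ident (collage n M) (A, True) = Up (Ident M A)"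
  "Comp (collage n M) (Lo f) (map Lo hs) = Lo (Comp M f hs)"
  "Comp (collage n M) (Up u) [Up v] = Up (Comp M u [v])"
  "Comp (collage n M) (Up u) [Mix f gs] = Mix (Comp M u [f]) gs"
  by (auto simp: collage_def comp_def)

text \<open>\<open>chop\<close> recovers the blocks because the length of each is the arity of the
  arrow that it is fed to.\<close>

lemma Comp_Mix:
  assumes "list_all2 (composable M) gs hss"
  shows "Comp (collage n M) (Mix f gs) (map Lo (concat hss)) = Mix f (map2 (Comp M) gs hss)"
proof -
  have "map (length \<circ> Dom M) gs = map length hss"
    using assms by (auto simp: list_all2_conv_all_nth composable_nth intro!: nth_equalityI)
  moreover have "map base (map Lo (concat hss)) = concat hss" by (simp add: comp_def)
  ultimately show ?thesis by (simp add: collage_def chop_concat del: map_map)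
qed

lemma collage_lower:
  assumes "set bs \<subseteq> Arr (collage n M)" "map (Cod (collage n M)) bs = map (\<lambda>A. (A, False)) As"
  obtains hs where "bs = map Lo hs" "set hs \<subseteq> Arr M" "map (Cod M) hs = As"
proof -
  have "\<exists>hs. bs = map Lo hs \<and> set hs \<subseteq> Arr M \<and> map (Cod M) hs = As"
    using assms
  proof (induction bs arbitrary: As)
    case (Cons b bs)
    then obtain A As' where As: "As = A # As'" "Cod (collage n M) b = (A, False)" by (cases As) auto
    then obtain f where f: "b = Lo f" "f \<in> Arr M" "Cod M f = A"
      using Cons.prems(1) by (cases b) (auto simp: collage_simps)
    from Cons As obtain hs where "bs = map Lo hs" "set hs \<subseteq> Arr M" "map (Cod M) hs = As'" by auto
    with f As show ?case by (intro exI[of _ "f # hs"]) simp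
  qed simp
  then show thesis using that by blast
qed

context multicategory
begin

text \<open>Only lower arrows end in lower objects, and an upper arrow has a single input, filled by
  an upper or a mixed arrow. This leaves four shapes of composable lists.\<close>

lemma collage_composableE:
  assumes c: "composable (collage n M) a bs"
  obtains (Lo) f hs where "a = Lo f" "bs = map Lo hs" "composable M f hs"
  | (Up) u v where "a = Up u" "bs = [Up v]" "u \<in> ary M 1" "v \<in> ary M 1" "composable M u [v]"
  | (UpMix) u f gs where "a = Up u" "bs = [Mix f gs]" "u \<in> ary M 1" "composable M u [f]"
    "composable M f gs" "length gs = n"
  | (Mix) f gs hss where "a = Mix f gs" "bs = map Lo (concat hss)" "composable M f gs" "length gs =
    n"
      "list_all2 (composable M) gs hss"
proof (cases a)
  case (Lo f)
  then have "map (Cod (collage n M)) bs = map (\<lambda>A. (A, False)) (Dom M f)"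
    "set bs \<subseteq> Arr (collage n M)" "f \<in> Arr M"
    using c by (auto simp: composable_def collage_simps)
  then show thesis using that(1)[OF Lo] collage_lower by (metis composable_def)
next
  case (Up u)
  then have u: "u \<in> ary M 1" "map (Cod (collage n M)) bs = map (\<lambda>A. (A, True)) (Dom M u)"
    "set bs \<subseteq> Arr (collage n M)"
    using c by (auto simp: composable_def collage_simps)
  then obtain A where A: "Dom M u = [A]" by (cases "Dom M u") (auto simp: ary_def)
  then obtain b where b: "bs = [b]" "Cod (collage n M) b = (A, True)" "b \<in> Arr (collage n M)"
    using u(2,3) by (auto simp: map_eq_Cons_conv)
  show thesis
  proof (cases b)
    case (Up v)
    then show thesis using that(2)[OF \<open>a = Up u\<close>] b u(1) A
      by (simp add: collage_simps composable_def ary_def)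
  next
    case (Mix f gs)
    then show thesis using that(3)[OF \<open>a = Up u\<close>] b u(1) A
      by (simp add: collage_simps composable_def ary_def)
  qed (use b in \<open>simp add: collage_simps\<close>)
next
  case (Mix f gs)
  then have f: "composable M f gs" "length gs = n"
    and "map (Cod (collage n M)) bs = map (\<lambda>A. (A, False)) (concat (map (Dom M) gs))"
      "set bs \<subseteq> Arr (collage n M)"
    using c by (auto simp: composable_def collage_simps)
  then obtain hs where hs: "bs = map Lo hs" "set hs \<subseteq> Arr M" "map (Cod M) hs =
    concat (map (Dom M) gs)"
    using collage_lower by blast
  then have "composable M (Comp M f gs) hs" using comp_simps[OF f(1)] by (simp add: composable_def)
  then obtain hss where "concat hss = hs" "list_all2 (composable M) gs hss"
    by (rule composable_split[OF f(1)])
  then show thesis using that(4)[OF Mix _ f] hs(1) by blast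
qed

lemma list_all2_composable_Lo:
  assumes "list_all2 (composable (collage n M)) (map Lo gs) bss"
  obtains hss where "bss = map (map Lo) hss" "list_all2 (composable M) gs hss"
proof -
  have "\<exists>hss. bss = map (map Lo) hss \<and> list_all2 (composable M) gs hss"
    using assms
  proof (induction gs arbitrary: bss)
    case (Cons g gs)
    then obtain bs bss' where b: "bss = bs # bss'" "composable (collage n M) (Lo g) bs"
      "list_all2 (composable (collage n M)) (map Lo gs) bss'" by (auto simp: list_all2_Cons1)
    from b(2) obtain hs where "bs = map Lo hs" "composable M g hs"
      by (rule collage_composableE) auto
    moreover obtain hss where "bss' = map (map Lo) hss" "list_all2 (composable M) gs hss"
      using Cons.IH[OF b(3)] by blast
    ultimately show ?case using b(1) by (intro exI[of _ "hs # hss"]) simp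
  qed simp
  then show thesis using that by blast
qed

lemma list_all2_concatE:
  assumes "list_all2 P (concat xss) ys"
  obtains yss where "ys = concat yss" "list_all2 (list_all2 P) xss yss"
proof -
  have "\<exists>yss. ys = concat yss \<and> list_all2 (list_all2 P) xss yss"
    using assms
  proof (induction xss arbitrary: ys)
    case (Cons xs xss)
    then obtain ys1 ys2 where y: "ys = ys1 @ ys2" "list_all2 P xs ys1" "list_all2 P (concat xss)
      ys2"
      by (auto simp: list_all2_append1)
    with Cons.IH obtain yss where "ys2 = concat yss" "list_all2 (list_all2 P) xss yss" by blast
    with y show ?case by (intro exI[of _ "ys1 # yss"]) simp
  qed simp
  then show thesis using that by blast
qed

lemma map_Dom_Comp: "list_all2 (composable M) gs hss \<Longrightarrow>
    map (Dom M) (map2 (Comp M) gs hss) = map (\<lambda>hs. concat (map (Dom M) hs)) hss"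
  by (induction rule: list_all2_induct) (auto simp: comp_simps)

lemma Comp_collage_hom:
  assumes "composable (collage n M) a bs"
  shows "Comp (collage n M) a bs \<in> mhom (collage n M) (concat (map (Dom (collage n M)) bs)) (Cod
    (collage n M) a)"
  using assms
proof (cases rule: collage_composableE)
  case (Lo f hs)
  then show ?thesis using comp_simps[of f hs]
    by (simp add: mhom_def collage_simps map_concat comp_def)
next
  case (Up u v)
  then show ?thesis using comp_simps[of u "[v]"] by (simp add: mhom_def collage_simps ary_def)
next
  case (UpMix u f gs)
  have "list_all2 (composable M) [f] [gs]" using UpMix by simp
  from composable_concat(1)[OF UpMix(4) this] show ?thesis
    using UpMix comp_simps[of u "[f]"] by (simp add: mhom_def collage_simps)
next
  case (Mix f gs hss)
  have "concat (map (\<lambda>hs. concat (map (Dom M) hs)) hss) = concat (map (Dom M) (concat hss))"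
    by (induction hss) auto
  moreover have "map (Dom (collage n M)) bs = map (map (\<lambda>A. (A, False))) (map (Dom M) (concat hss))"
    by (simp add: Mix(2) collage_simps)
  moreover have "Comp (collage n M) a bs = Mix f (map2 (Comp M) gs hss)"
    by (simp only: Mix(1,2) Comp_Mix[OF Mix(5)])
  ultimately show ?thesis
    using Mix(1,4) composable_concat(2)[OF Mix(3,5)] map_Dom_Comp[OF Mix(5)] list_all2_lengthD[OF
      Mix(5)]
    by (simp add: mhom_def collage_simps) (simp add: map_concat)
qed

lemma multicategory_collage: "multicategory (collage n M)"
proof
  fix a assume a: "a \<in> Arr (collage n M)"
  have *: "set (Dom M f) \<subseteq> Obj M \<and> Cod M f \<in> Obj M" if "f \<in> Arr M" for f
    using dom_obj[OF that] cod_obj[OF that] by simp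
  have **: "set (concat (map (Dom M) gs)) \<subseteq> Obj M" if "composable M f gs" for f gs
    using * composableD(2)[OF that] by fastforce
  show "set (Dom (collage n M) a) \<subseteq> Obj (collage n M)"
  proof (cases a)
    case (Mix f gs)
    then show ?thesis using a **[of f gs] by (simp only: collage_simps) (auto simp: collage_simps)
  qed (use a * in \<open>auto simp: collage_simps ary_def subset_iff\<close>)
  show "Cod (collage n M) a \<in> Obj (collage n M)"
    using a * by (cases a) (auto simp: collage_simps ary_def composable_def)
  show "Comp (collage n M) (Ident (collage n M) (Cod (collage n M) a)) [a] = a"
    using a ident_left collage_simps(13)[of n M _ "[_]"]
    by (cases a) (auto simp: collage_simps ary_def composable_def)
  show "Comp (collage n M) a (map (Ident (collage n M)) (Dom (collage n M) a)) = a"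
  proof (cases a)
    case (Lo f)
    have "map (Ident (collage n M)) (Dom (collage n M) a) = map Lo (map (Ident M) (Dom M f))"
      by (simp add: Lo collage_simps)
    then show ?thesis using a Lo ident_right by (simp add: collage_simps del: map_map)
  next
    case (Up u)
    then have u: "u \<in> Arr M" "Dom M u = [hd (Dom M u)]"
      using a ary1_Dom[of u M] by (auto simp: collage_simps ary_def)
    then have "Comp M u [Ident M (hd (Dom M u))] = u" using ident_right[OF u(1)]
      by (metis list.simps(8,9))
    then show ?thesis unfolding Up collage_simps by (subst u(2)) (simp add: collage_simps)
  next
    case (Mix f gs)
    then have c: "composable M f gs" using a by (simp add: collage_simps)
    have l: "list_all2 (composable M) gs (map (\<lambda>g. map (Ident M) (Dom M g)) gs)"
      using c composable_Ident_right by (auto simp: list_all2_conv_all_nth composable_nth[of _ f])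
    have "map (Ident (collage n M)) (Dom (collage n M) a) = map Lo (concat (map (\<lambda>g. map (Ident M)
      (Dom M g)) gs))"
      by (simp add: Mix collage_simps map_concat comp_def)
    moreover have "map2 (Comp M) gs (map (\<lambda>g. map (Ident M) (Dom M g)) gs) = gs"
      using c ident_right by (auto simp: composable_nth intro!: nth_equalityI)
    ultimately show ?thesis using Comp_Mix[OF l] Mix by simp
  qed
next
  fix A assume "A \<in> Obj (collage n M)"
  then show "Ident (collage n M) A \<in> mhom (collage n M) [A] A"
    using ident_simps by (cases A; cases "snd A") (auto simp: collage_simps mhom_def ary_def)
next
  fix a bs assume "composable (collage n M) a bs"
  then show "Comp (collage n M) a bs \<in> mhom (collage n M) (concat (map (Dom (collage n M)) bs)) (Cod
    (collage n M) a)"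
    by (rule Comp_collage_hom)
next
  fix a bs css assume a: "composable (collage n M) a bs"
    and b: "list_all2 (composable (collage n M)) bs css"
  from a show "Comp (collage n M) (Comp (collage n M) a bs) (concat css) =
    Comp (collage n M) a (map2 (Comp (collage n M)) bs css)"
  proof (cases rule: collage_composableE)
    case (Lo f hs)
    obtain kss where k: "css = map (map Lo) kss" "list_all2 (composable M) hs kss"
      using list_all2_composable_Lo b Lo by metis
    have "map2 (Comp (collage n M)) bs css = map Lo (map2 (Comp M) hs kss)"
      using list_all2_lengthD[OF k(2)] by (auto simp: k(1) Lo collage_simps intro!: nth_equalityI)
    moreover have "concat css = map Lo (concat kss)" by (simp add: k(1) map_concat)
    ultimately show ?thesis using comp_assoc[OF Lo(3) k(2)] Lo by (simp only: collage_simps)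
  next
    case (Up u v)
    then obtain cs where cs: "css = [cs]" "composable (collage n M) (Up v) cs"
      using b by (auto simp: list_all2_Cons1)
    from cs(2) show ?thesis
    proof (cases rule: collage_composableE)
      case (Up v' w)
      have "list_all2 (composable M) [v] [[w]]" using Up by simp
      from comp_assoc[OF \<open>composable M u [v]\<close> this] show ?thesis
        using Up \<open>a = _\<close> \<open>bs = _\<close> cs(1) by (simp add: collage_simps)
    next
      case (UpMix v' f gs)
      have "list_all2 (composable M) [v] [[f]]" using UpMix by simp
      from comp_assoc[OF \<open>composable M u [v]\<close> this] show ?thesis
        using UpMix \<open>a = _\<close> \<open>bs = _\<close> cs(1) by (simp add: collage_simps)
    qed auto
  next
    case (UpMix u f gs)
    then obtain cs where cs: "css = [cs]" "composable (collage n M) (Mix f gs) cs"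
      using b by (auto simp: list_all2_Cons1)
    from cs(2) obtain hss where "cs = map Lo (concat hss)" "list_all2 (composable M) gs hss"
      by (rule collage_composableE) auto
    then show ?thesis using UpMix cs(1) by (simp add: collage_simps Comp_Mix)
  next
    case (Mix f gs hss)
    obtain kss where k: "css = map (map Lo) kss" "list_all2 (composable M) (concat hss) kss"
      using list_all2_composable_Lo b Mix(2) by metis
    \<comment> \<open>The arguments, indexed so far by the flat list \<open>concat hss\<close>, are
      regrouped by blocks, so that associativity in \<open>M\<close> can be applied at each
      \<open>gs ! i\<close> separately.\<close>
    then obtain ksss where ks: "kss = concat ksss" "list_all2 (list_all2 (composable M)) hss ksss"
      using list_all2_concatE by metis
    have len: "length hss = length gs" "length ksss = length gs"
      using list_all2_lengthD[OF Mix(5)] list_all2_lengthD[OF ks(2)] by auto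
    have nth: "composable M (gs ! i) (hss ! i)" "list_all2 (composable M) (hss ! i) (ksss ! i)"
      if "i < length gs" for i
      using Mix(5) ks(2) that len by (auto simp: list_all2_conv_all_nth[of "composable M"
        gs] list_all2_conv_all_nth[of "list_all2 (composable M)"])
    have l1: "list_all2 (composable M) (map2 (Comp M) gs hss) (map concat ksss)"
      using len nth composable_concat(1) by (simp add: list_all2_conv_all_nth[of "composable M"
        "map2 (Comp M) gs hss"])
    have l2: "list_all2 (composable M) gs (map2 (map2 (Comp M)) hss ksss)"
      using len nth composable_concat(2) by (simp add: list_all2_conv_all_nth[of "composable M" gs])
    have "concat (concat ksss) = concat (map concat ksss)" by (induction ksss) auto
    then have "concat css = map Lo (concat (map concat ksss))"
      by (simp add: k(1) ks(1) flip: map_concat)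
    then have L: "Comp (collage n M) (Comp (collage n M) a bs) (concat css) =
      Mix f (map2 (Comp M) (map2 (Comp M) gs hss) (map concat ksss))"
      by (simp only: Mix(1,2) Comp_Mix[OF Mix(5)] Comp_Mix[OF l1])
    have "map2 (Comp (collage n M)) bs css = map Lo (map2 (Comp M) (concat hss) (concat ksss))"
      using list_all2_lengthD[OF k(2)] by (auto simp: k(1) ks(1) Mix(2) collage_simps intro!:
        nth_equalityI)
    also have "map2 (Comp M) (concat hss) (concat ksss) = concat (map2 (map2 (Comp M)) hss ksss)"
      using ks(2) by (intro map2_concat) (auto simp: list_all2_conv_all_nth)
    finally have R: "Comp (collage n M) a (map2 (Comp (collage n M)) bs css) =
      Mix f (map2 (Comp M) gs (map2 (map2 (Comp M)) hss ksss))"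
      by (simp only: Mix(1) Comp_Mix[OF l2])
    have "map2 (Comp M) (map2 (Comp M) gs hss) (map concat ksss) = map2 (Comp M) gs (map2 (map2
      (Comp M)) hss ksss)"
      using len nth comp_assoc by (intro nth_equalityI) simp_all
    then show ?thesis using L R by simp
  qed
qed

end

lemma esmall_collage:
  assumes U: "universe TYPE('u)" and M: "esmall_mcat TYPE('u) M"
  shows "esmall_mcat TYPE('u) (collage n M)"
proof -
  interpret multicategory M using M by (simp add: esmall_mcat_def)
  have "Obj (collage n M) = Obj M \<times> UNIV" by (simp add: collage_def)
  then have "esmall TYPE('u) (Obj (collage n M))"
    using M esmall_Sigma[OF U, of "Obj M" "\<lambda>_. UNIV :: bool set"] esmall_finite[OF U, of "UNIV ::
      bool set"]
    by (simp add: esmall_mcat_def)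
  moreover have "esmall TYPE('u) (mhom (collage n M) As B)" for As B
  proof (rule esmall_subset)
    let ?A = "\<lambda>m. \<Union>k\<in>{..m}. ary M k"
    \<comment> \<open>\<open>?L\<close> consists of the arrows of arity at most that of
      \<open>As\<close>. It contains the inner arrows of every mixed arrow with domain
      \<open>As\<close>, because their domains concatenate to \<open>As\<close>.\<close>
    let ?L = "?A (length As)"
    let ?R = "Lo ` ?L \<union> (Up ` ?L \<union> (\<lambda>(f, gs). Mix f gs) ` (ary M n \<times> {gs. set gs \<subseteq> ?L \<and> length gs =
      n}))"
    have "esmall TYPE('u) ?L" using U M by (intro esmall_UNION esmall_ary esmall_finite) auto
    then show "esmall TYPE('u) ?R"
      using U M by (intro esmall_Un esmall_image esmall_Sigma esmall_lists_length esmall_ary)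
    show "mhom (collage n M) As B \<subseteq> ?R"
    proof
      fix a assume a: "a \<in> mhom (collage n M) As B"
      show "a \<in> ?R"
      proof (cases a)
        case (Mix f gs)
        have c: "composable M f gs" "length gs = n" "length As = length (concat (map (Dom M) gs))"
          using a Mix by (auto simp: mhom_def collage_simps)
        have "length (Dom M g) \<le> length As" if "g \<in> set gs" for g
          unfolding c(3) using that by (induction gs) auto
        then have "set gs \<subseteq> ?L" using c by (auto simp: composable_def ary_def)
        moreover have "f \<in> ary M n" using c by (simp add: ary_def composable_nth)
        ultimately show ?thesis using Mix c by blast
      qed (use a in \<open>auto simp: mhom_def collage_simps ary_def\<close>)
    qed
  qed
  ultimately show ?thesis using multicategory_collage by (simp add: esmall_mcat_def)
qed

text \<open>Applied to \<open>mfunctor_arity\<close>, this reads off the arities of the outer and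
  inner arrows of a formal composite.\<close>

lemma mfunctor_collage:
  assumes "multicategory M" and F: "is_mfunctor M N Fo Fa"
  shows "is_mfunctor (collage n M) (collage n N) (\<lambda>(A, b). (Fo A, b)) (map_collage Fa)"
proof -
  interpret multicategory M by fact
  note FD = mfunctorD[OF F] and Fc = mfunctor_composable[OF F]
  have Fary: "Fa u \<in> ary N 1" if "u \<in> ary M 1" for u using that FD by (simp add: ary_def)
  have dm: "map (Dom N) (map Fa gs) = map (map Fo) (map (Dom M) gs)" if "set gs \<subseteq> Arr M"
    for gs using that FD(3) by auto
  show ?thesis unfolding is_mfunctor_def
  proof (intro conjI ballI allI impI)
    fix a assume a: "a \<in> Arr (collage n M)"
    show "map_collage Fa a \<in> mhom (collage n N) (map (\<lambda>(A, b). (Fo A, b)) (Dom (collage n M) a))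
      ((\<lambda>(A, b). (Fo A, b)) (Cod (collage n M) a))"
    proof (cases a)
      case (Mix f gs)
      then have c: "composable M f gs" "length gs = n" using a by (simp_all add: collage_simps)
      have "concat (map (Dom N) (map Fa gs)) = map Fo (concat (map (Dom M) gs))"
        using dm[OF composableD(2)[OF c(1)]] by (simp only: map_concat)
      then show ?thesis using Mix c Fc[OF c(1)] FD(4)[OF composableD(1)[OF c(1)]]
        by (simp add: mhom_def collage_simps comp_def)
    qed (use a FD Fary in \<open>auto simp: mhom_def collage_simps ary_def\<close>)
  next
    fix A assume "A \<in> Obj (collage n M)"
    then show "map_collage Fa (Ident (collage n M) A) = Ident (collage n N) ((\<lambda>(A, b). (Fo A,
      b)) A)"
      using FD(5) by (cases A; cases "snd A") (auto simp: collage_simps)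
  next
    fix a bs assume "composable (collage n M) a bs"
    then show "map_collage Fa (Comp (collage n M) a bs) = Comp (collage n N) (map_collage Fa a) (map
      (map_collage Fa) bs)"
    proof (cases rule: collage_composableE)
      case (Lo f hs)
      have "map (map_collage Fa) bs = map Lo (map Fa hs)" by (simp add: Lo)
      then show ?thesis using FD(6)[OF Lo(3)] Lo by (simp add: collage_simps del: map_map)
    next
      case (Mix f gs hss)
      have l: "list_all2 (composable N) (map Fa gs) (map (map Fa) hss)"
        using Mix(5) Fc by (auto simp: list_all2_conv_all_nth)
      have "map (map_collage Fa) bs = map Lo (concat (map (map Fa) hss))"
        by (simp add: Mix map_concat comp_def)
      moreover have "map Fa (map2 (Comp M) gs hss) = map2 (Comp N) (map Fa gs) (map (map Fa) hss)"
        using Mix(5) FD(6) by (auto simp: list_all2_conv_all_nth intro!: nth_equalityI)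
      ultimately show ?thesis using Comp_Mix[OF l] Comp_Mix[OF Mix(5)] Mix by simp
    qed (use FD(6) in \<open>simp_all add: collage_simps\<close>)
  qed (use FD(1) in \<open>auto simp: collage_simps\<close>)
qed

text \<open>
  The quotient by the congruence that identifies \<open>f\<close> and \<open>g\<close> if \<open>\<rho> f = \<rho> g\<close>, on representatives.
\<close>

definition mquot :: "('o, 'a) mcat \<Rightarrow> ('a \<Rightarrow> 'a) \<Rightarrow> ('o, 'a) mcat" where
  "mquot M \<rho> = M\<lparr>Arr := \<rho> ` Arr M, Ident := \<rho> \<circ> Ident M, Comp := (\<lambda>f gs. \<rho> (Comp M f gs))\<rparr>"

locale mcat_congruence = multicategory M for M :: "('o, 'a) mcat" +
  fixes \<rho> :: "'a \<Rightarrow> 'a"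
  assumes rep: "f \<in> Arr M \<Longrightarrow> \<rho> f \<in> mhom M (Dom M f) (Cod M f)"
    and rep_idem: "f \<in> Arr M \<Longrightarrow> \<rho> (\<rho> f) = \<rho> f"
    and rep_Comp: "composable M f gs \<Longrightarrow> \<rho> (Comp M (\<rho> f) (map \<rho> gs)) = \<rho> (Comp M f gs)"
begin

lemma mquot_simps: "Obj (mquot M \<rho>) = Obj M" "Arr (mquot M \<rho>) = \<rho> ` Arr M" "Dom (mquot M \<rho>) = Dom M"
  "Cod (mquot M \<rho>) = Cod M" "Ident (mquot M \<rho>) A = \<rho> (Ident M A)" "Comp (mquot M \<rho>) f gs =
    \<rho> (Comp M f gs)"
  by (simp_all add: mquot_def)

lemma mquot_Arr: "f \<in> Arr (mquot M \<rho>) \<longleftrightarrow> f \<in> Arr M \<and> \<rho> f = f"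
  using rep rep_idem by (auto simp: mquot_simps mhom_def) (metis image_eqI)

lemma mquot_composable: "composable (mquot M \<rho>) f gs \<Longrightarrow> composable M f gs \<and> \<rho> f = f \<and> map \<rho> gs = gs"
  using mquot_Arr by (auto simp: composable_def mquot_simps(3,4) intro!: map_idI)

lemma rep_simps: "f \<in> Arr M \<Longrightarrow> \<rho> f \<in> Arr M" "f \<in> Arr M \<Longrightarrow> Dom M (\<rho> f) = Dom M f"
  "f \<in> Arr M \<Longrightarrow> Cod M (\<rho> f) = Cod M f"
  using rep by (auto simp: mhom_def)

lemma mfunctor_mquot: "is_mfunctor M (mquot M \<rho>) id \<rho>"
  unfolding is_mfunctor_def using rep_simps rep_idem rep_Comp by (auto simp: mquot_simps mhom_def)

lemma multicategory_mquot: "multicategory (mquot M \<rho>)"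
proof
  fix f gs assume "composable (mquot M \<rho>) f gs"
  then have "composable M f gs" using mquot_composable by blast
  then show "Comp (mquot M \<rho>) f gs \<in> mhom (mquot M \<rho>) (concat (map (Dom (mquot M \<rho>)) gs)) (Cod
    (mquot M \<rho>) f)"
    using comp_simps rep_simps by (simp add: mhom_def mquot_simps)
next
  fix f gs hss assume c: "composable (mquot M \<rho>) f gs"
    and l: "list_all2 (composable (mquot M \<rho>)) gs hss"
  note cM = mquot_composable[OF c]
  have l': "list_all2 (composable M) gs hss" using l mquot_composable
    by (auto simp: list_all2_conv_all_nth)
  have "map \<rho> (concat hss) = concat hss"
  proof -
    have "map \<rho> hs = hs" if "hs \<in> set hss" for hs
      using that l mquot_composable by (auto simp: list_all2_conv_all_nth in_set_conv_nth)
    then have "map (map \<rho>) hss = hss" by (simp add: map_idI)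
    then show ?thesis by (simp add: map_concat)
  qed
  then have "\<rho> (Comp M (\<rho> (Comp M f gs)) (concat hss)) = \<rho> (Comp M (Comp M f gs) (concat hss))"
    using rep_Comp[OF composable_concat(1)[OF conjunct1[OF cM] l']] by simp
  also have "\<dots> = \<rho> (Comp M f (map \<rho> (map2 (Comp M) gs hss)))"
    using rep_Comp[OF composable_concat(2)[OF conjunct1[OF cM] l']] comp_assoc[OF conjunct1[OF cM]
      l'] cM by simp
  also have "map \<rho> (map2 (Comp M) gs hss) = map2 (Comp (mquot M \<rho>)) gs hss"
    by (simp add: mquot_simps case_prod_unfold)
  finally show "Comp (mquot M \<rho>) (Comp (mquot M \<rho>) f gs) (concat hss) =
    Comp (mquot M \<rho>) f (map2 (Comp (mquot M \<rho>)) gs hss)"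
    by (simp add: mquot_simps)
next
  fix f assume "f \<in> Arr (mquot M \<rho>)"
  then have f: "f \<in> Arr M" "\<rho> f = f" by (simp_all add: mquot_Arr)
  show "Comp (mquot M \<rho>) (Ident (mquot M \<rho>) (Cod (mquot M \<rho>) f)) [f] = f"
    using rep_Comp[OF composable_Ident_left[OF f(1) refl]] f ident_left[OF f(1)]
      by (simp add: mquot_simps)
  have "map (Ident (mquot M \<rho>)) (Dom M f) = map \<rho> (map (Ident M) (Dom M f))"
    by (simp add: mquot_simps)
  then show "Comp (mquot M \<rho>) f (map (Ident (mquot M \<rho>)) (Dom (mquot M \<rho>) f)) = f"
    using rep_Comp[OF composable_Ident_right[OF f(1)]] f ident_right[OF f(1)]
      by (simp only: mquot_simps)
next
  fix f assume "f \<in> Arr (mquot M \<rho>)"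
  then show "set (Dom (mquot M \<rho>) f) \<subseteq> Obj (mquot M \<rho>)"
    using dom_obj[of f] mquot_Arr by (simp add: mquot_simps(1,3))
qed (use rep_simps cod_obj ident_simps in \<open>auto simp: mquot_simps mhom_def\<close>)

lemma mfunctor_from_mquot:
  assumes F: "is_mfunctor M N Fo Fa" and inv: "\<And>f. f \<in> Arr M \<Longrightarrow> Fa (\<rho> f) = Fa f"
  shows "is_mfunctor (mquot M \<rho>) N Fo Fa"
proof -
  note FD = mfunctorD[OF F]
  have "Fa (\<rho> (Comp M f gs)) = Comp N (Fa f) (map Fa gs)" if "composable (mquot M \<rho>) f gs" for f gs
    using FD(6) inv comp_simps(1) mquot_composable[OF that] by simp
  then show ?thesis
    unfolding is_mfunctor_def using FD inv ident_simps mquot_Arr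
      by (auto simp: mquot_simps(1,3-6) mhom_def)
qed

lemma esmall_mquot:
  assumes "esmall_mcat TYPE('u) M"
  shows "esmall_mcat TYPE('u) (mquot M \<rho>)"
proof -
  have "mhom (mquot M \<rho>) As B \<subseteq> mhom M As B" for As B
    using mquot_Arr by (auto simp: mhom_def mquot_simps(3,4))
  then have "esmall TYPE('u) (mhom (mquot M \<rho>) As B)" if "set As \<subseteq> Obj M" "B \<in> Obj M" for As B
    using assms that esmall_subset[where 'u = 'u] by (metis esmall_mcat_def)
  then show ?thesis
    using assms multicategory_mquot by (simp add: esmall_mcat_def mquot_simps(1))
qed

end

section \<open>Exponentiable multicategories are promonoidal\<close>

text \<open>An arrow is its own arity, whence composition by sums. \<open>comm UNIV\<close> is the
  terminal multicategory; \<open>comm {1}\<close> has one object with its identity, so its functors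
  to \<open>E\<close> are the objects of \<open>E\<close>.\<close>

definition comm :: "nat set \<Rightarrow> (unit, nat) mcat" where
  "comm S = \<lparr>Obj = {()}, Arr = S, Dom = (\<lambda>k. replicate k ()), Cod = (\<lambda>_. ()), Ident = (\<lambda>_. 1),
     Comp = (\<lambda>_. sum_list)\<rparr>"

text \<open>\<open>None\<close> is a free n-ary arrow from \<open>n\<close> copies of the object
  \<open>False\<close> to \<open>True\<close>, and \<open>Some b\<close> is the identity of
  \<open>b\<close>. The inputs coincide because all the arrows t will share one object as
  codomain.\<close>

definition corolla :: "nat \<Rightarrow> (bool, bool option) mcat" where
  "corolla n = \<lparr>Obj = UNIV, Arr = UNIV,
     Dom = (\<lambda>a. case a of None \<Rightarrow> replicate n False | Some b \<Rightarrow> [b]),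
     Cod = (\<lambda>a. case a of None \<Rightarrow> True | Some b \<Rightarrow> b),
     Ident = Some,
     Comp = (\<lambda>a bs. case a of None \<Rightarrow> None | Some _ \<Rightarrow> hd bs)\<rparr>"

lemma comm_simps: "Obj (comm S) = {()}" "Arr (comm S) = S" "Dom (comm S) k = replicate k ()"
  "Cod (comm S) k = ()"
  "Ident (comm S) x = 1" "Comp (comm S) k ks = sum_list ks"
  by (simp_all add: comm_def)

lemma corolla_simps: "Obj (corolla n) = UNIV" "Arr (corolla n) = UNIV"
  "Dom (corolla n) None = replicate n False" "Dom (corolla n) (Some b) = [b]"
  "Cod (corolla n) None = True" "Cod (corolla n) (Some b) = b" "Ident (corolla n) b = Some b"
  "Comp (corolla n) None bs = None" "Comp (corolla n) (Some b) [a] = a"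
  by (simp_all add: corolla_def)

lemma multicategory_comm:
  assumes "1 \<in> S" and "\<And>ks. length ks \<in> S \<Longrightarrow> set ks \<subseteq> S \<Longrightarrow> sum_list ks \<in> S"
  shows "multicategory (comm S)"
proof
  fix f gs assume "composable (comm S) f gs"
  then have "sum_list gs \<in> S" using assms(2)[of gs]
    by (auto simp: composable_nth comm_simps in_set_conv_nth subset_iff)
  moreover have "concat (map (\<lambda>k. replicate k ()) gs) = replicate (sum_list gs) ()"
    by (induction gs) (auto simp: replicate_add)
  ultimately show "Comp (comm S) f gs \<in> mhom (comm S) (concat (map (Dom (comm S)) gs)) (Cod (comm S)
    f)"
    by (simp add: mhom_def comm_simps cong: map_cong)
next
  fix f gs hss assume "list_all2 (composable (comm S)) gs hss"
  then have "length gs = length hss" by (rule list_all2_lengthD)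
  then have "map2 (Comp (comm S)) gs hss = map sum_list hss"
    by (auto simp: comm_simps intro!: nth_equalityI)
  moreover have "sum_list (concat hss) = sum_list (map sum_list hss)" by (induction hss) auto
  ultimately show "Comp (comm S) (Comp (comm S) f gs) (concat hss) = Comp (comm S) f (map2 (Comp
    (comm S)) gs hss)"
    by (simp add: comm_simps)
qed (use assms(1) in \<open>auto simp: comm_simps mhom_def sum_list_replicate\<close>)

lemma esmall_comm:
  assumes U: "universe TYPE('u)" and S: "multicategory (comm S)"
  shows "esmall_mcat TYPE('u) (comm S)"
proof -
  have "mhom (comm S) As B \<subseteq> {length As}" for As B by (auto simp: mhom_def comm_simps)
  then have "esmall TYPE('u) (mhom (comm S) As B)" for As B
    using esmall_finite[OF U, of "mhom (comm S) As B"] finite_subset by blast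
  then show ?thesis using S esmall_finite[OF U, of "{()}"] by (simp add: esmall_mcat_def comm_simps)
qed

lemma multicategory_corolla: "multicategory (corolla n)"
proof
  fix a bs assume c: "composable (corolla n) a bs"
  show "Comp (corolla n) a bs \<in> mhom (corolla n) (concat (map (Dom (corolla n)) bs)) (Cod (corolla
    n) a)"
  proof (cases a)
    case None
    have "map (Dom (corolla n)) bs = map (\<lambda>_. [False]) bs"
    proof (rule map_cong[OF refl])
      fix b assume "b \<in> set bs"
      then have "Cod (corolla n) b \<in> set (map (Cod (corolla n)) bs)" by simp
      also have "map (Cod (corolla n)) bs = replicate n False"
        using c None by (simp add: composable_def corolla_simps)
      finally have "Cod (corolla n) b = False" by simp
      then show "Dom (corolla n) b = [False]" by (cases b) (auto simp: corolla_simps)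
    qed
    moreover have "length bs = n" using c None by (simp add: composable_nth corolla_simps)
    moreover have "concat (map (\<lambda>_. [False]) bs) = replicate (length bs) False"
      by (induction bs) auto
    ultimately have "concat (map (Dom (corolla n)) bs) = replicate n False" by metis
    then show ?thesis by (simp add: None mhom_def corolla_simps)
  next
    case (Some b)
    then obtain x where "bs = [x]" "Cod (corolla n) x = b"
      using c by (auto simp: composable_def corolla_simps map_eq_Cons_conv)
    then show ?thesis by (simp add: Some mhom_def corolla_simps)
  qed
next
  fix a bs css assume c: "composable (corolla n) a bs"
    and l: "list_all2 (composable (corolla n)) bs css"
  show "Comp (corolla n) (Comp (corolla n) a bs) (concat css) = Comp (corolla n) a (map2 (Comp
    (corolla n)) bs css)"
  proof (cases a)
    case (Some b)
    then obtain x where x: "bs = [x]" using c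
      by (auto simp: composable_def corolla_simps map_eq_Cons_conv)
    then obtain cs where "css = [cs]" using l by (auto simp: list_all2_Cons1)
    then show ?thesis using x Some by (simp add: corolla_simps)
  qed (simp add: corolla_simps)
next
  fix a show "Comp (corolla n) a (map (Ident (corolla n)) (Dom (corolla n) a)) = a"
    by (cases a) (simp_all add: corolla_simps)
qed (auto simp: corolla_simps mhom_def)

lemma esmall_corolla: "universe TYPE('u) \<Longrightarrow> esmall_mcat TYPE('u) (corolla n)"
  using multicategory_corolla by (auto simp: esmall_mcat_def intro!: esmall_finite)

text \<open>\<open>SOME\<close> is applied to the coend class as a set, so related pairs get the
  same representative and equality of representatives is equality of classes.\<close>

definition collage_rep :: "('o, 'a) mcat \<Rightarrow> 'a collage \<Rightarrow> 'a collage" where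
  "collage_rep M a = (case a of Mix f gs \<Rightarrow>
     (case SOME p. p \<in> coend_rel M (map (Dom M) gs) (Cod M f) `` {(f, gs)} of (f', gs') \<Rightarrow> Mix f'
       gs') | _ \<Rightarrow> a)"

lemma collage_rep_simps: "collage_rep M (Lo f) = Lo f" "collage_rep M (Up u) = Up u"
  by (simp_all add: collage_rep_def)

context multicategory
begin

lemma collage_rep_eq:
  assumes r: "((f, gs), (f', gs')) \<in> coend_rel M \<Gamma>s B"
  shows "collage_rep M (Mix f gs) = collage_rep M (Mix f' gs')"
proof -
  have d: "(f, gs) \<in> decomps M \<Gamma>s B" "(f', gs') \<in> decomps M \<Gamma>s B"
    using r by (auto simp: coend_rel_def)
  have "coend_rel M \<Gamma>s B `` {(f, gs)} = coend_rel M \<Gamma>s B `` {(f', gs')}"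
    using equiv_class_eq[OF equiv_coend_rel r] .
  moreover have "Cod M f = B" "Cod M f' = B" "map (Dom M) gs = \<Gamma>s" "map (Dom M) gs' = \<Gamma>s"
    using d by (auto simp: decomps_def)
  ultimately show ?thesis by (simp only: collage_rep_def collage.case)
qed

lemma collage_rep_rel:
  assumes d: "(f, gs) \<in> decomps M \<Gamma>s B"
  obtains f' gs' where "collage_rep M (Mix f gs) = Mix f' gs'" "((f, gs), (f', gs')) \<in> coend_rel M
    \<Gamma>s B"
proof -
  have eq: "map (Dom M) gs = \<Gamma>s" "Cod M f = B" using d by (auto simp: decomps_def)
  obtain f' gs' where p: "(SOME p. p \<in> coend_rel M \<Gamma>s B `` {(f, gs)}) = (f', gs')" by fastforce
  have "(f, gs) \<in> coend_rel M \<Gamma>s B `` {(f, gs)}" using equiv_class_self[OF equiv_coend_rel d] .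
  from someI[of "\<lambda>p. p \<in> coend_rel M \<Gamma>s B `` {(f, gs)}", OF this]
  have "((f, gs), (f', gs')) \<in> coend_rel M \<Gamma>s B" using p by simp
  then show thesis using that p by (simp add: collage_rep_def eq)
qed

text \<open>Half of the congruence property: composing with \<open>u\<close> on the outside turns a
  generating step into a generating step, since \<open>u(k(us)) = (u k)(us)\<close>.\<close>

lemma coend_rel_left:
  assumes r: "((f, gs), (f', gs')) \<in> coend_rel M \<Gamma>s B" and u: "u \<in> ary M 1" "Dom M u = [B]"
  shows "collage_rep M (Mix (Comp M u [f]) gs) = collage_rep M (Mix (Comp M u [f']) gs')"
proof -
  let ?\<phi> = "\<lambda>(f, gs). collage_rep M (Mix (Comp M u [f]) gs)"
  have "?\<phi> (f, gs) = ?\<phi> (f', gs')"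
  proof (rule coend_rel_constant[OF r])
    fix k us ls assume k: "composable M k us" "Cod M k = B" "set us \<subseteq> ary M 1"
      "list_all2 (composable M) us (map (\<lambda>g. [g]) ls)"
    have uk: "composable M u [k]" using k u by (simp add: composable_def ary_def)
    have l: "list_all2 (composable M) [k] [us]" using k by simp
    have "composable M (Comp M u [k]) us" "Comp M (Comp M u [k]) us = Comp M u [Comp M k us]"
      using composable_concat(1)[OF uk l] comp_assoc[OF uk l] by simp_all
    then show "?\<phi> (k, map2 (Comp M) us (map (\<lambda>g. [g]) ls)) = ?\<phi> (Comp M k us, ls)"
      using collage_rep_eq[OF coend_rel_step[OF _ k(3,4)]] by simp
  qed
  then show ?thesis by simp
qed

text \<open>The other half, with \<open>(u_i l_i)(hs_i) = u_i(l_i(hs_i))\<close> for the inner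
  arrows. Composability of \<open>hss\<close> is expressed by \<open>\<Gamma>s\<close> alone, so
  that it makes sense along the whole zigzag.\<close>

lemma coend_rel_right:
  assumes r: "((f, gs), (f', gs')) \<in> coend_rel M \<Gamma>s B"
    and hss: "list_all2 (\<lambda>\<Gamma> hs. set hs \<subseteq> Arr M \<and> map (Cod M) hs = \<Gamma>) \<Gamma>s hss"
  shows "collage_rep M (Mix f (map2 (Comp M) gs hss)) = collage_rep M (Mix f' (map2 (Comp M) gs'
    hss))"
proof -
  let ?\<phi> = "\<lambda>(f, gs). collage_rep M (Mix f (map2 (Comp M) gs hss))"
  have "?\<phi> (f, gs) = ?\<phi> (f', gs')"
  proof (rule coend_rel_constant[OF r])
    fix k us ls assume k: "composable M k us" "set us \<subseteq> ary M 1"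
      "list_all2 (composable M) us (map (\<lambda>g. [g]) ls)" and dom: "map (Dom M) ls = \<Gamma>s"
    have len: "length us = length ls" "length hss = length ls"
      using list_all2_lengthD[OF k(3)] list_all2_lengthD[OF hss] dom by auto
    have u: "composable M (us ! i) [ls ! i]" if "i < length ls" for i
      using k(3) that len by (simp add: list_all2_conv_all_nth)
    have h: "composable M (ls ! i) (hss ! i)" if "i < length ls" for i
      using hss u[OF that] that len by (auto simp: list_all2_conv_all_nth composable_def simp flip:
        dom)
    have lh: "list_all2 (composable M) [ls ! i] [hss ! i]" if "i < length ls"
      for i using h[OF that] by simp
    have "list_all2 (composable M) us (map (\<lambda>g. [g]) (map2 (Comp M) ls hss))"
      using composable_concat(2)[OF u lh] len by (simp add: list_all2_conv_all_nth)
    moreover have "map2 (Comp M) (map2 (Comp M) us (map (\<lambda>g. [g]) ls)) hss =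
        map2 (Comp M) us (map (\<lambda>g. [g]) (map2 (Comp M) ls hss))"
      using comp_assoc[OF u lh] len by (intro nth_equalityI) simp_all
    ultimately show "?\<phi> (k, map2 (Comp M) us (map (\<lambda>g. [g]) ls)) = ?\<phi> (Comp M k us, ls)"
      using collage_rep_eq[OF coend_rel_step[OF k(1,2)]] by (simp only: prod.case)
  qed
  then show ?thesis by simp
qed

lemma mcat_congruence_collage: "mcat_congruence (collage n M) (collage_rep M)"
proof -
  interpret D: multicategory "collage n M" by (rule multicategory_collage)
  have Mix: "\<exists>f' gs'. collage_rep M (Mix f gs) = Mix f' gs' \<and> ((f, gs), (f', gs')) \<in> coend_rel M
    (map (Dom M) gs) (Cod M f)"
    if "composable M f gs" for f gs
  proof -
    have "(f, gs) \<in> decomps M (map (Dom M) gs) (Cod M f)" using that by (simp add: decomps_def)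
    then show ?thesis by (rule collage_rep_rel) blast
  qed
  show ?thesis
  proof
    fix a assume a: "a \<in> Arr (collage n M)"
    show "collage_rep M a \<in> mhom (collage n M) (Dom (collage n M) a) (Cod (collage n M) a)"
    proof (cases a)
      case a': (Mix f gs)
      then have "composable M f gs" "length gs = n" using a by (auto simp: collage_simps)
      moreover from this(1) obtain f' gs' where *: "collage_rep M (Mix f gs) = Mix f' gs'"
        "((f, gs), (f', gs')) \<in> coend_rel M (map (Dom M) gs) (Cod M f)"
        using Mix by blast
      from *(2) have "(f', gs') \<in> decomps M (map (Dom M) gs) (Cod M f)"
        by (auto simp: coend_rel_def)
      then have "composable M f' gs'" "Cod M f' = Cod M f" "map (Dom M) gs' = map (Dom M) gs"
        by (auto simp: decomps_def)
      moreover from this(3) have "length gs' = length gs" by (metis length_map)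
      ultimately show ?thesis using a' *(1) by (simp add: mhom_def collage_simps)
    qed (use a in \<open>auto simp: collage_rep_simps mhom_def\<close>)
    show "collage_rep M (collage_rep M a) = collage_rep M a"
    proof (cases a)
      case a': (Mix f gs)
      then have "composable M f gs" using a by (auto simp: collage_simps)
      then show ?thesis using Mix a' collage_rep_eq by metis
    qed (simp_all add: collage_rep_simps)
  next
    fix a bs assume "composable (collage n M) a bs"
    then show "collage_rep M (Comp (collage n M) (collage_rep M a) (map (collage_rep M) bs)) =
      collage_rep M (Comp (collage n M) a bs)"
    proof (cases rule: collage_composableE)
      case (Lo f hs)
      have "map (collage_rep M) bs = bs" by (simp add: Lo collage_rep_simps)
      then show ?thesis by (simp only: Lo(1) collage_rep_simps)
    next
      case (UpMix u f gs)
      obtain f' gs' where *: "collage_rep M (Mix f gs) = Mix f' gs'"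
        "((f, gs), (f', gs')) \<in> coend_rel M (map (Dom M) gs) (Cod M f)"
        using Mix[OF UpMix(5)] by blast
      have "Dom M u = [Cod M f]" using UpMix(4) by (simp add: composable_def)
      then show ?thesis
        using coend_rel_left[OF *(2) UpMix(3)] *(1) UpMix(1,2)
          by (simp add: collage_simps collage_rep_simps)
    next
      case M: (Mix f gs hss)
      obtain f' gs' where *: "collage_rep M (Mix f gs) = Mix f' gs'"
        "((f, gs), (f', gs')) \<in> coend_rel M (map (Dom M) gs) (Cod M f)"
        using Mix[OF M(3)] by blast
      from *(2) have "(f', gs') \<in> decomps M (map (Dom M) gs) (Cod M f)"
        by (auto simp: coend_rel_def)
      then have d: "composable M f' gs'" "map (Dom M) gs' = map (Dom M) gs"
        by (auto simp: decomps_def)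
      have hss: "list_all2 (\<lambda>\<Gamma> hs. set hs \<subseteq> Arr M \<and> map (Cod M) hs = \<Gamma>) (map (Dom M) gs) hss"
        using M(5) by (simp add: list_all2_conv_all_nth composable_def)
      then have "list_all2 (\<lambda>\<Gamma> hs. set hs \<subseteq> Arr M \<and> map (Cod M) hs = \<Gamma>) (map (Dom M) gs') hss"
        by (simp only: d(2))
      then have l: "list_all2 (composable M) gs' hss"
        using d(1) by (auto simp: list_all2_conv_all_nth composable_def subset_iff)
      have "map (collage_rep M) bs = map Lo (concat hss)" by (simp add: M(2) collage_rep_simps)
      then show ?thesis
        using coend_rel_right[OF *(2) hss] by (simp only: M(1,2) *(1) Comp_Mix[OF l] Comp_Mix[OF
          M(5)])
    qed (simp add: collage_rep_simps)
  qed
qed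

lemma mfunctor_Lo: "is_mfunctor M (collage n M) (\<lambda>A. (A, False)) Lo"
  by (auto simp: is_mfunctor_def collage_simps mhom_def)

lemma mfunctor_collage_collapse:
  "is_mfunctor (collage n M) M fst (\<lambda>a. case a of Mix f gs \<Rightarrow> Comp M f gs | _ \<Rightarrow> base a)"
    (is "is_mfunctor _ _ _ ?q")
  unfolding is_mfunctor_def
proof (intro conjI ballI allI impI)
  fix a assume "a \<in> Arr (collage n M)"
  then show "?q a \<in> mhom M (map fst (Dom (collage n M) a)) (fst (Cod (collage n M) a))"
    using comp_simps by (cases a) (auto simp: collage_simps mhom_def ary_def comp_def)
next
  fix A assume "A \<in> Obj (collage n M)"
  then show "?q (Ident (collage n M) A) = Ident M (fst A)"
    by (cases A; cases "snd A") (auto simp: collage_simps)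
next
  fix a bs assume "composable (collage n M) a bs"
  then show "?q (Comp (collage n M) a bs) = Comp M (?q a) (map ?q bs)"
  proof (cases rule: collage_composableE)
    case (Lo f hs)
    then show ?thesis by (simp add: collage_simps comp_def)
  next
    case (UpMix u f gs)
    have "list_all2 (composable M) [f] [gs]" using UpMix by simp
    from comp_assoc[OF UpMix(4) this] show ?thesis using UpMix by (simp add: collage_simps)
  next
    case (Mix f gs hss)
    have "map ?q bs = concat hss" by (simp add: Mix(2) comp_def)
    moreover have "?q (Comp (collage n M) a bs) = Comp M f (map2 (Comp M) gs hss)"
      by (simp only: Mix(1,2) Comp_Mix[OF Mix(5)] collage.case)
    ultimately show ?thesis using comp_assoc[OF Mix(3,5)] Mix(1) by simp
  qed (simp add: collage_simps)
qed (auto simp: collage_def)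

lemma mfunctor_arity: "is_mfunctor M (comm UNIV) (\<lambda>_. ()) (\<lambda>f. length (Dom M f))"
proof -
  have "length (concat (map (Dom M) gs)) = sum_list (map (\<lambda>f. length (Dom M f)) gs)" for gs
    by (induction gs) auto
  then show ?thesis
    using ident_simps comp_simps by (auto simp: is_mfunctor_def comm_simps mhom_def
      map_replicate_const)
qed

end

lemma multicategory_comm_UNIV: "multicategory (comm UNIV)"
  by (rule multicategory_comm) auto

lemma multicategory_comm_unit: "multicategory (comm {1})"
  by (rule multicategory_comm) (auto simp: length_Suc_conv)

section \<open>The generic n-ary arrow\<close>

context multicategory
begin

text \<open>The multicategory called \<open>K\<close> above: its mixed arrows are chosen
  representatives of coend classes.\<close>

abbreviation "collage_quot n \<equiv> mquot (collage n M) (collage_rep M)"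

abbreviation "idents f \<equiv> map (Ident M) (Dom M f)"

lemma idents_simps: "f \<in> Arr M \<Longrightarrow> Comp M f (idents f) = f \<and> composable M f (idents f) \<and>
  length (idents f) = length (Dom M f)"
  using ident_right composable_Ident_right by simp

text \<open>Every formal composite arises from one with identities inside by composing with lower
  arrows. This lets generic arrows reach all mixed arrows.\<close>

lemma Comp_Mix_idents:
  assumes c: "composable M f gs"
  shows "Comp (collage n M) (Mix f (idents f)) (map Lo gs) = Mix f gs"
proof -
  have l: "list_all2 (composable M) (idents f) (map (\<lambda>g. [g]) gs)"
    using c composable_Ident_left by (auto simp: list_all2_conv_all_nth composable_nth[of _ f])
  have "map2 (Comp M) (idents f) (map (\<lambda>g. [g]) gs) = gs"
    using c ident_left by (auto simp: composable_nth intro!: nth_equalityI) (metis ident_left)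
  then show ?thesis using Comp_Mix[OF l] by (simp only: concat_singletons)
qed

lemma composable_Mix_idents:
  assumes c: "composable M f gs" "length gs = n"
  shows "composable (collage n M) (Mix f (idents f)) (map Lo gs)"
proof -
  have f: "f \<in> Arr M" using c by (simp add: composable_def)
  have "concat (map (Dom M) (idents f)) = Dom M f"
    using comp_simps(2)[OF composable_Ident_right[OF f]] ident_right[OF f] by simp
  moreover have "map (Cod (collage n M)) (map Lo gs) = map (\<lambda>A. (A, False)) (map (Cod M) gs)"
    by (simp add: collage_simps)
  ultimately show ?thesis
    unfolding composable_def[of "collage n M"]
    using composableD[OF c(1)] c(2) composable_Ident_right[OF f] by (auto simp: collage_simps)
qed

text \<open>The generating step whose inner arrows are identities. It makes
  \<open>f \<mapsto> [f, id, ..., id]\<close> compatible with unary arrows at the inputs.\<close>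

lemma idents_rel:
  assumes c: "composable M f us" "set us \<subseteq> ary M 1"
  shows "collage_rep M (Mix f us) = collage_rep M (Mix (Comp M f us) (idents (Comp M f us)))"
proof -
  let ?ls = "map (\<lambda>u. Ident M (hd (Dom M u))) us"
  have u: "Dom M u = [hd (Dom M u)]" "u \<in> Arr M" if "u \<in> set us" for u
    using c(2) that ary1_Dom[of u M] by (auto simp: ary_def)
  have ob: "hd (Dom M u) \<in> Obj M" if "u \<in> set us" for u
    using dom_obj[OF u(2)[OF that]] u(1)[OF that] by (metis list.set_intros(1) subset_iff)
  have cu: "composable M u [Ident M (hd (Dom M u))]" "Comp M u [Ident M (hd (Dom M u))] = u"
    if "u \<in> set us" for u
    using composable_Ident_right[OF u(2)[OF that]] ident_right[OF u(2)[OF that]] u(1)[OF that]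
    by (metis list.simps(8,9))+
  have "map (Dom M) us = map (\<lambda>u. [hd (Dom M u)]) us" using u(1) by simp
  moreover have "concat (map (\<lambda>u. [hd (Dom M u)]) us) = map (\<lambda>u. hd (Dom M u)) us"
    by (induction us) auto
  ultimately have "Dom M (Comp M f us) = map (\<lambda>u. hd (Dom M u)) us"
    using comp_simps(2)[OF c(1)] by metis
  then have ids: "idents (Comp M f us) = ?ls" by simp
  have l: "list_all2 (composable M) us (map (\<lambda>g. [g]) ?ls)"
    using cu(1) by (simp add: list_all2_conv_all_nth)
  have "map2 (Comp M) us (map (\<lambda>g. [g]) ?ls) = us"
    using cu(2) by (intro nth_equalityI) simp_all
  with coend_rel_step[OF c l] have "((f, us), (Comp M f us, ?ls)) \<in> coend_rel M (map (Dom M) ?ls)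
    (Cod M f)" by simp
  then show ?thesis using collage_rep_eq ids by simp
qed

text \<open>The transpose of this bifunctor picks out the arrow x of the exponential: the free arrow
  \<open>None\<close> evaluates at \<open>f\<close> to \<open>[f, id, ..., id]\<close>, and the two
  objects of the corolla give the lower and the upper copy.\<close>

lemma mbifun_corolla:
  "mbifun M (corolla n) (collage_quot n) Pair
     (\<lambda>f a. case a of None \<Rightarrow> collage_rep M (Mix f (idents f)) | Some b \<Rightarrow> if b then Up f else Lo f)"
  (is "mbifun M _ ?K _ ?c")
proof -
  interpret Q: mcat_congruence "collage n M" "collage_rep M" by (rule mcat_congruence_collage)
  note \<pi> = mfunctorD[OF Q.mfunctor_mquot]
  have None: "Mix f (idents f) \<in> Arr (collage n M)"
    "Dom (collage n M) (Mix f (idents f)) = map (\<lambda>A. (A, False)) (Dom M f)"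
    "Cod (collage n M) (Mix f (idents f)) = (Cod M f, True)" if "f \<in> Arr M" "length (Dom M f) = n"
      for f
    using that idents_simps[OF that(1)] comp_simps(2)[OF composable_Ident_right[OF that(1)]]
    by (simp_all add: collage_simps)
  have mp: "map2 Pair xs (replicate (length xs) b) = map (\<lambda>x. (x, b)) xs" for xs :: "'z list"
    and b :: bool
    by (intro nth_equalityI) simp_all
  show ?thesis unfolding mbifun_def
  proof (intro conjI ballI allI impI)
    fix f and a :: "bool option" assume f: "f \<in> Arr M" "length (Dom M f) =
      length (Dom (corolla n) a)"
    show "?c f a \<in> mhom ?K (map2 Pair (Dom M f) (Dom (corolla n) a)) (Cod M f, Cod (corolla n) a)"
    proof (cases a)
      case N: None
      then have n: "length (Dom M f) = n" using f by (simp add: corolla_simps)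
      show ?thesis
        using \<pi>(2-4)[OF None(1)[OF f(1) n]] None(2,3)[OF f(1) n] mp[of "Dom M f" False] n N
        by (simp add: mhom_def Q.mquot_simps(3,4) corolla_simps)
    next
      case (Some b)
      then have u: "length (Dom M f) = 1" using f by (simp add: corolla_simps)
      then obtain A where A: "Dom M f = [A]" by (cases "Dom M f") auto
      show ?thesis
        using f(1) A Some by (auto simp: mhom_def Q.mquot_Arr Q.mquot_simps(3,4) collage_rep_simps
          collage_simps corolla_simps ary_def)
    qed
  next
    fix A b assume "A \<in> Obj M"
    then show "?c (Ident M A) (Ident (corolla n) b) = Ident ?K (A, b)"
      by (cases b) (simp_all add: Q.mquot_simps(5) collage_simps collage_rep_simps corolla_simps)
  next
    fix f gs a bs
    assume "composable M f gs \<and> composable (corolla n) a bs \<and>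
      list_all2 (\<lambda>g b. length (Dom M g) = length (Dom (corolla n) b)) gs bs"
    then have c: "composable M f gs" and a: "composable (corolla n) a bs"
      and l: "list_all2 (\<lambda>g b. length (Dom M g) = length (Dom (corolla n) b)) gs bs" by auto
    have f: "f \<in> Arr M" using c by (simp add: composable_def)
    show "?c (Comp M f gs) (Comp (corolla n) a bs) = Comp ?K (?c f a) (map2 ?c gs bs)"
    proof (cases a)
      case N: None
      \<comment> \<open>Only identities of \<open>False\<close> can be plugged into the free arrow,
        so the arrows of \<open>M\<close> paired with them are unary and \<open>idents_rel\<close>
        applies.\<close>
      have bs: "length bs = n" "b \<in> set bs \<Longrightarrow> b = Some False" for b
      proof -
        show "length bs = n" using a N by (simp add: composable_nth corolla_simps)
        assume "b \<in> set bs"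
        then have "Cod (corolla n) b \<in> set (map (Cod (corolla n)) bs)" by simp
        also have "map (Cod (corolla n)) bs = replicate n False"
          using a N by (simp add: composable_def corolla_simps)
        finally show "b = Some False" by (cases b) (simp_all add: corolla_simps)
      qed
      have nth: "bs ! i = Some False" "gs ! i \<in> ary M 1" if "i < n" for i
      proof -
        show "bs ! i = Some False" using bs that by simp
        then show "gs ! i \<in> ary M 1" using l c that bs(1)
          by (auto simp: list_all2_conv_all_nth ary_def composable_nth corolla_simps)
      qed
      have len: "length gs = n" using list_all2_lengthD[OF l] bs by simp
      then have n: "length (Dom M f) = n" using c by (simp add: composable_nth)
      have un: "set gs \<subseteq> ary M 1" using nth(2) len by (auto simp: in_set_conv_nth)
      have "map2 ?c gs bs = map Lo gs" using nth(1) len bs(1) by (intro nth_equalityI) simp_all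
      moreover have "map (collage_rep M) (map Lo gs) = map Lo gs" by (simp add: collage_rep_simps)
      ultimately have "Comp ?K (?c f a) (map2 ?c gs bs) = collage_rep M (Mix f gs)"
        using \<pi>(6)[OF composable_Mix_idents[OF c len]] Comp_Mix_idents[OF c, of n]
        by (simp only: N option.case)
      then show ?thesis using idents_rel[OF c un] N by (simp add: corolla_simps)
    next
      case (Some b)
      then obtain x where x: "bs = [x]" "Cod (corolla n) x = b"
        using a by (auto simp: composable_def corolla_simps map_eq_Cons_conv)
      then obtain g where g: "gs = [g]" "length (Dom M g) = length (Dom (corolla n) x)"
        using l by (auto simp: list_all2_Cons2)
      have gA: "g \<in> Arr M" "Dom M f = [Cod M g]" using c g by (simp_all add: composable_def)
      have dfg: "Dom M (Comp M f [g]) = Dom M g" using comp_simps(2)[OF c] g by simp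
      show ?thesis
      proof (cases x)
        case N: None
        then have "b" and n: "length (Dom M g) = n" using x g by (simp_all add: corolla_simps)
        have "composable (collage n M) (Up f) [Mix g (idents g)]"
          using None[OF gA(1) n] f gA by (simp add: composable_def collage_simps ary_def)
        from \<pi>(6)[OF this] show ?thesis
          using N Some x g \<open>b\<close> dfg by (simp add: corolla_simps collage_simps collage_rep_simps)
      next
        case S: (Some b')
        then have "b' = b" using x by (simp add: corolla_simps)
        then show ?thesis
          using S Some x g collage_simps(13)[of n M f "[g]"]
          by (cases b) (simp_all add: corolla_simps collage_simps collage_rep_simps
            Q.mquot_simps(6))
      qed
    qed
  qed (simp add: Q.mquot_simps(1) collage_simps)
qed

end

text \<open>The same generic arrow with the terminal multicategory in place of \<open>M\<close>. Its
  composites with lower arrows \<open>ms\<close> are the arrows \<open>Mix n ms\<close>.\<close>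

lemma mfunctor_corolla_collage:
  "is_mfunctor (corolla n) (collage n (comm UNIV)) (Pair ())
     (\<lambda>a. case a of None \<Rightarrow> Mix n (replicate n 1) | Some b \<Rightarrow> if b then Up 1 else Lo 1)"
  (is "is_mfunctor _ ?R _ ?F")
proof -
  interpret C: multicategory "comm UNIV" by (rule multicategory_comm_UNIV)
  have c: "composable (comm UNIV) n (replicate n 1)" by (simp add: composable_nth comm_simps)
  have cc: "concat (map (Dom (comm UNIV)) (replicate n 1)) = replicate n ()"
    by (induction n) (auto simp: comm_simps)
  show ?thesis unfolding is_mfunctor_def
  proof (intro conjI ballI allI impI)
    fix a show "?F a \<in> mhom ?R (map (Pair ()) (Dom (corolla n) a)) ((), Cod (corolla n) a)"
      using c cc by (cases a) (auto simp: mhom_def collage_simps corolla_simps comm_simps ary_def)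
  next
    fix a bs assume a: "composable (corolla n) a bs"
    show "?F (Comp (corolla n) a bs) = Comp ?R (?F a) (map ?F bs)"
    proof (cases a)
      case None
      have "length bs = n" using a None by (simp add: composable_nth corolla_simps)
      moreover have "b = Some False" if "b \<in> set bs" for b
      proof -
        have "Cod (corolla n) b \<in> set (map (Cod (corolla n)) bs)" using that by simp
        also have "map (Cod (corolla n)) bs = replicate n False"
          using a None by (simp add: composable_def corolla_simps)
        finally show "b = Some False" by (cases b) (simp_all add: corolla_simps)
      qed
      ultimately have "bs = replicate n (Some False)" by (simp add: list_eq_iff_nth_eq)
      then have m: "map ?F bs = map Lo (replicate n 1)" by simp
      have "C.idents n = replicate n 1" by (simp add: comm_simps)
      then show ?thesis using C.Comp_Mix_idents[OF c, of n] None m by (simp add: corolla_simps)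
    next
      case (Some b)
      then obtain x where x: "bs = [x]" "Cod (corolla n) x = b"
        using a by (auto simp: composable_def corolla_simps map_eq_Cons_conv)
      then show ?thesis
        using Some collage_simps(13)[of n "comm UNIV" 1 "[1]"]
        by (cases x; cases b) (auto simp: corolla_simps collage_simps comm_simps)
    qed
  qed (auto simp: collage_simps corolla_simps comm_simps collage_def)
qed

section \<open>Decompositions from an exponential\<close>

lemma exponentiable_imp_promonoidal:
  fixes M :: "('u, 'u) mcat"
  assumes U: "universe TYPE('u)" and sM: "small_multicategory M" and ex: "exponentiable M"
  shows "promonoidal M"
proof -
  interpret multicategory M using sM by (simp add: small_multicategory_def)
  have eM: "esmall_mcat TYPE('u) M" using sM by (simp add: esmall_mcat_iff)
  note comm = multicategory_comm_UNIV
  have eC: "esmall_mcat TYPE('u) (comm UNIV)" by (rule esmall_comm[OF U comm])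
  have e1: "esmall_mcat TYPE('u) (comm {1})" by (rule esmall_comm[OF U multicategory_comm_unit])
  \<comment> \<open>For fixed arities \<open>ms\<close>, the first clause of \<open>key\<close>
    makes composition injective on classes and the second makes it surjective. Prescribing arities
    is enough, because the domain of the composite then fixes the blocks.\<close>
  have key: "\<exists>r. (\<forall>f gs. composable M f gs \<and> map (length \<circ> Dom M) gs = ms \<longrightarrow>
        r (Comp M f gs) = collage_rep M (Mix f gs)) \<and>
      (\<forall>h. h \<in> Arr M \<and> length (Dom M h) = sum_list ms \<longrightarrow>
        (\<exists>f gs. r h = Mix f gs \<and> composable M f gs \<and> map (length \<circ> Dom M) gs = ms \<and> Comp M f gs =
          h))"
    for ms :: "nat list"
  proof -
    define n where "n = length ms"
    interpret Q: mcat_congruence "collage n M" "collage_rep M" by (rule mcat_congruence_collage)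
    let ?D = "collage n M" and ?K = "collage_quot n" and ?R = "collage n (comm UNIV)"
    note \<pi> = mfunctorD[OF Q.mfunctor_mquot]
    have eK: "esmall_mcat TYPE('u) ?K" by (rule Q.esmall_mquot[OF esmall_collage[OF U eM]])
    have eR: "esmall_mcat TYPE('u) ?R" by (rule esmall_collage[OF U eC])
    let ?c = "\<lambda>f a. case a of None \<Rightarrow> collage_rep M (Mix f (idents f)) | Some b \<Rightarrow> if b then Up f else
      Lo f"
    obtain E eo ea where E: "universal_ev M ?K E eo ea"
      using exponentiable_universal_ev[OF U sM ex eK] .
    interpret E: multicategory E using universal_evD(2)[OF E] .
    have sE: "esmall_mcat TYPE('u) E" using universal_evD(1)[OF E] by (simp add: esmall_mcat_iff)
    have LoK: "is_mfunctor M ?K (\<lambda>A. (A, False)) Lo"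
      using mfunctor_comp[OF mfunctor_Lo Q.mfunctor_mquot] by (simp add: comp_def collage_rep_simps)
    have bt: "mbifun M (comm UNIV) ?K (\<lambda>A x. (A, False)) (\<lambda>g m. Lo g)" by (rule mbifun_fst[OF LoK])
    obtain to ta where t: "transposes M (comm UNIV) E eo ea (\<lambda>A x. (A, False)) (\<lambda>g m. Lo g) to ta"
      by (rule universal_ev_transpose[OF U E eC bt])
    obtain xo xa where x: "transposes M (corolla n) E eo ea Pair ?c xo xa"
      by (rule universal_ev_transpose[OF U E esmall_corolla[OF U] mbifun_corolla])
    note tF = mfunctorD[OF transposesD(1)[OF t]] and xF = mfunctorD[OF transposesD(1)[OF x]]
    \<comment> \<open>\<open>comm {1}\<close> classifies objects, and \<open>corolla n\<close> classifies \<open>n\<close>-ary arrows.\<close>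
    have same_object: "xo False = to ()"
    proof -
      have i: "is_mfunctor (comm {1}) (corolla n) (\<lambda>_. False) (\<lambda>_. Some False)"
        by (auto simp: is_mfunctor_def comm_simps corolla_simps mhom_def composable_def
          map_eq_Cons_conv)
      have j: "is_mfunctor (comm {1}) (comm UNIV) id id"
        by (auto simp: is_mfunctor_def comm_simps mhom_def)
      have b: "mbifun M (comm {1}) ?K (\<lambda>A x. (A, False)) (\<lambda>g m. Lo g)" by (rule mbifun_fst[OF LoK])
      have 1: "transposes M (comm {1}) E eo ea (\<lambda>A x. (A, False)) (\<lambda>g m. Lo g) (xo \<circ> (\<lambda>_. False))
        (xa \<circ> (\<lambda>_. Some False))"
        using transposes_compose[OF x i] by simp
      have 2: "transposes M (comm {1}) E eo ea (\<lambda>A x. (A, False)) (\<lambda>g m. Lo g) (to \<circ> id) (ta \<circ> id)"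
        by (rule transposes_compose[OF t j])
      have "(xo \<circ> (\<lambda>_. False)) () = (to \<circ> id) ()"
        by (rule universal_ev_unique(1)[OF U E e1 b 1 2]) (simp add: comm_simps)
      then show ?thesis by simp
    qed
    \<comment> \<open>The composite x(t, ..., t) makes sense because \<open>same_object\<close>
      identifies the inputs of x with the codomain of every t.\<close>
    have zc: "composable E (xa None) (map ta ms)"
      using tF(2-4) xF(2-4) by (auto simp: composable_nth corolla_simps comm_simps same_object
        n_def)
    define z where "z = Comp E (xa None) (map ta ms)"
    \<comment> \<open>\<open>z\<close> can be evaluated at each \<open>h\<close> of arity
      \<open>sum_list ms\<close>, whether or not \<open>h\<close> decomposes.\<close>
    define r where "r h = ea h z" for h
    have xe: "ea f (xa None) = collage_rep M (Mix f (idents f))"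
      if "f \<in> Arr M" "length (Dom M f) = n" for f
      using transposesD(3)[OF x that(1)] that(2) by (simp add: corolla_simps)
    have te: "ea g (ta (length (Dom M g))) = Lo g" if "g \<in> Arr M" for g
      using transposesD(3)[OF t that] by (simp add: comm_simps)
    have ta_dom: "length (Dom E (ta m)) = m" "ta m \<in> Arr E"
      for m using tF(2,3) by (simp_all add: comm_simps)
    have zdom: "length (Dom E z) = sum_list ms"
    proof -
      have "length (concat (map (Dom E) (map ta ms))) = sum_list ms"
        using ta_dom(1) by (induction ms) (simp_all)
      then show ?thesis using E.comp_simps(2)[OF zc] by (simp add: z_def)
    qed
    have zA: "z \<in> Arr E" using E.comp_simps(1)[OF zc] by (simp add: z_def)
    \<comment> \<open>Evaluation preserves composition, so the value of \<open>z\<close> at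
      \<open>f(gs)\<close> is \<open>[f, id, ..., id]\<close> composed with the lower copies of
      \<open>gs\<close>, that is, the class of \<open>(f, gs)\<close>.\<close>
    have r_Comp: "r (Comp M f gs) = collage_rep M (Mix f gs)"
      if c: "composable M f gs" and ar: "map (length \<circ> Dom M) gs = ms" for f gs
    proof -
      have len: "length gs = n" using ar by (auto simp: n_def)
      have f: "f \<in> Arr M" "length (Dom M f) = n" using c len by (simp_all add: composable_nth)
      have l: "same_arity M E gs (map ta ms)"
        using ta_dom(1) by (auto simp: list_all2_conv_all_nth simp flip: ar)
      have "map2 ea gs (map ta ms) = map Lo gs"
        using te c by (auto simp: composable_nth simp flip: ar intro!: nth_equalityI)
      moreover have "map (collage_rep M) (map Lo gs) = map Lo gs" by (simp add: collage_rep_simps)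
      ultimately show ?thesis
        using mbifunD(6)[OF universal_evD(3)[OF E] c zc l] xe[OF f]
          \<pi>(6)[OF composable_Mix_idents[OF c len]] Comp_Mix_idents[OF c, of n]
        by (metis r_def z_def)
    qed
    \<comment> \<open>The transposes of \<open>k \<circ> ev\<close> and \<open>b\<close> agree on the generic arrows, hence on their composite
      \<open>z\<close>.\<close>
    have r_functor: "ka (r h) = ba h (Mix n ms)"
      if N: "esmall_mcat TYPE('u) N" and k: "is_mfunctor ?K N ko ka" and b: "mbifun M ?R N bo ba"
        and o: "\<And>A \<beta>. A \<in> Obj M \<Longrightarrow> bo A ((), \<beta>) = ko (A, \<beta>)"
        and lo: "\<And>g. g \<in> Arr M \<Longrightarrow> ba g (Lo (length (Dom M g))) = ka (Lo g)"
        and up: "\<And>u. u \<in> ary M 1 \<Longrightarrow> ba u (Up 1) = ka (Up u)"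
        and mix: "\<And>f. f \<in> ary M n \<Longrightarrow> ba f (Mix n (replicate n 1)) = ka (collage_rep M (Mix f (idents
          f)))"
        and h: "h \<in> Arr M" "length (Dom M h) = sum_list ms"
      for N :: "('p, 'b) mcat" and ko ka bo ba h
    proof -
      \<comment> \<open>The assumptions on \<open>b\<close> only relate values on generic arrows;
        its value on \<open>Mix n ms\<close> is the point at issue. To compose the generic values at
        a fixed \<open>h\<close>, both bifunctors are transposed into the exponential
        \<open>E'\<close> of \<open>N\<close>: \<open>p\<close> maps \<open>E\<close> to
        \<open>E'\<close>, and \<open>q\<close> maps the terminal collage \<open>?R\<close> to
        \<open>E'\<close>.\<close>
      obtain E' eo' ea' where E': "universal_ev M N E' eo' ea'"
        using exponentiable_universal_ev[OF U sM ex N] .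
      interpret E': multicategory E' using universal_evD(2)[OF E'] .
      have bk: "mbifun M E N (\<lambda>A y. ko (eo A y)) (\<lambda>f e. ka (ea f e))"
        by (rule mbifun_mfunctor_left[OF universal_evD(3)[OF E] k])
      obtain po pa where p: "transposes M E E' eo' ea' (\<lambda>A y. ko (eo A y)) (\<lambda>f e. ka (ea f e)) po
        pa"
        by (rule universal_ev_transpose[OF U E' sE bk])
      obtain qo qa where q: "transposes M ?R E' eo' ea' bo ba qo qa"
        by (rule universal_ev_transpose[OF U E' eR b])
      note pF = mfunctorD[OF transposesD(1)[OF p]] and qF = mfunctorD[OF transposesD(1)[OF q]]
      interpret C: multicategory "comm UNIV" by (rule comm)
      have pt: "pa (ta m) = qa (Lo m)" for m
      proof -
        have 0: "mbifun M (comm UNIV) N (\<lambda>A y. ko (eo A (to y))) (\<lambda>f e. ka (ea f (ta e)))"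
          by (rule mbifun_mfunctor_right[OF bk transposesD(1)[OF t]])
        have 1: "transposes M (comm UNIV) E' eo' ea' (\<lambda>A y. ko (eo A (to y))) (\<lambda>f e. ka (ea f (ta
          e))) (po \<circ> to) (pa \<circ> ta)"
          by (rule transposes_compose[OF p transposesD(1)[OF t]])
        have 2: "transposes M (comm UNIV) E' eo' ea' (\<lambda>A y. ko (eo A (to y))) (\<lambda>f e. ka (ea f (ta
          e))) (qo \<circ> (\<lambda>A. (A, False))) (qa \<circ> Lo)"
          using transposes_compose[OF q C.mfunctor_Lo] o lo te transposesD(2)[OF t]
          by (auto simp: transposes_def comm_simps)
        have "(pa \<circ> ta) m = (qa \<circ> Lo) m"
          by (rule universal_ev_unique(2)[OF U E' eC 0 1 2]) (simp add: comm_simps)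
        then show ?thesis by simp
      qed
      have px: "pa (xa None) = qa (Mix n (replicate n 1))"
      proof -
        let ?F = "\<lambda>a. case a of None \<Rightarrow> Mix n (replicate n 1) | Some b \<Rightarrow> if b then Up 1 else Lo 1"
        have 0: "mbifun M (corolla n) N (\<lambda>A y. ko (eo A (xo y))) (\<lambda>f e. ka (ea f (xa e)))"
          by (rule mbifun_mfunctor_right[OF bk transposesD(1)[OF x]])
        have 1: "transposes M (corolla n) E' eo' ea' (\<lambda>A y. ko (eo A (xo y))) (\<lambda>f e. ka (ea f (xa
          e))) (po \<circ> xo) (pa \<circ> xa)"
          by (rule transposes_compose[OF p transposesD(1)[OF x]])
        have "ba f (?F a) = ka (ea f (xa a))"
          if f: "f \<in> Arr M" "length (Dom M f) = length (Dom (corolla n) a)" for f a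
        proof (cases a)
          case None
          then show ?thesis using f mix[of f] xe by (simp add: ary_def corolla_simps)
        next
          case (Some \<beta>)
          then have "f \<in> ary M 1" "length (Dom M f) = 1"
            using f by (simp_all add: ary_def corolla_simps)
          then show ?thesis using up[of f] lo[OF f(1)] transposesD(3)[OF x f(1), of a] f Some
            by (simp add: corolla_simps)
        qed
        then have 2: "transposes M (corolla n) E' eo' ea' (\<lambda>A y. ko (eo A (xo y))) (\<lambda>f e. ka (ea f
          (xa e))) (qo \<circ> Pair ()) (qa \<circ> ?F)"
          using transposes_compose[OF q mfunctor_corolla_collage] o transposesD(2)[OF x]
          by (auto simp: transposes_def corolla_simps(1))
        have "(pa \<circ> xa) None = (qa \<circ> ?F) None"
          by (rule universal_ev_unique(2)[OF U E' esmall_corolla[OF U] 0 1 2]) (simp add: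
            corolla_simps)
        then show ?thesis by simp
      qed
      have cm: "composable (comm UNIV) n ms" by (simp add: composable_nth comm_simps n_def)
      have idn: "C.idents n = replicate n 1" by (simp add: comm_simps)
      \<comment> \<open>\<open>p\<close> and \<open>q\<close> agree on the factors of
        \<open>z\<close> and of \<open>Mix n ms\<close>, and both preserve composition, so the two
        composites have the same image in \<open>E'\<close>.\<close>
      have "pa z = Comp E' (qa (Mix n (replicate n 1))) (map qa (map Lo ms))"
        using pF(6)[OF zc] pt px by (simp add: z_def comp_def)
      also have "\<dots> = qa (Mix n ms)"
        using qF(6)[OF C.composable_Mix_idents[OF cm n_def[symmetric]]] C.Comp_Mix_idents[OF cm,
          of n]
        by (simp only: idn)
      finally have "pa z = qa (Mix n ms)" .
      moreover have "ea' h (pa z) = ka (r h)"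
        using transposesD(3)[OF p h(1) zA] h(2) zdom by (simp add: r_def)
      moreover have "ea' h (qa (Mix n ms)) = ba h (Mix n ms)"
      proof -
        have "length (concat (map (Dom (comm UNIV)) ms)) = sum_list ms"
          by (induction ms) (auto simp: comm_simps)
        then show ?thesis
          using transposesD(3)[OF q h(1), of "Mix n ms"] h(2) cm by (simp add: collage_simps n_def)
      qed
      ultimately show ?thesis by simp
    qed
    have surj: "\<exists>f gs. r h = Mix f gs \<and> composable M f gs \<and> map (length \<circ> Dom M) gs = ms \<and>
      Comp M f gs = h"
      if h: "h \<in> Arr M" "length (Dom M h) = sum_list ms" for h
    proof -
      let ?q = "\<lambda>a. case a of Mix f gs \<Rightarrow> Comp M f gs | _ \<Rightarrow> base a"
      let ?p = "map_collage (\<lambda>f. length (Dom M f))"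
      have MixA: "\<exists>f' gs'. collage_rep M (Mix f gs) = Mix f' gs' \<and> Comp M f' gs' = Comp M f gs \<and>
        map (Dom M) gs' = map (Dom M) gs"
        if "composable M f gs" for f gs
      proof -
        have "(f, gs) \<in> decomps M (map (Dom M) gs) (Cod M f)" using that by (simp add: decomps_def)
        then obtain f' gs' where *: "collage_rep M (Mix f gs) = Mix f' gs'"
          "((f, gs), (f', gs')) \<in> coend_rel M (map (Dom M) gs) (Cod M f)"
          by (rule collage_rep_rel)
        then show ?thesis using coend_rel_Comp[OF *(2)] by (auto simp: coend_rel_def decomps_def)
      qed
      have q_rep: "?q (collage_rep M a) = ?q a" if "a \<in> Arr ?D" for a
        using that MixA by (cases a) (fastforce simp: collage_rep_simps collage_simps)+
      have p_rep: "?p (collage_rep M a) = ?p a" if a: "a \<in> Arr ?D" for a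
      proof (cases a)
        case (Mix f gs)
        then have c: "composable M f gs" using a by (simp add: collage_simps)
        obtain f' gs' where *: "collage_rep M (Mix f gs) = Mix f' gs'" "map (Dom M) gs' =
          map (Dom M) gs"
          using MixA[OF c] by blast
        have "composable M f' gs'" using Q.rep_simps(1)[OF a] *(1) Mix by (simp add: collage_simps)
        then have "length (Dom M f') = length (Dom M f)"
          using c *(2) by (metis composableD(4) length_map)
        moreover have "map (\<lambda>f. length (Dom M f)) gs' = map (\<lambda>f. length (Dom M f)) gs"
          using arg_cong[OF *(2), of "map length"] by (simp add: comp_def)
        ultimately show ?thesis using *(1) Mix by simp
      qed (simp_all add: collage_rep_simps)
      have qF: "is_mfunctor ?K M fst ?q"
        by (rule Q.mfunctor_from_mquot[OF mfunctor_collage_collapse q_rep])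
      have pF: "is_mfunctor ?K ?R (\<lambda>(A, b). ((), b)) ?p"
        by (rule Q.mfunctor_from_mquot[OF mfunctor_collage[OF multicategory_axioms mfunctor_arity]
          p_rep])
      have MixI: "Mix f (idents f) \<in> Arr ?D" if "f \<in> ary M n" for f
        using that idents_simps[of f] by (simp add: collage_simps ary_def)
      \<comment> \<open>First comparison, with \<open>N = M\<close>: composing formal composites
        against projecting to the factor \<open>M\<close>. They agree on generic arrows because
        \<open>f(id, ..., id) = f\<close>, and the projection returns \<open>h\<close>.\<close>
      have 1: "?q (r h) = h"
        using idents_simps q_rep[OF MixI] h
        by (intro r_functor[OF eM qF mbifun_fst[OF mfunctor_id[OF multicategory_axioms]],
          simplified])
          (auto simp: ary_def)
      have ids: "map (\<lambda>f. length (Dom M f)) (idents f) = replicate (length (Dom M f)) 1"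
        if "f \<in> Arr M" for f
        using dom_obj[OF that] ident_simps(2) by (auto simp: subset_iff intro!: nth_equalityI)
      have eRm: "multicategory ?R" using eR by (simp add: esmall_mcat_def)
      \<comment> \<open>Second comparison, with \<open>N = ?R\<close>: taking arities against
        projecting to the factor \<open>?R\<close>. It shows that \<open>r h\<close> is a mixed
        arrow with inner arities \<open>ms\<close>, information that \<open>?q\<close>
        forgets.\<close>
      have "?p (r h) = id (Mix n ms)"
      proof (rule r_functor[OF eR pF mbifun_snd[OF mfunctor_id[OF eRm]]])
        fix f assume f: "f \<in> ary M n"
        then show "id (Mix n (replicate n 1)) = ?p (collage_rep M (Mix f (idents f)))"
          using p_rep[OF MixI[OF f]] ids[of f] by (simp add: ary_def del: map_map)
      qed (use h in \<open>simp_all add: ary_def\<close>)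
      then have 2: "?p (r h) = Mix n ms" by simp
      have "r h \<in> Arr ?K" using mbifunD(2)[OF universal_evD(3)[OF E] h(1) zA] h(2) zdom
        by (simp add: r_def)
      then have rD: "r h \<in> Arr ?D" by (simp add: Q.mquot_Arr)
      obtain f gs where fgs: "r h = Mix f gs" "map (\<lambda>f. length (Dom M f)) gs = ms"
        using 2 by (cases "r h") auto
      then show ?thesis using 1 rD by (auto simp: collage_simps comp_def)
    qed
    show ?thesis using r_Comp surj by blast
  qed
  show ?thesis unfolding promonoidal_iff
  proof (intro conjI ballI allI impI)
    fix h \<Gamma>s assume h: "h \<in> Arr M" "concat \<Gamma>s = Dom M h"
    have "length (Dom M h) = sum_list (map length \<Gamma>s)" by (simp add: length_concat flip: h(2))
    then obtain f gs where c: "composable M f gs" "map (length \<circ> Dom M) gs = map length \<Gamma>s"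
      "Comp M f gs = h"
      using key[of "map length \<Gamma>s"] h(1) by blast
    \<comment> \<open>Two ways of cutting \<open>Dom M h\<close> with the same block lengths
      coincide.\<close>
    have "map (Dom M) gs = \<Gamma>s"
    proof (rule concat_eq_iff_lengths[THEN iffD1])
      show "map length (map (Dom M) gs) = map length \<Gamma>s" using c(2) by simp
      show "concat (map (Dom M) gs) = concat \<Gamma>s" using comp_simps(2)[OF c(1)] c(3) h(2) by simp
    qed
    then show "\<exists>f gs. composable M f gs \<and> map (Dom M) gs = \<Gamma>s \<and> Comp M f gs = h" using c by blast
  next
    fix \<Gamma>s B f gs f' gs'
    assume *: "(f, gs) \<in> decomps M \<Gamma>s B \<and> (f', gs') \<in> decomps M \<Gamma>s B \<and> Comp M f gs = Comp M f' gs'"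
    have ar: "composable M f gs \<and> map (length \<circ> Dom M) gs = map length \<Gamma>s"
      if "(f, gs) \<in> decomps M \<Gamma>s B" for f gs
      using that by (auto simp: decomps_def)
    obtain r where r: "\<And>f gs. composable M f gs \<and> map (length \<circ> Dom M) gs = map length \<Gamma>s \<Longrightarrow>
      r (Comp M f gs) = collage_rep M (Mix f gs)"
      using key[of "map length \<Gamma>s"] by blast
    \<comment> \<open>Both sides are the value of \<open>r\<close> at the common composite. A common
      representative then links the two decompositions.\<close>
    have "collage_rep M (Mix f gs) = collage_rep M (Mix f' gs')"
      using r[OF ar] * by metis
    moreover obtain k ks where "collage_rep M (Mix f gs) = Mix k ks" "((f, gs), (k, ks)) \<in> coend_rel
      M \<Gamma>s B"
      using collage_rep_rel * by metis
    moreover obtain k' ks' where "collage_rep M (Mix f' gs') = Mix k' ks'" "((f', gs'), (k',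
      ks')) \<in> coend_rel M \<Gamma>s B"
      using collage_rep_rel * by metis
    ultimately show "((f, gs), (f', gs')) \<in> coend_rel M \<Gamma>s B"
      using equiv_coend_rel[of \<Gamma>s B] by (metis collage.inject(3) equiv_def symE transE)
  qed
qed

theorem proposition2p9:
  assumes "universe TYPE('u)"
  shows "(\<forall>M :: ('u, 'u) mcat. small_multicategory M \<longrightarrow> (exponentiable M \<longleftrightarrow> promonoidal M)) \<and>
         (\<forall>M :: ('u, 'u) mcat. small_multicategory M \<and> representable M \<longrightarrow> exponentiable M) \<and>
         (\<forall>M :: ('u, 'u) mcat. small_multicategory M \<and> sequential M \<longrightarrow> exponentiable M) \<and>
         (\<forall>C :: ('u, 'u) cat. small_category C \<and> Ob C \<noteq> {} \<longrightarrow> \<not> exponentiable (unary_mcat C))"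
proof -
  have m: "multicategory M" if "small_multicategory M" for M :: "('u, 'u) mcat"
    using that by (simp add: small_multicategory_def)
  have iff: "exponentiable M \<longleftrightarrow> promonoidal M" if "small_multicategory M" for M :: "('u, 'u) mcat"
    using that exponentiable_imp_promonoidal promonoidal_imp_exponentiable assms by blast
  show ?thesis
    using iff m representable_imp_promonoidal sequential_imp_promonoidal
      small_unary_mcat[OF assms] not_promonoidal_unary_mcat[OF assms] by blast
qed

end
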